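(* Let $\mathbf{g}$ be an elliptic Darboux integrable Lorentzian metric with a spacelike Killing field on $M$. Then up to local coordinate transformations on $M$, $\mathbf{g}$ is locally equivalent to one of the following: 1. $\mathbf{g}=\cosh^4u\,(du)^2-\sinh^2u\,(dv)^2$, with $K=\operatorname{sech}^4u$; 2. $\mathbf{g}=\sinh^4u\,(du)^2-\cosh^2u\,(dv)^2$, with $K=\operatorname{csch}^4u$; 3. $\mathbf{g}=u^2\left((du)^2-(dv)^2\right)$, with $K=u^{-4}$.
   Context: $M$ is a Lorentzian surface with orthonormal frame bundle $\mathcal{F}_M$, canonical dual forms $\eta^1,\eta^2$ (so $\mathbf{g}=(\eta^1)^2-(\eta^2)^2$) and connection form $\eta^1_2=\eta^2_1$ satisfying $$d\eta^1=-\eta^1_2\wedge\eta^2,\quad d\eta^2=-\eta^2_1\wedge\eta^1,\quad d\eta^1_2=-K\,\eta^1\wedge\eta^2,$$ which fixes the sign convention for the Gauss curvature $K$. The metric is elliptic if $K>0$ and hyperbolic if $K<0$. A vector $X$ is spacelike if $\langle X,X\rangle<0$ and timelike if $\langle X,X\rangle>0$. The Killing field meant is $V=q_1v_2-q_2v_1$, where $q=|K|^{-3/4}$, $dq=q_1\eta^1+q_2\eta^2$ and $(v_1,v_2)$ is the orthonormal framing of $M$ dual to $(\eta^1,\eta^2)$ ($V$ is a Killing field whenever $\mathbf{g}$ is Darboux integrable). $\mathbb{R}^{1,2}$ is $\mathbb{R}^3$ with inner product of signature $(1,2)$. $\mathcal{F}_{\mathbb{R}^{1,2}}$ is the bundle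 of orthonormal frames $(e_1,e_2,e_3)$ with $\langle e_1,e_1\rangle=1$, $\langle e_2,e_2\rangle=\langle e_3,e_3\rangle=-1$, $\langle e_a,e_b\rangle=0$ for $a\ne b$; with basepoint map $\rho$, its canonical and connection forms are defined by $d\rho=e_i\omega^i$, $de_i=e_j\omega^j_i$. The isometric embedding system $\mathcal{I}$ is the Pfaffian exterior differential system on $\mathcal{F}_M\times\mathcal{F}_{\mathbb{R}^{1,2}}$ generated by $\theta_0=\omega^3$, $\theta_1=\omega^1-\eta^1$, $\theta_2=\omega^2-\eta^2$, $\theta_3=\omega^1_2-\eta^1_2$. Put $k=\sqrt{|K|}$. If $K<0$, its singular systems are $V_\pm=\operatorname{span}\{\theta_0,\theta_1,\theta_2,\theta_3,\omega^3_1\mp k\eta^2,\omega^3_2\pm k\eta^1\}$; if $K>0$, they are $W=\operatorname{span}_{\mathbb{C}}\{\theta_0,\theta_1,\theta_2,\theta_3,\omega^3_1-\mathrm{i}k\eta^2,\omega^3_2+\mathrm{i}k\eta^1\}$ in the complexified cotangent bundle and its conjugate $\overline{W}$. The metric $\mathbf{g}$ is Darboux integrable if, locally, each of the two singular systems contains a (real, respectively complex) Frobenius subbundle of rank at least $2$ that intersects the span of $\theta_0,\theta_1,\theta_2,\theta_3$ only in $0$.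
   Formalization: In cases 1 and 2 the metric is the stated one multiplied by a constant c>0, with K divided by c; as printed the claim fails, since e.g. 4 times metric 1 satisfies all hypotheses but is isometric to none of the three forms. *)

theory Defs
  imports "HOL-Analysis.Analysis"
begin

subsection \<open>Smooth functions and differential forms\<close>

text \<open>Only used for open \<open>S\<close>.\<close>

primrec Ck_on :: "nat \<Rightarrow> 'a::euclidean_space set \<Rightarrow> ('a \<Rightarrow> 'b::real_normed_vector) \<Rightarrow> bool" where
  "Ck_on 0 S f \<longleftrightarrow> continuous_on S f"
| "Ck_on (Suc k) S f \<longleftrightarrow>
     (\<forall>x\<in>S. f differentiable (at x)) \<and> (\<forall>v. Ck_on k S (\<lambda>x. frechet_derivative f (at x) v))"

definition smooth_on :: "'a::euclidean_space set \<Rightarrow> ('a \<Rightarrow> 'b::real_normed_vector) \<Rightarrow> bool" where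
  "smooth_on S f \<longleftrightarrow> (\<forall>k. Ck_on k S f)"

text \<open>
  A 1-form assigns to a point a (real-linear) functional on vectors; its values are real or complex,
  the latter for sections of the complexified cotangent bundle. The manifolds on which forms live
  below are embedded submanifolds \<open>N\<close> of a Euclidean space \<open>E\<close>. A form on \<open>N\<close> is represented by
  a form on an open subset of \<open>E\<close>, and only its restriction to the tangent spaces of \<open>N\<close> matters:
  restriction to \<open>N\<close> commutes with the exterior derivative, and every smooth form on \<open>N\<close> extends locally.
\<close>

definition smooth_form :: "'e::euclidean_space set \<Rightarrow> ('e \<Rightarrow> 'e \<Rightarrow> 'b::real_normed_vector) \<Rightarrow> bool" where
  "smooth_form W \<alpha> \<longleftrightarrow> (\<forall>q\<in>W. linear (\<alpha> q)) \<and> (\<forall>X. smooth_on W (\<lambda>q. \<alpha> q X))"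

definition wedge :: "('e \<Rightarrow> 'b::comm_ring) \<Rightarrow> ('e \<Rightarrow> 'b) \<Rightarrow> 'e \<Rightarrow> 'e \<Rightarrow> 'b" where
  "wedge a b X Y = a X * b Y - a Y * b X"

definition ext_d :: "('e::euclidean_space \<Rightarrow> 'e \<Rightarrow> 'b::real_normed_vector) \<Rightarrow> 'e \<Rightarrow> 'e \<Rightarrow> 'e \<Rightarrow> 'b" where
  "ext_d \<alpha> p X Y =
     frechet_derivative (\<lambda>q. \<alpha> q Y) (at p) X - frechet_derivative (\<lambda>q. \<alpha> q X) (at p) Y"

definition tangent_space :: "'e::euclidean_space set \<Rightarrow> 'e \<Rightarrow> 'e set" where
  "tangent_space N p =
     {X. \<exists>\<gamma>. \<gamma> 0 = p \<and> (\<forall>\<^sub>F t in nhds (0::real). \<gamma> t \<in> N) \<and> (\<gamma> has_vector_derivative X) (at 0)}"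

definition in_span_on :: "'e set \<Rightarrow> ('e \<Rightarrow> 'b::field) list \<Rightarrow> ('e \<Rightarrow> 'b) \<Rightarrow> bool" where
  "in_span_on T ws v \<longleftrightarrow> (\<exists>c. \<forall>X\<in>T. v X = (\<Sum>i<length ws. c i * (ws ! i) X))"

definition independent_on :: "'e set \<Rightarrow> ('e \<Rightarrow> 'b::field) list \<Rightarrow> bool" where
  "independent_on T ws \<longleftrightarrow>
     (\<forall>c. (\<forall>X\<in>T. (\<Sum>i<length ws. c i * (ws ! i) X) = 0) \<longrightarrow> (\<forall>i<length ws. c i = 0))"

definition forms_at :: "('e \<Rightarrow> 'e \<Rightarrow> 'b) list \<Rightarrow> 'e \<Rightarrow> ('e \<Rightarrow> 'b) list" where
  "forms_at \<alpha>s q = map (\<lambda>\<alpha>. \<alpha> q) \<alpha>s"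

text \<open>
  \<open>\<alpha>s\<close> is a local frame, over \<open>N \<inter> W\<close>, of a Frobenius subbundle of the (complexified) cotangent
  bundle of \<open>N\<close>, of rank \<open>length \<alpha>s\<close>: each \<open>d\<alpha>\<close> is a sum of \<open>\<beta>\<^sub>j \<and> \<alpha>\<^sub>j\<close>.
\<close>

definition frobenius_frame ::
    "'e::euclidean_space set \<Rightarrow> 'e set \<Rightarrow> ('e \<Rightarrow> 'e \<Rightarrow> 'b::real_normed_field) list \<Rightarrow> bool" where
  "frobenius_frame N W \<alpha>s \<longleftrightarrow>
     (\<forall>\<alpha>\<in>set \<alpha>s. smooth_form W \<alpha>) \<and>
     (\<forall>q\<in>N \<inter> W. independent_on (tangent_space N q) (forms_at \<alpha>s q) \<and>
       (\<forall>\<alpha>\<in>set \<alpha>s. \<exists>\<beta>. (\<forall>j<length \<alpha>s. linear (\<beta> j)) \<and>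
          (\<forall>X\<in>tangent_space N q. \<forall>Y\<in>tangent_space N q.
             ext_d \<alpha> q X Y = (\<Sum>j<length \<alpha>s. wedge (\<beta> j) ((\<alpha>s ! j) q) X Y))))"

definition contains_transversal_frobenius ::
    "'e::euclidean_space set \<Rightarrow> ('e \<Rightarrow> 'e \<Rightarrow> 'b::real_normed_field) list \<Rightarrow> ('e \<Rightarrow> 'e \<Rightarrow> 'b) list \<Rightarrow> bool" where
  "contains_transversal_frobenius N \<theta>s \<sigma>s \<longleftrightarrow>
     (\<forall>p\<in>N. \<exists>W \<alpha>s. open W \<and> p \<in> W \<and> length \<alpha>s \<ge> 2 \<and> frobenius_frame N W \<alpha>s \<and>
       (\<forall>q\<in>N \<inter> W.
          (\<forall>\<alpha>\<in>set \<alpha>s. in_span_on (tangent_space N q) (forms_at \<sigma>s q) (\<alpha> q)) \<and>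
          (\<forall>v. in_span_on (tangent_space N q) (forms_at \<alpha>s q) v \<and>
               in_span_on (tangent_space N q) (forms_at \<theta>s q) v
               \<longrightarrow> (\<forall>X\<in>tangent_space N q. v X = 0))))"


subsection \<open>Orthonormal frame bundles\<close>

text \<open>The signatures \<open>(1,-1)\<close> and \<open>(1,-1,-1)\<close>, for index types \<open>2\<close> and \<open>3\<close>.\<close>

definition eps :: "'n::one \<Rightarrow> real" where
  "eps i = (if i = 1 then 1 else -1)"

text \<open>A metric on an open subset of the plane: the bilinear form \<open>g x\<close> on tangent vectors at \<open>x\<close>.\<close>

type_synonym metric2 = "real^2 \<Rightarrow> real^2 \<Rightarrow> real^2 \<Rightarrow> real"

text \<open>Frames \<open>(x, v)\<close> with vectors \<open>v $ 1\<close>, \<open>v $ 2\<close> at \<open>x\<close>, and similarly in 3-space.\<close>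

type_synonym frame2 = "(real^2) \<times> ((real^2)^2)"
type_synonym frame3 = "(real^3) \<times> ((real^3)^3)"

definition frame_bundle :: "(real^2) set \<Rightarrow> metric2 \<Rightarrow> frame2 set" where
  "frame_bundle D g =
     {(x, v). x \<in> D \<and> (\<forall>i j. g x (v $ i) (v $ j) = (if i = j then eps i else 0))}"

text \<open>The forms \<open>\<eta>\<^sup>i\<close> with \<open>dx = v\<^sub>i \<eta>\<^sup>i\<close>, solved for \<open>\<eta>\<^sup>i\<close> by orthonormality.\<close>

definition eta :: "metric2 \<Rightarrow> 2 \<Rightarrow> frame2 \<Rightarrow> frame2 \<Rightarrow> real" where
  "eta g i f X = eps i * g (fst f) (snd f $ i) (fst X)"

text \<open>
  \<open>\<beta>\<close> is the connection form \<open>\<eta>\<^sup>1\<^sub>2 = \<eta>\<^sup>2\<^sub>1\<close> on the frame bundle and \<open>\<kappa>\<close> is the Gauss curvature.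
  The first two equations determine \<open>\<beta>\<close> on the tangent spaces, and the third one then determines \<open>\<kappa>\<close>.
\<close>

definition structure_equations ::
    "(real^2) set \<Rightarrow> metric2 \<Rightarrow> (frame2 \<Rightarrow> frame2 \<Rightarrow> real) \<Rightarrow> (real^2 \<Rightarrow> real) \<Rightarrow> bool" where
  "structure_equations D g \<beta> \<kappa> \<longleftrightarrow>
     smooth_form (D \<times> UNIV) \<beta> \<and>
     (\<forall>f\<in>frame_bundle D g.
        \<forall>X\<in>tangent_space (frame_bundle D g) f. \<forall>Y\<in>tangent_space (frame_bundle D g) f.
          ext_d (eta g 1) f X Y = - wedge (\<beta> f) (eta g 2 f) X Y \<and>
          ext_d (eta g 2) f X Y = - wedge (\<beta> f) (eta g 1 f) X Y \<and>
          ext_d \<beta> f X Y = - \<kappa> (fst f) * wedge (eta g 1 f) (eta g 2 f) X Y)"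

definition mink :: "real^3 \<Rightarrow> real^3 \<Rightarrow> real" where
  "mink X Y = (\<Sum>i\<in>UNIV. eps i * X $ i * Y $ i)"

definition mink_frames :: "frame3 set" where
  "mink_frames = {(\<rho>, e). \<forall>i j. mink (e $ i) (e $ j) = (if i = j then eps i else 0)}"

text \<open>
  \<open>omega i\<close> is \<open>\<omega>\<^sup>i\<close> and \<open>omega_conn j i\<close> is \<open>\<omega>\<^sup>j\<^sub>i\<close>, obtained from \<open>d\<rho> = e\<^sub>i \<omega>\<^sup>i\<close> and
  \<open>de\<^sub>i = e\<^sub>j \<omega>\<^sup>j\<^sub>i\<close> by orthonormality.
\<close>

definition omega :: "3 \<Rightarrow> frame3 \<Rightarrow> frame3 \<Rightarrow> real" where
  "omega i f X = eps i * mink (snd f $ i) (fst X)"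

definition omega_conn :: "3 \<Rightarrow> 3 \<Rightarrow> frame3 \<Rightarrow> frame3 \<Rightarrow> real" where
  "omega_conn j i f X = eps j * mink (snd f $ j) (snd X $ i)"


subsection \<open>The isometric embedding system and Darboux integrability\<close>

definition theta_forms ::
    "metric2 \<Rightarrow> (frame2 \<Rightarrow> frame2 \<Rightarrow> real)
     \<Rightarrow> (frame2 \<times> frame3 \<Rightarrow> frame2 \<times> frame3 \<Rightarrow> 'b::real_normed_field) list" where
  "theta_forms g \<beta> =
     [\<lambda>p X. of_real (omega 3 (snd p) (snd X)),
      \<lambda>p X. of_real (omega 1 (snd p) (snd X) - eta g 1 (fst p) (fst X)),
      \<lambda>p X. of_real (omega 2 (snd p) (snd X) - eta g 2 (fst p) (fst X)),
      \<lambda>p X. of_real (omega_conn 1 2 (snd p) (snd X) - \<beta> (fst p) (fst X))]"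

text \<open>
  The singular systems: \<open>V\<^sub>+\<close>, \<open>V\<^sub>-\<close> for \<open>s = 1, -1\<close> over the reals, and \<open>W\<close> and its conjugate
  for \<open>s = \<i>, -\<i>\<close> over the complex numbers.
\<close>

definition singular_forms ::
    "metric2 \<Rightarrow> (frame2 \<Rightarrow> frame2 \<Rightarrow> real) \<Rightarrow> (real^2 \<Rightarrow> real) \<Rightarrow> 'b
     \<Rightarrow> (frame2 \<times> frame3 \<Rightarrow> frame2 \<times> frame3 \<Rightarrow> 'b::real_normed_field) list" where
  "singular_forms g \<beta> \<kappa> s =
     (let k = (\<lambda>p. sqrt \<bar>\<kappa> (fst (fst p))\<bar>) in
      theta_forms g \<beta> @
      [\<lambda>p X. of_real (omega_conn 3 1 (snd p) (snd X)) - s * of_real (k p * eta g 2 (fst p) (fst X)),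
       \<lambda>p X. of_real (omega_conn 3 2 (snd p) (snd X)) + s * of_real (k p * eta g 1 (fst p) (fst X))])"

definition darboux_integrable_chart ::
    "(real^2) set \<Rightarrow> metric2 \<Rightarrow> (frame2 \<Rightarrow> frame2 \<Rightarrow> real) \<Rightarrow> (real^2 \<Rightarrow> real) \<Rightarrow> bool" where
  "darboux_integrable_chart D g \<beta> \<kappa> \<longleftrightarrow>
     (let N = frame_bundle D g \<times> mink_frames in
      (\<forall>x\<in>D. \<kappa> x < 0) \<and>
        (\<forall>s\<in>{1, - 1 :: real}.
           contains_transversal_frobenius N (theta_forms g \<beta>) (singular_forms g \<beta> \<kappa> s)) \<or>
      (\<forall>x\<in>D. \<kappa> x > 0) \<and>
        (\<forall>s\<in>{\<i>, - \<i>}.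
           contains_transversal_frobenius N (theta_forms g \<beta>) (singular_forms g \<beta> \<kappa> s)))"

text \<open>
  The vector field \<open>V = q\<^sub>1 v\<^sub>2 - q\<^sub>2 v\<^sub>1\<close> with \<open>q = \<bar>K\<bar>\<^sup>-\<^sup>3\<^sup>/\<^sup>4\<close> and \<open>q\<^sub>i = dq(v\<^sub>i)\<close>, computed
  in the orthonormal frame \<open>f = (x, v)\<close>. Up to sign it does not depend on the frame at \<open>x\<close>.
\<close>

definition killing_vector :: "(real^2 \<Rightarrow> real) \<Rightarrow> frame2 \<Rightarrow> real^2" where
  "killing_vector \<kappa> f =
     (let dq = frechet_derivative (\<lambda>y. \<bar>\<kappa> y\<bar> powr (-3/4)) (at (fst f)); v = snd f
      in dq (v $ 1) *\<^sub>R v $ 2 - dq (v $ 2) *\<^sub>R v $ 1)"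


subsection \<open>Lorentzian surfaces\<close>

type_synonym 'a chart = "'a set \<times> ('a \<Rightarrow> real^2)"

definition chart_image :: "'a chart \<Rightarrow> (real^2) set" where
  "chart_image c = snd c ` fst c"

definition in_chart :: "'a chart \<Rightarrow> ('a \<Rightarrow> 'b) \<Rightarrow> real^2 \<Rightarrow> 'b" where
  "in_chart c f = f \<circ> inv_into (fst c) (snd c)"

definition is_chart :: "'a topology \<Rightarrow> 'a chart \<Rightarrow> bool" where
  "is_chart M c \<longleftrightarrow> openin M (fst c) \<and> open (chart_image c) \<and>
     homeomorphic_map (subtopology M (fst c)) (top_of_set (chart_image c)) (snd c)"

definition overlap :: "'a chart \<Rightarrow> 'a chart \<Rightarrow> (real^2) set" where
  "overlap c c' = snd c ` (fst c \<inter> fst c')"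

definition transition :: "'a chart \<Rightarrow> 'a chart \<Rightarrow> real^2 \<Rightarrow> real^2" where
  "transition c c' = in_chart c (snd c')"

definition charts_compatible :: "'a chart \<Rightarrow> 'a chart \<Rightarrow> bool" where
  "charts_compatible c c' \<longleftrightarrow>
     smooth_on (overlap c c') (transition c c') \<and> smooth_on (overlap c' c) (transition c' c)"

definition smooth_surface :: "'a topology \<Rightarrow> 'a chart set \<Rightarrow> bool" where
  "smooth_surface M A \<longleftrightarrow>
     Hausdorff_space M \<and> second_countable M \<and>
     (\<forall>c\<in>A. is_chart M c) \<and> (\<Union>c\<in>A. fst c) = topspace M \<and>
     (\<forall>c\<in>A. \<forall>c'\<in>A. charts_compatible c c')"

definition lorentz_metric_on :: "(real^2) set \<Rightarrow> metric2 \<Rightarrow> bool" where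
  "lorentz_metric_on D g \<longleftrightarrow>
     (\<forall>x\<in>D. bilinear (g x) \<and> (\<forall>X Y. g x X Y = g x Y X) \<and>
        (\<exists>X Y. g x X X = 1 \<and> g x Y Y = -1 \<and> g x X Y = 0)) \<and>
     (\<forall>X Y. smooth_on D (\<lambda>x. g x X Y))"

text \<open>\<open>g\<close> and \<open>g'\<close>, given in the charts \<open>c\<close> and \<open>c'\<close>, represent the same metric on the overlap.\<close>

definition metrics_agree :: "'a chart \<Rightarrow> 'a chart \<Rightarrow> metric2 \<Rightarrow> metric2 \<Rightarrow> bool" where
  "metrics_agree c c' g g' \<longleftrightarrow>
     (\<forall>x\<in>overlap c c'. \<forall>X Y.
        let d = frechet_derivative (transition c c') (at x)
        in g x X Y = g' (transition c c' x) (d X) (d Y))"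

definition lorentzian_surface :: "'a topology \<Rightarrow> 'a chart set \<Rightarrow> ('a chart \<Rightarrow> metric2) \<Rightarrow> bool" where
  "lorentzian_surface M A g \<longleftrightarrow>
     smooth_surface M A \<and>
     (\<forall>c\<in>A. lorentz_metric_on (chart_image c) (g c)) \<and>
     (\<forall>c\<in>A. \<forall>c'\<in>A. metrics_agree c c' (g c) (g c'))"

definition connection_and_curvature ::
    "'a chart set \<Rightarrow> ('a chart \<Rightarrow> metric2) \<Rightarrow> ('a chart \<Rightarrow> frame2 \<Rightarrow> frame2 \<Rightarrow> real)
     \<Rightarrow> ('a \<Rightarrow> real) \<Rightarrow> bool" where
  "connection_and_curvature A g \<beta> K \<longleftrightarrow>
     (\<forall>c\<in>A. structure_equations (chart_image c) (g c) (\<beta> c) (in_chart c K))"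

definition elliptic :: "'a topology \<Rightarrow> ('a \<Rightarrow> real) \<Rightarrow> bool" where
  "elliptic M K \<longleftrightarrow> (\<forall>x\<in>topspace M. K x > 0)"

definition darboux_integrable ::
    "'a chart set \<Rightarrow> ('a chart \<Rightarrow> metric2) \<Rightarrow> ('a chart \<Rightarrow> frame2 \<Rightarrow> frame2 \<Rightarrow> real)
     \<Rightarrow> ('a \<Rightarrow> real) \<Rightarrow> bool" where
  "darboux_integrable A g \<beta> K \<longleftrightarrow>
     (\<forall>c\<in>A. darboux_integrable_chart (chart_image c) (g c) (\<beta> c) (in_chart c K))"

text \<open>In this signature convention spacelike vectors are those with negative square.\<close>

definition spacelike_killing_field ::
    "'a chart set \<Rightarrow> ('a chart \<Rightarrow> metric2) \<Rightarrow> ('a \<Rightarrow> real) \<Rightarrow> bool" where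
  "spacelike_killing_field A g K \<longleftrightarrow>
     (\<forall>c\<in>A. \<forall>f\<in>frame_bundle (chart_image c) (g c).
        let V = killing_vector (in_chart c K) f in g c (fst f) V V < 0)"

text \<open>The metric \<open>a(u) du\<^sup>2 - b(u) dv\<^sup>2\<close> in coordinates \<open>(u,v)\<close>.\<close>

definition diag_metric :: "(real \<Rightarrow> real) \<Rightarrow> (real \<Rightarrow> real) \<Rightarrow> metric2" where
  "diag_metric a b w X Y = a (w $ 1) * X $ 1 * Y $ 1 - b (w $ 1) * X $ 2 * Y $ 2"

text \<open>
  Around each point of \<open>S\<close> there are smooth local coordinates \<open>(u,v)\<close> on \<open>M\<close> in which the metric
  is \<open>h\<close> and the curvature is \<open>k(u)\<close>.
\<close>

definition locally_equivalent_on ::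
    "'a topology \<Rightarrow> 'a chart set \<Rightarrow> ('a chart \<Rightarrow> metric2) \<Rightarrow> ('a \<Rightarrow> real) \<Rightarrow> 'a set
     \<Rightarrow> metric2 \<Rightarrow> (real \<Rightarrow> real) \<Rightarrow> bool" where
  "locally_equivalent_on M A g K S h k \<longleftrightarrow>
     (\<forall>p\<in>S. \<exists>c'. is_chart M c' \<and> p \<in> fst c' \<and>
        (\<forall>c\<in>A. charts_compatible c c' \<and> metrics_agree c c' (g c) h) \<and>
        (\<forall>x\<in>fst c'. K x = k (snd c' x $ 1)))"

end

theory Submission
  imports Defs
begin

text \<open>
  Fix an orthonormal frame field \<open>E\<close> on \<open>M\<close> and restrict the Frobenius subbundle to the image of \<open>E\<close>
  times the frames of \<open>\<real>\<^sup>1\<^sup>,\<^sup>2\<close>. The annihilator of the singular system contains two complex vector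
  fields of the form \<open>E\<^sub>i + \<xi>\<^sub>i\<close>, where \<open>\<xi>\<^sub>i\<close> is a function on \<open>M\<close> with values in the complexified Lie algebra of
  isometries, acting by left-invariant vector fields. Sections annihilated by a Frobenius system are closed
  under brackets, and all iterated brackets are again of this form, so Darboux integrability becomes
  a statement about pointwise linear functionals on the Lie algebra. In a frame adapted to the gradient of \<open>K\<close>
  a few brackets, together with transversality to the \<open>\<theta>\<^sub>i\<close>, force \<open>q = K\<^sup>-\<^sup>3\<^sup>/\<^sup>4\<close> to satisfy
  \<open>Hess q = 3 q\<^sup>-\<^sup>1\<^sup>/\<^sup>3 g\<close>.

  For \<open>u = K\<^sup>-\<^sup>1\<^sup>/\<^sup>4\<close> this gives the first integral \<open>J = u\<^sup>4 \<bar>\<nabla>u\<bar>\<^sup>2 - u\<^sup>2\<close> and a closed form \<open>dv\<close>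
  with \<open>g = u\<^sup>4 du\<^sup>2 / (u\<^sup>2 + J) - (u\<^sup>2 + J) dv\<^sup>2\<close>. Since \<open>J\<close> is independent of charts and locally constant,
  it is constant on each component, and its sign selects the normal form.
\<close>

subsection \<open>Calculus of smooth functions\<close>

text \<open>Over the image of \<open>E\<close> times the Minkowski frames there are 2 + 6
  directions, so a subbundle of rank 2 leaves room for at most six annihilated fields. The two
  fields \<open>E\<^sub>i + \<xi>\<^sub>i\<close> and four bracket sections fill this room; any
  further bracket must be a combination of them, and every coefficient that obstructs this is an
  equation on the metric. Transversality is used in one form: the values of the subbundle on the
  last two generators of the isometry algebra fill complex 2-space, so a bracket reduced to these
  two generators has zero coefficients. The reduction divides by \<open>k\<close> (the square root
  of \<open>K\<close>) and by \<open>a\<close>, half the derivative of \<open>ln k\<close> along the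
  gradient direction. A spacelike Killing field means that the gradient of \<open>K\<close> is
  timelike, which yields both the adapted frame and \<open>a\<close> nonzero. The factor
  \<open>c = J^2\<close> in the first two normal forms cannot be removed by a change of coordinates:
  \<open>J\<close> is determined by the metric, and multiplying the metric by a constant multiplies
  \<open>J^2\<close> by it. For \<open>J = 0\<close> a common dilation of \<open>u\<close> and
  \<open>v\<close> absorbs the factor.\<close>

abbreviation fderiv :: "('a::real_normed_vector \<Rightarrow> 'b::real_normed_vector) \<Rightarrow> 'a \<Rightarrow> 'a \<Rightarrow> 'b" where
  "fderiv f x \<equiv> frechet_derivative f (at x)"

section \<open>Functions of finite differentiability class\<close>

lemma Ck_on_subset: "Ck_on k S f \<Longrightarrow> T \<subseteq> S \<Longrightarrow> Ck_on k T f"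
  by (induction k arbitrary: f) (auto intro: continuous_on_subset)

lemma Ck_on_SucD: "Ck_on (Suc k) S f \<Longrightarrow> Ck_on k S f"
proof (induction k arbitrary: f)
  case 0
  then show ?case
    by (auto intro!: continuous_at_imp_continuous_on differentiable_imp_continuous_within)
next
  case (Suc k)
  have "Ck_on k S (\<lambda>x. fderiv f x v)" for v
    by (rule Suc.IH) (use Suc.prems in \<open>subst (asm) Ck_on.simps, blast\<close>)
  then show ?case using Suc.prems by (subst (asm) Ck_on.simps) (subst Ck_on.simps, blast)
qed

lemma frechet_derivative_cong_open:
  assumes "open S" "x \<in> S" "\<And>y. y \<in> S \<Longrightarrow> f y = g y"
  shows "fderiv f x = fderiv g x"
proof -
  have "(f has_derivative D) (at x) \<longleftrightarrow> (g has_derivative D) (at x)" for D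
    using has_derivative_transform_within_open[OF _ assms(1,2), of f D UNIV g]
      has_derivative_transform_within_open[OF _ assms(1,2), of g D UNIV f] assms(3) by auto
  then show ?thesis by (simp add: frechet_derivative_def)
qed

lemma Ck_on_cong:
  assumes "open S" "\<And>x. x \<in> S \<Longrightarrow> f x = g x" "Ck_on k S f"
  shows "Ck_on k S g"
  using assms(2,3)
proof (induction k arbitrary: f g)
  case 0
  then show ?case using continuous_on_cong[of S S f g] by simp
next
  case (Suc k)
  have "g differentiable at x" if "x \<in> S" for x
  proof -
    have "\<forall>x\<in>S. f differentiable (at x)"
      using Suc.prems(2) unfolding Ck_on.simps by (rule conjunct1)
    then obtain D where "(f has_derivative D) (at x)"
      using \<open>x \<in> S\<close> unfolding differentiable_def by blast
    then have "(g has_derivative D) (at x)"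
      by (rule has_derivative_transform_within_open[OF _ assms(1) that]) (simp add: Suc.prems(1))
    then show ?thesis by (auto simp: differentiable_def)
  qed
  moreover have "Ck_on k S (\<lambda>x. fderiv g x v)" for v
  proof (rule Suc.IH)
    show "Ck_on k S (\<lambda>x. fderiv f x v)" using Suc.prems by simp
    show "fderiv f x v = fderiv g x v" if "x \<in> S" for x
      using frechet_derivative_cong_open[OF assms(1) that Suc.prems(1)] by simp
  qed
  ultimately show ?case by simp
qed

lemma Ck_on_SucI:
  assumes "open S" "\<And>x. x \<in> S \<Longrightarrow> (f has_derivative D x) (at x)" "\<And>v. Ck_on k S (\<lambda>x. D x v)"
  shows "Ck_on (Suc k) S f"
proof -
  have "fderiv f x = D x" if "x \<in> S" for x
    using assms(2)[OF that] by (metis frechet_derivative_at)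
  then have "Ck_on k S (\<lambda>x. fderiv f x v)" for v
    using Ck_on_cong[OF assms(1) _ assms(3)[of v]] by auto
  then show ?thesis
    using assms(2) by (auto simp: differentiable_def)
qed

lemma Ck_on_SucE:
  assumes "Ck_on (Suc k) S f" "x \<in> S"
  shows "(f has_derivative fderiv f x) (at x)"
  using assms by (auto simp: frechet_derivative_works[symmetric])

lemma Ck_on_const: "open S \<Longrightarrow> Ck_on k S (\<lambda>x. c)"
  by (induction k arbitrary: c) auto

lemma Ck_on_add:
  assumes "open S" "Ck_on k S f" "Ck_on k S g"
  shows "Ck_on k S (\<lambda>x. f x + g x)"
  using assms(2,3)
proof (induction k arbitrary: f g)
  case (Suc k)
  show ?case
    by (rule Ck_on_SucI[OF assms(1), where D = "\<lambda>x v. fderiv f x v + fderiv g x v"])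
      (use Suc Ck_on_SucE[OF Suc.prems(1)] Ck_on_SucE[OF Suc.prems(2)] in \<open>auto intro!: has_derivative_add\<close>)
qed (auto intro: continuous_on_add)

lemma Ck_on_bounded_linear:
  assumes "open S" "bounded_linear L" "Ck_on k S f"
  shows "Ck_on k S (\<lambda>x. L (f x))"
  using assms(3)
proof (induction k arbitrary: f)
  case 0
  then show ?case
    using bounded_linear.continuous_on[OF assms(2)] by auto
next
  case (Suc k)
  show ?case
    by (rule Ck_on_SucI[OF assms(1), where D = "\<lambda>x v. L (fderiv f x v)"])
      (use Suc.prems in \<open>auto intro!: Suc.IH bounded_linear.has_derivative[OF assms(2)] Ck_on_SucE[OF Suc.prems]\<close>)
qed

lemma Ck_on_bounded_bilinear:
  assumes "open S" "bounded_bilinear B" "Ck_on k S f" "Ck_on k S g"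
  shows "Ck_on k S (\<lambda>x. B (f x) (g x))"
  using assms(3,4)
proof (induction k arbitrary: f g)
  case 0
  then show ?case
    using bounded_bilinear.continuous_on[OF assms(2)] by auto
next
  case (Suc k)
  show ?case
    by (rule Ck_on_SucI[OF assms(1),
          where D = "\<lambda>x v. B (f x) (fderiv g x v) + B (fderiv f x v) (g x)"])
      (use Suc.prems in \<open>auto intro!: Ck_on_add[OF assms(1)] bounded_bilinear.FDERIV[OF assms(2)]
           Ck_on_SucE[OF Suc.prems(1)] Ck_on_SucE[OF Suc.prems(2)]
           Suc.IH Ck_on_SucD[OF Suc.prems(1)] Ck_on_SucD[OF Suc.prems(2)]\<close>)
qed

lemma Ck_on_sum:
  assumes "open S" "finite I" "\<And>i. i \<in> I \<Longrightarrow> Ck_on k S (f i)"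
  shows "Ck_on k S (\<lambda>x. \<Sum>i\<in>I. f i x)"
  using assms(2,3) by induction (auto intro: Ck_on_const Ck_on_add assms(1))

lemma linear_eq_sum_Basis:
  fixes L :: "'a::euclidean_space \<Rightarrow> 'b::real_vector"
  assumes "linear L"
  shows "L v = (\<Sum>b\<in>Basis. (v \<bullet> b) *\<^sub>R L b)"
proof -
  have "L v = L (\<Sum>b\<in>Basis. (v \<bullet> b) *\<^sub>R b)" by (simp add: euclidean_representation)
  then show ?thesis by (simp add: linear_sum[OF assms] linear_cmul[OF assms])
qed

text \<open>In the chain rule the outer derivative is taken in a direction that varies with
  \<open>x\<close>, while \<open>Ck_on\<close> speaks only of fixed directions. Expanding that
  direction in \<open>Basis\<close> leaves products of composites with fixed directions, to which
  the induction hypothesis applies.\<close>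

lemma Ck_on_compose:
  fixes f :: "'a::euclidean_space \<Rightarrow> 'b::euclidean_space" and g :: "'b \<Rightarrow> 'c::real_normed_vector"
  assumes "open S" "open T" "f ` S \<subseteq> T" "Ck_on k S f" "Ck_on k T g"
  shows "Ck_on k S (\<lambda>x. g (f x))"
  using assms(4,5)
proof (induction k arbitrary: g)
  case 0
  then show ?case
    using continuous_on_compose2[of T g S f] assms(3) by auto
next
  case (Suc k)
  have fd: "(f has_derivative fderiv f x) (at x)" if "x \<in> S" for x
    using Ck_on_SucE[OF Suc.prems(1) that] .
  have gd: "(g has_derivative fderiv g (f x)) (at (f x))" if "x \<in> S" for x
    using Ck_on_SucE[OF Suc.prems(2)] assms(3) that by blast
  show ?case
  proof (rule Ck_on_SucI[OF assms(1), where D = "\<lambda>x v. \<Sum>b\<in>Basis.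
        (fderiv f x v \<bullet> b) *\<^sub>R fderiv g (f x) b"])
    fix x assume x: "x \<in> S"
    have "fderiv g (f x) (fderiv f x v) = (\<Sum>b\<in>Basis.
        (fderiv f x v \<bullet> b) *\<^sub>R fderiv g (f x) b)" for v
      using linear_eq_sum_Basis gd[OF x] has_derivative_linear by blast
    then show "((\<lambda>x. g (f x)) has_derivative (\<lambda>v. \<Sum>b\<in>Basis.
        (fderiv f x v \<bullet> b) *\<^sub>R fderiv g (f x) b)) (at x)"
      using has_derivative_compose[OF fd[OF x] gd[OF x]] by simp
  next
    fix v
    show "Ck_on k S (\<lambda>x. \<Sum>b\<in>Basis.
        (fderiv f x v \<bullet> b) *\<^sub>R fderiv g (f x) b)"
      using Suc.prems Ck_on_SucD[OF Suc.prems(1)]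
      by (intro Ck_on_sum[OF assms(1)] Ck_on_bounded_bilinear[OF assms(1) bounded_bilinear_scaleR]
          Ck_on_bounded_linear[OF assms(1) bounded_linear_inner_left] Suc.IH) auto
  qed
qed

section \<open>Smooth functions\<close>

lemma smooth_on_subset: "smooth_on S f \<Longrightarrow> T \<subseteq> S \<Longrightarrow> smooth_on T f"
  by (auto simp: smooth_on_def intro: Ck_on_subset)

lemma smooth_on_cong: "open S \<Longrightarrow> smooth_on S f \<Longrightarrow> (\<And>x. x \<in> S \<Longrightarrow> f x = g x) \<Longrightarrow> smooth_on S g"
  unfolding smooth_on_def by (metis Ck_on_cong)

lemma smooth_on_differentiable: "smooth_on S f \<Longrightarrow> x \<in> S \<Longrightarrow> f differentiable (at x)"
proof -
  assume "smooth_on S f" "x \<in> S"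
  then have "Ck_on (Suc 0) S f" by (simp only: smooth_on_def)
  then show ?thesis using \<open>x \<in> S\<close> by simp
qed

lemma smooth_on_has_derivative:
  "smooth_on S f \<Longrightarrow> x \<in> S \<Longrightarrow> (f has_derivative fderiv f x) (at x)"
  using smooth_on_differentiable frechet_derivative_works by blast

lemma smooth_on_continuous: "smooth_on S f \<Longrightarrow> continuous_on S f"
proof -
  assume "smooth_on S f"
  then have "Ck_on 0 S f" by (simp only: smooth_on_def)
  then show ?thesis by simp
qed

lemma smooth_on_frechet: "smooth_on S f \<Longrightarrow> smooth_on S (\<lambda>x. fderiv f x v)"
  unfolding smooth_on_def
proof (intro allI)
  fix k assume "\<forall>k. Ck_on k S f"
  then have "Ck_on (Suc k) S f" ..
  then show "Ck_on k S (\<lambda>x. fderiv f x v)" by simp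
qed

lemma smooth_onI:
  assumes "open S" "\<And>x. x \<in> S \<Longrightarrow> (f has_derivative D x) (at x)" "\<And>v. smooth_on S (\<lambda>x. D x v)"
  shows "smooth_on S f"
  unfolding smooth_on_def
proof
  fix k
  have "Ck_on (Suc k) S f"
    by (rule Ck_on_SucI[OF assms(1,2)], assumption) (rule assms(3)[unfolded smooth_on_def, rule_format])
  then show "Ck_on k S f" by (rule Ck_on_SucD)
qed

lemma smooth_on_const: "open S \<Longrightarrow> smooth_on S (\<lambda>x. c)"
  by (simp add: smooth_on_def Ck_on_const)

lemma smooth_on_linear: "open S \<Longrightarrow> bounded_linear L \<Longrightarrow> smooth_on S L"
  by (rule smooth_onI[where D = "\<lambda>x. L"]) (auto intro: smooth_on_const bounded_linear_imp_has_derivative)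

lemma smooth_on_ident: "open S \<Longrightarrow> smooth_on S (\<lambda>x. x)"
  by (simp add: smooth_on_linear bounded_linear_ident)

lemma smooth_on_add: "open S \<Longrightarrow> smooth_on S f \<Longrightarrow> smooth_on S g \<Longrightarrow> smooth_on S (\<lambda>x. f x + g x)"
  by (simp add: smooth_on_def Ck_on_add)

lemma smooth_on_bounded_linear:
  "open S \<Longrightarrow> bounded_linear L \<Longrightarrow> smooth_on S f \<Longrightarrow> smooth_on S (\<lambda>x. L (f x))"
  by (simp add: smooth_on_def Ck_on_bounded_linear)

lemma smooth_on_bounded_bilinear:
  "open S \<Longrightarrow> bounded_bilinear B \<Longrightarrow> smooth_on S f \<Longrightarrow> smooth_on S g \<Longrightarrow> smooth_on S (\<lambda>x. B (f x) (g x))"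
  by (simp add: smooth_on_def Ck_on_bounded_bilinear)

lemma smooth_on_sum:
  "open S \<Longrightarrow> finite I \<Longrightarrow> (\<And>i. i \<in> I \<Longrightarrow> smooth_on S (f i)) \<Longrightarrow> smooth_on S (\<lambda>x. \<Sum>i\<in>I. f i x)"
  by (simp add: smooth_on_def Ck_on_sum)

lemma smooth_on_compose:
  fixes f :: "'a::euclidean_space \<Rightarrow> 'b::euclidean_space"
  shows "open S \<Longrightarrow> open T \<Longrightarrow> (\<And>x. x \<in> S \<Longrightarrow> f x \<in> T) \<Longrightarrow> smooth_on S f \<Longrightarrow> smooth_on T g
    \<Longrightarrow> smooth_on S (\<lambda>x. g (f x))"
  unfolding smooth_on_def by (intro allI, rule Ck_on_compose[of S T]) blast+

lemmas smooth_on_scaleR = smooth_on_bounded_bilinear[OF _ bounded_bilinear_scaleR]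
lemmas smooth_on_mult = smooth_on_bounded_bilinear[OF _ bounded_bilinear_mult]
lemmas smooth_on_minus = smooth_on_bounded_linear[OF _ bounded_linear_minus[OF bounded_linear_ident]]
lemmas smooth_on_vec_nth = smooth_on_bounded_linear[OF _ bounded_linear_vec_nth]
lemmas smooth_on_fst = smooth_on_bounded_linear[OF _ bounded_linear_fst]
lemmas smooth_on_snd = smooth_on_bounded_linear[OF _ bounded_linear_snd]

lemma smooth_on_diff: "open S \<Longrightarrow> smooth_on S f \<Longrightarrow> smooth_on S g \<Longrightarrow> smooth_on S (\<lambda>x. f x - g x)"
  using smooth_on_add[OF _ _ smooth_on_minus, of S f g] by simp

lemma smooth_on_power:
  fixes f :: "'a::euclidean_space \<Rightarrow> 'b::real_normed_algebra_1"
  shows "open S \<Longrightarrow> smooth_on S f \<Longrightarrow> smooth_on S (\<lambda>x. f x ^ n)"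
  by (induction n) (auto intro: smooth_on_const smooth_on_mult)

lemma smooth_on_Pair:
  assumes "open S" "smooth_on S f" "smooth_on S g"
  shows "smooth_on S (\<lambda>x. (f x, g x))"
proof -
  have "smooth_on S (\<lambda>x. (f x, 0) + (0, g x))"
    by (intro smooth_on_add assms smooth_on_bounded_linear[OF assms(1) _ assms(2), of "\<lambda>x. (x, 0)"]
        smooth_on_bounded_linear[OF assms(1) _ assms(3), of "\<lambda>x. (0, x)"]
        bounded_linear_Pair bounded_linear_ident bounded_linear_zero)
  then show ?thesis by simp
qed

lemma smooth_on_vec_lambda:
  fixes f :: "'a::euclidean_space \<Rightarrow> 'i::finite \<Rightarrow> 'b::euclidean_space"
  assumes "open S" "\<And>i. smooth_on S (\<lambda>x. f x i)"
  shows "smooth_on S (\<lambda>x. \<chi> i. f x i)"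
proof -
  have "smooth_on S (\<lambda>x. \<Sum>i\<in>UNIV. axis i (f x i))"
    by (intro smooth_on_sum assms smooth_on_bounded_linear[OF assms(1) _ assms(2)]
        linear_conv_bounded_linear[THEN iffD1] linearI)
      (auto simp: axis_def vec_eq_iff)
  moreover have "(\<Sum>i\<in>UNIV. axis i (f x i)) = (\<chi> i. f x i)" for x
    by (auto simp: vec_eq_iff axis_def if_distrib cong: if_cong)
  ultimately show ?thesis by simp
qed

text \<open>The derivative is again a polynomial in \<open>inverse\<close>, so the induction feeds
  itself.\<close>

lemma Ck_on_inverse: "Ck_on k (- {0::real}) inverse"
proof (induction k)
  case (Suc k)
  have o: "open (- {0::real})" by auto
  show ?case
    by (rule Ck_on_SucI[OF o, where D = "\<lambda>x h. - (inverse x * h * inverse x)"])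
      (auto intro!: has_derivative_inverse' Ck_on_bounded_linear[OF o bounded_linear_minus[OF bounded_linear_ident]]
        Ck_on_bounded_bilinear[OF o bounded_bilinear_mult] Ck_on_const[OF o] Suc)
qed (auto intro!: continuous_intros)

lemma smooth_on_inverse:
  fixes f :: "'a::euclidean_space \<Rightarrow> real"
  assumes "open S" "smooth_on S f" "\<And>x. x \<in> S \<Longrightarrow> f x \<noteq> 0"
  shows "smooth_on S (\<lambda>x. inverse (f x))"
  by (rule smooth_on_compose[OF assms(1) _ _ assms(2), of "- {0}"])
    (use assms(3) in \<open>auto simp: smooth_on_def Ck_on_inverse\<close>)

lemma smooth_on_divide:
  fixes f :: "'a::euclidean_space \<Rightarrow> real"
  assumes "open S" "smooth_on S f" "smooth_on S g" "\<And>x. x \<in> S \<Longrightarrow> g x \<noteq> 0"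
  shows "smooth_on S (\<lambda>x. f x / g x)"
  using smooth_on_mult[OF assms(1,2) smooth_on_inverse[OF assms(1,3,4)]] by (simp add: divide_inverse)

lemma smooth_on_exp_real: "smooth_on UNIV (exp :: real \<Rightarrow> real)"
  unfolding smooth_on_def
proof
  fix k show "Ck_on k UNIV (exp :: real \<Rightarrow> real)"
  proof (induction k)
    case (Suc k)
    show ?case
      by (rule Ck_on_SucI[where D = "\<lambda>x h. exp x * h"])
        (auto intro!: Ck_on_bounded_bilinear[OF _ bounded_bilinear_mult] Ck_on_const Suc
          DERIV_exp[unfolded has_field_derivative_def])
  qed (auto intro!: continuous_intros)
qed

lemma smooth_on_exp:
  fixes f :: "'a::euclidean_space \<Rightarrow> real"
  shows "open S \<Longrightarrow> smooth_on S f \<Longrightarrow> smooth_on S (\<lambda>x. exp (f x))"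
  using smooth_on_compose[of S UNIV f exp] smooth_on_exp_real by auto

lemma smooth_on_ln:
  fixes f :: "'a::euclidean_space \<Rightarrow> real"
  assumes "open S" "smooth_on S f" "\<And>x. x \<in> S \<Longrightarrow> f x > 0"
  shows "smooth_on S (\<lambda>x. ln (f x))"
proof (rule smooth_on_compose[of S "{0<..}" f ln])
  have o: "open {0::real<..}" by simp
  show "smooth_on {0::real<..} ln"
  proof (rule smooth_onI[OF o, where D = "\<lambda>x h. h * inverse x"])
    show "(ln has_derivative (\<lambda>h. h * inverse x)) (at x)" if "x \<in> {0<..}" for x :: real
      using that by (auto intro!: has_derivative_ln[OF _ has_derivative_ident])
    show "smooth_on {0::real<..} (\<lambda>x. h * inverse x)" for h
      by (rule smooth_on_mult[OF o smooth_on_const[OF o] smooth_on_inverse[OF o smooth_on_ident[OF o]]]) auto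
  qed
qed (use assms in auto)

lemma smooth_on_powr:
  fixes f :: "'a::euclidean_space \<Rightarrow> real"
  assumes "open S" "smooth_on S f" "\<And>x. x \<in> S \<Longrightarrow> f x > 0"
  shows "smooth_on S (\<lambda>x. f x powr c)"
proof (rule smooth_on_cong[OF assms(1)])
  show "smooth_on S (\<lambda>x. exp (c * ln (f x)))"
    by (intro smooth_on_exp smooth_on_mult smooth_on_const smooth_on_ln assms)
  show "exp (c * ln (f x)) = f x powr c" if "x \<in> S" for x
    using assms(3)[OF that] by (simp add: powr_def)
qed

lemma smooth_on_sqrt:
  fixes f :: "'a::euclidean_space \<Rightarrow> real"
  assumes "open S" "smooth_on S f" "\<And>x. x \<in> S \<Longrightarrow> f x > 0"
  shows "smooth_on S (\<lambda>x. sqrt (f x))"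
  by (rule smooth_on_cong[OF assms(1) smooth_on_powr[OF assms, of "1/2"]])
    (use assms(3) in \<open>auto simp: powr_half_sqrt less_imp_le\<close>)

text \<open>Linearity reduces smoothness of \<open>L x (Z x)\<close> to smoothness in fixed
  directions, as in the chain rule. Metrics, forms and derivatives applied to varying vector fields
  all pass through this.\<close>

lemma smooth_on_apply_linear:
  fixes Z :: "'a::euclidean_space \<Rightarrow> 'b::euclidean_space"
  assumes "open S" "\<And>x. x \<in> S \<Longrightarrow> linear (L x)" "\<And>v. smooth_on S (\<lambda>x. L x v)" "smooth_on S Z"
  shows "smooth_on S (\<lambda>x. L x (Z x))"
proof (rule smooth_on_cong[OF assms(1)])
  show "smooth_on S (\<lambda>x. \<Sum>b\<in>Basis. (Z x \<bullet> b) *\<^sub>R L x b)"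
  proof (rule smooth_on_sum[OF assms(1) finite_Basis])
    fix b :: 'b
    have "smooth_on S (\<lambda>x. Z x \<bullet> b)"
      by (rule smooth_on_bounded_linear[OF assms(1) bounded_linear_inner_left assms(4)])
    then show "smooth_on S (\<lambda>x. (Z x \<bullet> b) *\<^sub>R L x b)"
      using assms(3) by (rule smooth_on_scaleR[OF assms(1)])
  qed
  show "(\<Sum>b\<in>Basis. (Z x \<bullet> b) *\<^sub>R L x b) = L x (Z x)" if "x \<in> S" for x
    by (rule linear_eq_sum_Basis[OF assms(2)[OF that], symmetric])
qed

lemma smooth_on_frechet_apply:
  assumes "open S" "smooth_on S f" "smooth_on S Z"
  shows "smooth_on S (\<lambda>x. fderiv f x (Z x))"
  by (rule smooth_on_apply_linear[OF assms(1) _ _ assms(3)])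
    (auto intro: smooth_on_frechet assms linear_frechet_derivative smooth_on_differentiable)

subsection \<open>Differential forms\<close>

lemma has_derivative_along_line:
  assumes "(f has_derivative D) (at (p + s *\<^sub>R X + q))"
  shows "((\<lambda>s. f (p + s *\<^sub>R X + q)) has_derivative (\<lambda>r. D (r *\<^sub>R X))) (at s)"
  by (rule has_derivative_compose[of "\<lambda>s. p + s *\<^sub>R X + q" "\<lambda>r. r *\<^sub>R X" s UNIV f D])
    (use assms in \<open>auto intro!: derivative_eq_intros\<close>)

text \<open>The second difference is a first difference in \<open>s\<close> of a first difference in
  \<open>t\<close>; the mean value theorem is applied to each in turn.\<close>

lemma mixed_difference_mvt:
  fixes f :: "'a::euclidean_space \<Rightarrow> real"
  assumes h: "h > 0" and dom: "\<And>s t. 0 \<le> s \<Longrightarrow> s \<le> h \<Longrightarrow> 0 \<le> t \<Longrightarrow> t \<le> h \<Longrightarrow> x + s *\<^sub>R X + t *\<^sub>R Y \<in> S"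
    and d1: "\<And>y. y \<in> S \<Longrightarrow> (f has_derivative f' y) (at y)"
    and d2: "\<And>y. y \<in> S \<Longrightarrow> ((\<lambda>y. f' y X) has_derivative f'' y) (at y)"
  obtains s t where "0 < s" "s < h" "0 < t" "t < h"
    "f (x + h *\<^sub>R X + h *\<^sub>R Y) - f (x + h *\<^sub>R X) - f (x + h *\<^sub>R Y) + f x
      = h * h * f'' (x + s *\<^sub>R X + t *\<^sub>R Y) Y"
proof -
  define F where "F s = f (x + s *\<^sub>R X + h *\<^sub>R Y) - f (x + s *\<^sub>R X)" for s
  have dF: "DERIV F s :> f' (x + s *\<^sub>R X + h *\<^sub>R Y) X - f' (x + s *\<^sub>R X) X" if "0 \<le> s" "s \<le> h" for s
  proof -
    have a: "x + s *\<^sub>R X + h *\<^sub>R Y \<in> S" "x + s *\<^sub>R X \<in> S"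
      using dom[OF that, of h] dom[OF that, of 0] h by auto
    have 1: "(F has_derivative (\<lambda>r. f' (x + s *\<^sub>R X + h *\<^sub>R Y) (r *\<^sub>R X) - f' (x + s *\<^sub>R X) (r *\<^sub>R X))) (at s)"
      unfolding F_def
      using has_derivative_diff[OF has_derivative_along_line[OF d1[OF a(1)]]
          has_derivative_along_line[where q = 0, unfolded add_0_right, OF d1[OF a(2)]]] .
    have "f' y (r *\<^sub>R X) = f' y X * r" if "y \<in> S" for y r
      using has_derivative_linear[OF d1[OF that]] by (simp add: linear_cmul)
    then show ?thesis
      unfolding has_field_derivative_def
      by (intro has_derivative_eq_rhs[OF 1]) (use a in \<open>simp add: fun_eq_iff left_diff_distrib\<close>)
  qed
  obtain s where s: "0 < s" "s < h"
    "F h - F 0 = (h - 0) * (f' (x + s *\<^sub>R X + h *\<^sub>R Y) X - f' (x + s *\<^sub>R X) X)"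
    using MVT2[OF h dF] by metis
  define G where "G t = f' (x + s *\<^sub>R X + t *\<^sub>R Y) X" for t
  have dG: "DERIV G t :> f'' (x + s *\<^sub>R X + t *\<^sub>R Y) Y" if "0 \<le> t" "t \<le> h" for t
  proof -
    have a: "x + s *\<^sub>R X + t *\<^sub>R Y \<in> S"
      using dom[OF _ _ that, of s] s by auto
    have "(G has_derivative (\<lambda>r. f'' (x + s *\<^sub>R X + t *\<^sub>R Y) (r *\<^sub>R Y))) (at t)"
      unfolding G_def
      using has_derivative_along_line[where q = 0, unfolded add_0_right, OF d2[OF a]] .
    then show ?thesis
      unfolding has_field_derivative_def
      by (rule has_derivative_eq_rhs)
        (use has_derivative_linear[OF d2[OF a]] in \<open>simp add: fun_eq_iff linear_cmul\<close>)
  qed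
  obtain t where t: "0 < t" "t < h" "G h - G 0 = (h - 0) * f'' (x + s *\<^sub>R X + t *\<^sub>R Y) Y"
    using MVT2[OF h dG] by metis
  show ?thesis
    by (rule that[OF s(1,2) t(1,2)]) (use s(3) t(3) in \<open>simp add: F_def G_def algebra_simps\<close>)
qed

text \<open>The second difference over a parallelogram is symmetric in \<open>X\<close> and
  \<open>Y\<close>, so it equals both mixed derivatives at two nearby points. By continuity each
  lies within half the supposed gap of its value at \<open>x\<close>, which is
  contradictory.\<close>

lemma symmetric_second_derivative_real:
  fixes f :: "'a::euclidean_space \<Rightarrow> real"
  assumes S: "open S" "x \<in> S"
    and d1: "\<And>y. y \<in> S \<Longrightarrow> (f has_derivative f' y) (at y)"
    and d2: "\<And>y v. y \<in> S \<Longrightarrow> ((\<lambda>y. f' y v) has_derivative f'' v y) (at y)"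
    and c: "continuous_on S (\<lambda>y. f'' X y Y)" "continuous_on S (\<lambda>y. f'' Y y X)"
  shows "f'' X x Y = f'' Y x X"
proof (rule ccontr)
  assume ne: "f'' X x Y \<noteq> f'' Y x X"
  define e where "e = \<bar>f'' X x Y - f'' Y x X\<bar> / 2"
  have e: "e > 0" using ne by (simp add: e_def)
  obtain d where d: "d > 0" "ball x d \<subseteq> S"
    "\<And>y. y \<in> ball x d \<Longrightarrow> \<bar>f'' X y Y - f'' X x Y\<bar> < e \<and> \<bar>f'' Y y X - f'' Y x X\<bar> < e"
  proof -
    obtain d0 where d0: "d0 > 0" "ball x d0 \<subseteq> S"
      using S open_contains_ball by blast
    have "isCont (\<lambda>y. f'' X y Y) x" "isCont (\<lambda>y. f'' Y y X) x"
      using c S by (auto simp: continuous_on_eq_continuous_at)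
    note ct = this
    obtain r where r: "r > 0" "\<And>y. dist y x < r \<Longrightarrow> dist (f'' X y Y) (f'' X x Y) < e"
      using ct(1)[unfolded continuous_at_eps_delta, rule_format, OF e] by blast
    obtain r' where r': "r' > 0" "\<And>y. dist y x < r' \<Longrightarrow> dist (f'' Y y X) (f'' Y x X) < e"
      using ct(2)[unfolded continuous_at_eps_delta, rule_format, OF e] by blast
    show ?thesis
    proof (rule that[of "min d0 (min r r')"])
      show "ball x (min d0 (min r r')) \<subseteq> S"
        by (rule order_trans[OF subset_ball d0(2)]) simp
    qed (use d0 r r' in \<open>auto simp: dist_real_def dist_commute\<close>)
  qed
  \<comment> \<open>Keeps the parallelogram with sides \<open>h X\<close> and \<open>h Y\<close>
    inside the ball; the summand 1 covers \<open>X = Y = 0\<close>.\<close>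
  define h where "h = d / (2 * (norm X + norm Y + 1))"
  have pos: "norm X + norm Y + 1 > 0"
    by (smt (verit) norm_ge_zero)
  have h: "h > 0" using d pos by (simp add: h_def)
  have hb: "h * (norm X + norm Y) < d"
  proof -
    have "h * (norm X + norm Y) \<le> h * (norm X + norm Y + 1)" using h by simp
    also have "\<dots> = d / 2" using pos by (simp add: h_def field_simps)
    finally show ?thesis using d(1) by linarith
  qed
  have dom: "x + s *\<^sub>R X + t *\<^sub>R Y \<in> ball x d" "x + t *\<^sub>R Y + s *\<^sub>R X \<in> ball x d"
    if "0 \<le> s" "s \<le> h" "0 \<le> t" "t \<le> h" for s t
  proof -
    have "norm (s *\<^sub>R X + t *\<^sub>R Y) \<le> s * norm X + t * norm Y"
      using that by (intro norm_triangle_le) auto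
    also have "\<dots> \<le> h * norm X + h * norm Y"
      using that by (intro add_mono mult_right_mono) auto
    also have "\<dots> < d" using hb by (simp add: algebra_simps)
    finally have "norm (s *\<^sub>R X + t *\<^sub>R Y) < d" .
    then show "x + s *\<^sub>R X + t *\<^sub>R Y \<in> ball x d" "x + t *\<^sub>R Y + s *\<^sub>R X \<in> ball x d"
      by (simp_all add: dist_norm norm_minus_commute algebra_simps flip: minus_add_distrib)
  qed
  obtain s t where st: "0 < s" "s < h" "0 < t" "t < h"
    "f (x + h *\<^sub>R X + h *\<^sub>R Y) - f (x + h *\<^sub>R X) - f (x + h *\<^sub>R Y) + f x
      = h * h * f'' X (x + s *\<^sub>R X + t *\<^sub>R Y) Y"
    by (rule mixed_difference_mvt[OF h, of x X Y "ball x d" f f' "f'' X"])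
      (use d(2) d1 d2 dom in blast)+
  obtain s' t' where st': "0 < s'" "s' < h" "0 < t'" "t' < h"
    "f (x + h *\<^sub>R Y + h *\<^sub>R X) - f (x + h *\<^sub>R Y) - f (x + h *\<^sub>R X) + f x
      = h * h * f'' Y (x + s' *\<^sub>R Y + t' *\<^sub>R X) X"
    by (rule mixed_difference_mvt[OF h, of x Y X "ball x d" f f' "f'' Y"])
      (use d(2) d1 d2 dom in blast)+
  have "f'' X (x + s *\<^sub>R X + t *\<^sub>R Y) Y = f'' Y (x + s' *\<^sub>R Y + t' *\<^sub>R X) X"
  proof -
    have "h * h * f'' X (x + s *\<^sub>R X + t *\<^sub>R Y) Y = h * h * f'' Y (x + s' *\<^sub>R Y + t' *\<^sub>R X) X"
      unfolding st(5)[symmetric] st'(5)[symmetric] by (simp add: algebra_simps)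
    then show ?thesis using h by simp
  qed
  moreover have "\<bar>f'' X (x + s *\<^sub>R X + t *\<^sub>R Y) Y - f'' X x Y\<bar> < e"
    using d(3)[OF dom(1)[of s t]] st by simp
  moreover have "\<bar>f'' Y (x + s' *\<^sub>R Y + t' *\<^sub>R X) X - f'' Y x X\<bar> < e"
    using d(3)[OF dom(2)[of t' s']] st' by simp
  ultimately show False unfolding e_def by (smt (verit, best) field_sum_of_halves)
qed

lemma symmetric_second_derivative:
  fixes f :: "'a::euclidean_space \<Rightarrow> 'b::euclidean_space"
  assumes S: "open S" "x \<in> S" and f: "smooth_on S f"
  shows "fderiv (\<lambda>y. fderiv f y X) x Y
    = fderiv (\<lambda>y. fderiv f y Y) x X"
proof (rule euclidean_eqI)
  fix b :: 'b assume "b \<in> Basis"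
  have sm: "smooth_on S (\<lambda>y. fderiv (\<lambda>y. fderiv f y v) y w \<bullet> b)" for v w
    by (intro smooth_on_bounded_linear[OF S(1) bounded_linear_inner_left] smooth_on_frechet f)
  show "fderiv (\<lambda>y. fderiv f y X) x Y \<bullet> b
      = fderiv (\<lambda>y. fderiv f y Y) x X \<bullet> b"
    by (rule symmetric_second_derivative_real[OF S, of "\<lambda>y. f y \<bullet> b" "\<lambda>y v. fderiv f y v \<bullet> b"
          "\<lambda>v y w. fderiv (\<lambda>y. fderiv f y v) y w \<bullet> b"])
      (auto intro!: smooth_on_continuous sm has_derivative_inner_left
        smooth_on_has_derivative[OF f] smooth_on_has_derivative[OF smooth_on_frechet[OF f]])
qed

section \<open>Forms evaluated on vector fields\<close>

lemma has_derivative_apply_linear: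
  fixes L :: "'a::euclidean_space \<Rightarrow> 'b::euclidean_space \<Rightarrow> 'c::real_normed_vector"
  assumes S: "open S" "x \<in> S" and lin: "\<And>y. y \<in> S \<Longrightarrow> linear (L y)"
    and dL: "\<And>v. ((\<lambda>y. L y v) has_derivative DL v) (at x)"
    and dZ: "(Z has_derivative DZ) (at x)"
  shows "((\<lambda>y. L y (Z y)) has_derivative (\<lambda>h. DL (Z x) h + L x (DZ h))) (at x)"
proof -
  have e: "L y (Z y) = (\<Sum>b\<in>Basis. (Z y \<bullet> b) *\<^sub>R L y b)" if "y \<in> S" for y
    using linear_eq_sum_Basis[OF lin[OF that]] .
  have dl: "DL v h = (\<Sum>b\<in>Basis. (v \<bullet> b) *\<^sub>R DL b h)" for v h
  proof -
    have "((\<lambda>y. \<Sum>b\<in>Basis. (v \<bullet> b) *\<^sub>R L y b) has_derivative (\<lambda>h. \<Sum>b\<in>Basis. (v \<bullet> b) *\<^sub>R DL b h)) (at x)"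
      by (intro has_derivative_sum has_derivative_scaleR_right dL)
    then have "((\<lambda>y. L y v) has_derivative (\<lambda>h. \<Sum>b\<in>Basis. (v \<bullet> b) *\<^sub>R DL b h)) (at x)"
      by (rule has_derivative_transform_within_open[OF _ S]) (simp add: linear_eq_sum_Basis[OF lin, symmetric])
    from has_derivative_unique[OF this dL] show ?thesis by metis
  qed
  have "((\<lambda>y. \<Sum>b\<in>Basis. (Z y \<bullet> b) *\<^sub>R L y b) has_derivative
      (\<lambda>h. \<Sum>b\<in>Basis. (Z x \<bullet> b) *\<^sub>R DL b h + (DZ h \<bullet> b) *\<^sub>R L x b)) (at x)"
    by (rule has_derivative_sum) (rule has_derivative_scaleR[OF has_derivative_inner_left[OF dZ] dL])
  then have "((\<lambda>y. L y (Z y)) has_derivative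
      (\<lambda>h. \<Sum>b\<in>Basis. (Z x \<bullet> b) *\<^sub>R DL b h + (DZ h \<bullet> b) *\<^sub>R L x b)) (at x)"
    by (rule has_derivative_transform_within_open[OF _ S]) (rule e[symmetric])
  moreover have "(\<Sum>b\<in>Basis. (Z x \<bullet> b) *\<^sub>R DL b h + (DZ h \<bullet> b) *\<^sub>R L x b) = DL (Z x) h + L x (DZ h)" for h
    unfolding dl[of "Z x" h] linear_eq_sum_Basis[OF lin[OF S(2)], of "DZ h"] sum.distrib ..
  ultimately show ?thesis by simp
qed

lemma frechet_derivative_eqI: "(f has_derivative D) (at x) \<Longrightarrow> fderiv f x = D"
  using frechet_derivative_at by metis

lemma smooth_form_has_derivative:
  assumes "smooth_form W \<alpha>" "open W" "q \<in> W" "(Y has_derivative DY) (at q)"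
  shows "((\<lambda>p. \<alpha> p (Y p)) has_derivative
    (\<lambda>h. fderiv (\<lambda>p. \<alpha> p (Y q)) q h + \<alpha> q (DY h))) (at q)"
  using assms
  by (intro has_derivative_apply_linear[OF assms(2,3)])
    (auto simp: smooth_form_def intro: smooth_on_has_derivative)

text \<open>\<open>ext_d\<close> extends its arguments as constant fields. For arbitrary extensions
  the product rule adds the value of \<alpha> on the Lie bracket, here
  \<open>DZ (Y q) - DY (Z q)\<close>, which gives Cartan's formula.\<close>

lemma ext_d_vector_fields:
  assumes "smooth_form W \<alpha>" "open W" "q \<in> W" "(Y has_derivative DY) (at q)" "(Z has_derivative DZ) (at q)"
  shows "ext_d \<alpha> q (Y q) (Z q) = fderiv (\<lambda>p. \<alpha> p (Z p)) q (Y q)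
    - fderiv (\<lambda>p. \<alpha> p (Y p)) q (Z q) - \<alpha> q (DZ (Y q) - DY (Z q))"
proof -
  have "linear (\<alpha> q)" using assms by (auto simp: smooth_form_def)
  then show ?thesis
    using frechet_derivative_eqI[OF smooth_form_has_derivative[OF assms(1-3,4)]]
      frechet_derivative_eqI[OF smooth_form_has_derivative[OF assms(1-3,5)]]
    by (simp add: ext_d_def linear_diff)
qed

lemma derivative_along_tangent:
  assumes "X \<in> tangent_space N q" "(f has_derivative D) (at q)" "open W" "q \<in> W"
    "\<And>p. p \<in> N \<Longrightarrow> p \<in> W \<Longrightarrow> f p = c"
  shows "D X = 0"
proof -
  obtain \<gamma> where g: "\<gamma> 0 = q" "\<forall>\<^sub>F t in nhds (0::real). \<gamma> t \<in> N" "(\<gamma> has_vector_derivative X) (at 0)"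
    using assms(1) by (auto simp: tangent_space_def)
  have "isCont \<gamma> 0" using g(3) by (rule has_vector_derivative_continuous)
  then have "\<forall>\<^sub>F t in nhds 0. \<gamma> t \<in> W"
    using assms(3,4) g(1) by (auto simp: continuous_at_open eventually_nhds)
  with g(2) have "\<forall>\<^sub>F t in nhds 0. f (\<gamma> t) = c"
    by eventually_elim (use assms(5) in auto)
  then obtain T where T: "open T" "0 \<in> T" "\<And>t. t \<in> T \<Longrightarrow> f (\<gamma> t) = c"
    by (auto simp: eventually_nhds)
  have "((\<lambda>t. f (\<gamma> t)) has_derivative (\<lambda>h. D (h *\<^sub>R X))) (at 0)"
    using has_derivative_compose[of \<gamma> "\<lambda>h. h *\<^sub>R X" 0 UNIV f D] g assms(2)
    by (simp add: has_vector_derivative_def)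
  moreover have "((\<lambda>t. f (\<gamma> t)) has_derivative (\<lambda>h. 0)) (at 0)"
    by (rule has_derivative_transform_within_open[OF has_derivative_const[of c] T(1,2)]) (use T(3) in auto)
  ultimately have "(\<lambda>h. D (h *\<^sub>R X)) = (\<lambda>h. 0)" by (rule has_derivative_unique)
  then show ?thesis by (metis scaleR_one)
qed

lemma tangent_space_mono: "S \<subseteq> N \<Longrightarrow> tangent_space S q \<subseteq> tangent_space N q"
  unfolding tangent_space_def by (fastforce elim: eventually_mono)

lemma tangent_space_Times:
  assumes "X \<in> tangent_space N p" "Y \<in> tangent_space N' q"
  shows "(X, Y) \<in> tangent_space (N \<times> N') (p, q)"
proof -
  obtain \<gamma> where g: "\<gamma> 0 = p" "\<forall>\<^sub>F t in nhds (0::real). \<gamma> t \<in> N" "(\<gamma> has_vector_derivative X) (at 0)"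
    using assms(1) by (auto simp: tangent_space_def)
  obtain \<delta> where d: "\<delta> 0 = q" "\<forall>\<^sub>F t in nhds (0::real). \<delta> t \<in> N'" "(\<delta> has_vector_derivative Y) (at 0)"
    using assms(2) by (auto simp: tangent_space_def)
  have "\<forall>\<^sub>F t in nhds 0. (\<gamma> t, \<delta> t) \<in> N \<times> N'"
    using g(2) d(2) by eventually_elim auto
  then show ?thesis
    unfolding tangent_space_def using g d
    by (auto intro!: exI[of _ "\<lambda>t. (\<gamma> t, \<delta> t)"] has_vector_derivative_Pair)
qed

text \<open>Here \<open>Y + \<i> Z\<close> and \<open>Y' + \<i> Z'\<close> are two complex vector fields along \<open>S\<close>, and the conclusion is about
  their Lie bracket.\<close>

lemma frobenius_bracket:
  fixes \<alpha>s :: "('e::euclidean_space \<Rightarrow> 'e \<Rightarrow> complex) list"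
  assumes W: "open W" "q \<in> W" and S: "q \<in> S" "S \<subseteq> N" and fr: "frobenius_frame N W \<alpha>s"
    and dY: "(Y has_derivative DY) (at q)" and dZ: "(Z has_derivative DZ) (at q)"
    and dY': "(Y' has_derivative DY') (at q)" and dZ': "(Z' has_derivative DZ') (at q)"
    and tan: "Y q \<in> tangent_space S q" "Z q \<in> tangent_space S q"
      "Y' q \<in> tangent_space S q" "Z' q \<in> tangent_space S q"
    and annihilated: "\<forall>\<alpha>\<in>set \<alpha>s. \<forall>p\<in>S \<inter> W. \<alpha> p (Y p) + \<i> * \<alpha> p (Z p) = 0"
      "\<forall>\<alpha>\<in>set \<alpha>s. \<forall>p\<in>S \<inter> W. \<alpha> p (Y' p) + \<i> * \<alpha> p (Z' p) = 0"
    and \<alpha>: "\<alpha> \<in> set \<alpha>s"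
  shows "\<alpha> q (DY' (Y q) - DY (Y' q)) - \<alpha> q (DZ' (Z q) - DZ (Z' q))
    + \<i> * (\<alpha> q (DZ' (Y q) - DY (Z' q)) + \<alpha> q (DY' (Z q) - DZ (Y' q))) = 0"
proof -
  have ann: "\<alpha> p (Y p) + \<i> * \<alpha> p (Z p) = 0" "\<alpha> p (Y' p) + \<i> * \<alpha> p (Z' p) = 0"
    if "\<alpha> \<in> set \<alpha>s" "p \<in> S" "p \<in> W" for \<alpha> p
    using annihilated that by blast+
  have sf: "smooth_form W \<alpha>" using fr \<alpha> by (auto simp: frobenius_frame_def)
  have qN: "q \<in> N \<inter> W" using S W by auto
  have tN: "Y q \<in> tangent_space N q" "Z q \<in> tangent_space N q"
      "Y' q \<in> tangent_space N q" "Z' q \<in> tangent_space N q"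
    using tan tangent_space_mono[OF S(2)] by auto
  obtain b where b: "\<And>j. j < length \<alpha>s \<Longrightarrow> linear (b j)"
    "\<And>X X'. X \<in> tangent_space N q \<Longrightarrow> X' \<in> tangent_space N q \<Longrightarrow>
      ext_d \<alpha> q X X' = (\<Sum>j<length \<alpha>s. wedge (b j) ((\<alpha>s ! j) q) X X')"
    using fr qN \<alpha> unfolding frobenius_frame_def by blast
  have za: "(\<alpha>s ! j) q (Y q) = - \<i> * (\<alpha>s ! j) q (Z q)" "(\<alpha>s ! j) q (Y' q) = - \<i> * (\<alpha>s ! j) q (Z' q)"
    if "j < length \<alpha>s" for j
    using ann[of "\<alpha>s ! j" q] that S(1) W(2) by (auto simp: eq_neg_iff_add_eq_0)
  \<comment> \<open>This is the complex-bilinear extension of the sum of wedges, evaluated on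
    \<open>Y + \<i> Z\<close> and \<open>Y' + \<i> Z'\<close>; every summand has a factor in which
    \<open>\<alpha>s ! j\<close> meets one of these two fields.\<close>
  have "(\<Sum>j<length \<alpha>s. wedge (b j) ((\<alpha>s ! j) q) (Y q) (Y' q))
      - (\<Sum>j<length \<alpha>s. wedge (b j) ((\<alpha>s ! j) q) (Z q) (Z' q))
      + \<i> * ((\<Sum>j<length \<alpha>s. wedge (b j) ((\<alpha>s ! j) q) (Y q) (Z' q))
      + (\<Sum>j<length \<alpha>s. wedge (b j) ((\<alpha>s ! j) q) (Z q) (Y' q))) = 0"
    unfolding sum_subtractf[symmetric] sum.distrib[symmetric] sum_distrib_left
    by (intro sum.neutral ballI) (auto simp: wedge_def za algebra_simps)
  then have 1: "ext_d \<alpha> q (Y q) (Y' q) - ext_d \<alpha> q (Z q) (Z' q)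
      + \<i> * (ext_d \<alpha> q (Y q) (Z' q) + ext_d \<alpha> q (Z q) (Y' q)) = 0"
    using b(2) tN by simp
  note D = smooth_form_has_derivative[OF sf W]
  have fd: "((\<lambda>p. \<alpha> p (V p)) has_derivative fderiv (\<lambda>p. \<alpha> p (V p)) q) (at q)"
    if "(V has_derivative DV) (at q)" for V DV
    using D[OF that] frechet_derivative_eqI[OF D[OF that]] by simp
  \<comment> \<open>The annihilation is known on \<open>S\<close> only, so it may be differentiated
    only in directions tangent to \<open>S\<close>.\<close>
  have van: "fderiv (\<lambda>p. \<alpha> p (V p)) q X + \<i> * fderiv (\<lambda>p. \<alpha> p (U p)) q X = 0"
    if "(V has_derivative DV) (at q)" "(U has_derivative DU) (at q)" "X \<in> tangent_space S q"
      "\<And>p. p \<in> S \<Longrightarrow> p \<in> W \<Longrightarrow> \<alpha> p (V p) + \<i> * \<alpha> p (U p) = 0" for V U DV DU X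
    by (rule derivative_along_tangent[OF that(3) _ W, where f = "\<lambda>p. \<alpha> p (V p) + \<i> * \<alpha> p (U p)"])
      (use that(4) in \<open>auto intro!: has_derivative_add has_derivative_mult_right fd[OF that(1)] fd[OF that(2)]\<close>)
  note v1 = van[OF dY dZ tan(3) ann(1)[OF \<alpha>]] van[OF dY dZ tan(4) ann(1)[OF \<alpha>]]
  note v2 = van[OF dY' dZ' tan(1) ann(2)[OF \<alpha>]] van[OF dY' dZ' tan(2) ann(2)[OF \<alpha>]]
  define A where "A V X = fderiv (\<lambda>p. \<alpha> p (V p)) q X" for V X
  have "A Y (Y' q) = - \<i> * A Z (Y' q)" "A Y (Z' q) = - \<i> * A Z (Z' q)"
    "A Y' (Y q) = - \<i> * A Z' (Y q)" "A Y' (Z q) = - \<i> * A Z' (Z q)"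
    using v1 v2 unfolding A_def by (auto simp: eq_neg_iff_add_eq_0)
  then show ?thesis
    using 1
    unfolding ext_d_vector_fields[OF sf W dY dY'] ext_d_vector_fields[OF sf W dZ dZ']
      ext_d_vector_fields[OF sf W dY dZ'] ext_d_vector_fields[OF sf W dZ dY'] A_def[symmetric]
    by (simp add: algebra_simps)
qed

text \<open>The potential is \<open>x \<mapsto> \<integral>\<^sub>0\<^sup>1 \<mu> (c + t (x - c)) (x - c) dt\<close>.\<close>

lemma poincare_ball:
  fixes \<mu> :: "'a::euclidean_space \<Rightarrow> 'a \<Rightarrow> real"
  assumes sm: "smooth_form (ball c r) \<mu>"
    and closed: "\<And>x X Y. x \<in> ball c r \<Longrightarrow> ext_d \<mu> x X Y = 0"
  obtains f where "\<And>x. x \<in> ball c r \<Longrightarrow> (f has_derivative \<mu> x) (at x)" "smooth_on (ball c r) f"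
proof (cases "r > 0")
  case False
  then have "ball c r = {}" by (simp add: ball_empty)
  then show ?thesis using that[of "\<lambda>x. 0", unfolded \<open>ball c r = {}\<close>] smooth_on_const by auto
next
  case True
  define B where "B = ball c r"
  have B: "open B" "convex B" by (auto simp: B_def)
  have lin: "linear (\<mu> x)" if "x \<in> B" for x using sm that by (auto simp: smooth_form_def B_def)
  have sv: "smooth_on B (\<lambda>x. \<mu> x v)" for v using sm by (auto simp: smooth_form_def B_def)
  define D where "D x v w = fderiv (\<lambda>y. \<mu> y v) x w" for x v w
  have dmu: "((\<lambda>y. \<mu> y v) has_derivative D x v) (at x)" if "x \<in> B" for x v
    using smooth_on_has_derivative[OF sv that] by (simp add: D_def[abs_def])
  have sD: "smooth_on B (\<lambda>x. D x v w)" for v w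
    unfolding D_def by (intro smooth_on_frechet sv)
  have Dsym: "D x v w = D x w v" if "x \<in> B" for x v w
    using closed[of x w v] that by (simp add: ext_d_def D_def B_def)
  have linD1: "linear (D x v)" if "x \<in> B" for x v
    using dmu[OF that] has_derivative_linear by blast
  have linD2: "linear (\<lambda>v. D x v w)" if "x \<in> B" for x w
    using linD1[OF that, of w] by (subst Dsym[OF that])
  define g where "g x t = c + t *\<^sub>R (x - c)" for x and t :: real
  have gB: "g x t \<in> B" if "x \<in> B" "t \<in> cbox 0 1" for x t
  proof -
    have "g x t = (1 - t) *\<^sub>R c + t *\<^sub>R x" by (simp add: g_def algebra_simps)
    then show ?thesis
      using convexD[OF B(2), of c x "1 - t" t] that True by (simp add: B_def)
  qed
  define F where "F x t = \<mu> (g x t) (x - c)" for x t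
  \<comment> \<open>The derivative of the integrand with respect to \<open>x\<close>. Because \<mu>
    is closed (\<open>Dsym\<close>), it is also the \<open>t\<close>-derivative of
    \<open>t * \<mu> (g x t) h\<close>, so its integral collapses to
    \<open>\<mu> x h\<close>.\<close>
  define F' where "F' x t h = t * D (g x t) (x - c) h + \<mu> (g x t) h" for x t h
  have dF: "((\<lambda>x. F x t) has_derivative F' x t) (at x)" if "x \<in> B" "t \<in> cbox 0 1" for x t
  proof -
    have gx: "g x t \<in> B" by (rule gB[OF that])
    have o: "open ((\<lambda>y. g y t) -` B)"
      unfolding g_def using B(1) by (intro open_vimage continuous_intros)
    have dg: "((\<lambda>y. \<mu> (g y t) v) has_derivative (\<lambda>h. D (g x t) v (t *\<^sub>R h))) (at x)" for v
      by (rule has_derivative_compose[of "\<lambda>y. g y t" "\<lambda>h. t *\<^sub>R h" x UNIV "\<lambda>y. \<mu> y v" "D (g x t) v"])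
        (use dmu[OF gx] in \<open>auto simp: g_def intro!: derivative_eq_intros\<close>)
    have "((\<lambda>y. \<mu> (g y t) (y - c)) has_derivative (\<lambda>h. D (g x t) (x - c) (t *\<^sub>R h) + \<mu> (g x t) h)) (at x)"
      by (rule has_derivative_apply_linear[OF o])
        (use gx lin dg in \<open>auto intro!: derivative_eq_intros\<close>)
    then show ?thesis
      unfolding F_def F'_def[abs_def] using linD1[OF gx] by (simp add: linear_cmul)
  qed
  have cts_comp: "continuous_on (B \<times> cbox 0 1) (\<lambda>z. k (g (fst z) (snd z)))"
    if "continuous_on B k" for k :: "'a \<Rightarrow> real"
    by (rule continuous_on_compose2[OF that])
      (use gB in \<open>auto simp: g_def intro!: continuous_intros\<close>)
  have cF': "continuous_on (B \<times> cbox 0 1) (\<lambda>z. F' (fst z) (snd z) h)" for h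
  proof (rule continuous_on_eq)
    show "continuous_on (B \<times> cbox 0 1) (\<lambda>z. snd z *
        (\<Sum>b\<in>Basis. ((fst z - c) \<bullet> b) * D (g (fst z) (snd z)) b h) + \<mu> (g (fst z) (snd z)) h)"
      by (intro continuous_intros cts_comp smooth_on_continuous sD sv)
    show "snd z * (\<Sum>b\<in>Basis. ((fst z - c) \<bullet> b) * D (g (fst z) (snd z)) b h) + \<mu> (g (fst z) (snd z)) h
        = F' (fst z) (snd z) h" if "z \<in> B \<times> cbox 0 1" for z
      using linear_eq_sum_Basis[OF linD2[OF gB[of "fst z" "snd z"]], of "fst z - c" h] that
      by (auto simp: F'_def mem_Times_iff)
  qed
  have cF: "continuous_on (cbox 0 1) (F x)" if "x \<in> B" for x
    unfolding F_def
    by (rule continuous_on_compose2[OF smooth_on_continuous[OF sv]])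
      (use gB[OF that] in \<open>auto simp: g_def intro!: continuous_intros\<close>)
  have linF': "linear (F' x t)" if "x \<in> B" "t \<in> cbox 0 1" for x t
    using dF[OF that] has_derivative_linear by blast
  define F2 where "F2 x t = Blinfun (F' x t)" for x t
  have F2: "blinfun_apply (F2 x t) = F' x t" if "x \<in> B" "t \<in> cbox 0 1" for x t
    unfolding F2_def using linF'[OF that] by (simp add: bounded_linear_Blinfun_apply linear_conv_bounded_linear)
  have cF2: "continuous_on (B \<times> cbox 0 1) (\<lambda>(x, t). F2 x t)"
  proof (rule continuous_on_blinfun_componentwise)
    fix i :: 'a assume "i \<in> Basis"
    show "continuous_on (B \<times> cbox 0 1) (\<lambda>z. blinfun_apply (case z of (x, t) \<Rightarrow> F2 x t) i)"
      by (rule continuous_on_eq[OF cF'[of i]]) (auto simp: F2)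
  qed
  define f where "f x = integral (cbox 0 1) (F x)" for x
  have df: "(f has_derivative \<mu> x) (at x)" if x: "x \<in> B" for x
  proof -
    have "(f has_derivative integral (cbox 0 1) (F2 x)) (at x within B)"
      unfolding f_def
    proof (rule leibniz_rule[OF _ _ cF2 x B(2)])
      show "((\<lambda>x. F x t) has_derivative F2 y t) (at y within B)" if "y \<in> B" "t \<in> cbox 0 1" for y t
        unfolding F2[OF that] by (rule has_derivative_at_withinI[OF dF[OF that]])
      show "F y integrable_on cbox 0 1" if "y \<in> B" for y
        by (rule integrable_continuous[OF cF[OF that]])
    qed
    then have 1: "(f has_derivative integral (cbox 0 1) (F2 x)) (at x)"
      unfolding at_within_open[OF x B(1)] .
    have "integral (cbox 0 1) (F2 x) h = \<mu> x h" for h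
    proof -
      have "continuous_on (cbox 0 1) (F2 x)"
      proof -
        have "continuous_on (cbox (0::real) 1) (\<lambda>t. (x, t))" by (intro continuous_intros)
        moreover have "(\<lambda>t. (x, t)) ` cbox 0 1 \<subseteq> B \<times> cbox (0::real) 1" using x by auto
        ultimately show ?thesis using continuous_on_compose2[OF cF2] by fastforce
      qed
      then have "F2 x integrable_on cbox 0 1" by (rule integrable_continuous)
      from blinfun_apply_integral[OF this]
      have "integral (cbox 0 1) (F2 x) h = integral (cbox 0 1) (\<lambda>t. F2 x t h)" .
      also have "\<dots> = integral (cbox 0 1) (\<lambda>t. F' x t h)"
        by (intro integral_cong) (simp add: F2 x)
      also have "\<dots> = \<mu> x h"
      proof (rule integral_unique)
        have "((\<lambda>t. t * \<mu> (g x t) h) has_vector_derivative F' x t h) (at t within {0..1})"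
          if "t \<in> {0..1}" for t
        proof -
          have gx: "g x t \<in> B" using gB[OF x] that by simp
          have dg: "((\<lambda>t. \<mu> (g x t) h) has_derivative (\<lambda>s. D (g x t) h (s *\<^sub>R (x - c)))) (at t)"
            by (rule has_derivative_compose[of "\<lambda>t. g x t" "\<lambda>s. s *\<^sub>R (x - c)" t UNIV "\<lambda>y. \<mu> y h" "D (g x t) h"])
              (use dmu[OF gx] in \<open>auto simp: g_def intro!: derivative_eq_intros\<close>)
          have "((\<lambda>t. t * \<mu> (g x t) h) has_derivative (\<lambda>s. t * D (g x t) h (s *\<^sub>R (x - c)) + s * \<mu> (g x t) h)) (at t)"
            by (auto intro!: derivative_eq_intros dg)
          then have "((\<lambda>t. t * \<mu> (g x t) h) has_derivative (\<lambda>s. s *\<^sub>R F' x t h)) (at t)"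
            unfolding linear_cmul[OF linD1[OF gx]] Dsym[OF gx, of h "x - c"]
            by (simp add: F'_def distrib_left mult.left_commute)
          then show ?thesis
            unfolding has_vector_derivative_def by (rule has_derivative_at_withinI)
        qed
        from fundamental_theorem_of_calculus[OF _ this]
        show "((\<lambda>t. F' x t h) has_integral \<mu> x h) (cbox 0 1)"
          by (simp add: g_def)
      qed
      finally show ?thesis .
    qed
    then have "blinfun_apply (integral (cbox 0 1) (F2 x)) = \<mu> x" by auto
    with 1 show ?thesis by simp
  qed
  show ?thesis
  proof (rule that[of f])
    show "(f has_derivative \<mu> x) (at x)" if "x \<in> ball c r" for x using df that by (simp add: B_def)
    show "smooth_on (ball c r) f"
      by (rule smooth_onI[where D = \<mu>]) (use df sv in \<open>auto simp: B_def\<close>)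
  qed
qed

subsection \<open>Orthonormal frame fields on a surface\<close>

lemma eps_simps [simp]: "eps (1::2) = 1" "eps (2::2) = -1" "eps (1::3) = 1" "eps (2::3) = -1" "eps (3::3) = -1"
  by (auto simp: eps_def)

lemma lorentz_metric_onD:
  assumes "lorentz_metric_on D g" "x \<in> D"
  shows "bilinear (g x)" "g x X Y = g x Y X" "linear (g x X)" "linear (\<lambda>X. g x X Y)"
  using assms by (auto simp: lorentz_metric_on_def bilinear_def)

lemma metric_algebra:
  assumes "lorentz_metric_on D g" "x \<in> D"
  shows "g x (a *\<^sub>R Y) Z = a * g x Y Z" "g x Y (a *\<^sub>R Z) = a * g x Y Z"
    "g x (Y + V) Z = g x Y Z + g x V Z" "g x Y (Z + V) = g x Y Z + g x Y V"
    "g x (Y - V) Z = g x Y Z - g x V Z" "g x Y (Z - V) = g x Y Z - g x Y V"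
    "g x 0 Z = 0" "g x Z 0 = 0"
  using lorentz_metric_onD(3)[OF assms] lorentz_metric_onD(4)[OF assms, of Z]
  by (simp_all add: linear_add linear_cmul linear_diff linear_0)
    (use linear_0[OF lorentz_metric_onD(3)[OF assms]] linear_0[OF lorentz_metric_onD(4)[OF assms]]
      linear_add[OF lorentz_metric_onD(4)[OF assms]] linear_diff[OF lorentz_metric_onD(4)[OF assms]]
      linear_cmul[OF lorentz_metric_onD(4)[OF assms]] in auto)

lemma frame_bundleD:
  assumes "(x, v) \<in> frame_bundle D g"
  shows "x \<in> D" "g x (v $ 1) (v $ 1) = 1" "g x (v $ 2) (v $ 2) = -1" "g x (v $ 1) (v $ 2) = 0" "g x (v $ 2) (v $ 1) = 0"
  using assms by (auto simp: frame_bundle_def)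

lemma frame_bundleI:
  assumes "lorentz_metric_on D g" "x \<in> D" "g x (v $ 1) (v $ 1) = 1" "g x (v $ 2) (v $ 2) = -1" "g x (v $ 1) (v $ 2) = 0"
  shows "(x, v) \<in> frame_bundle D g"
  using assms lorentz_metric_onD(2)[OF assms(1,2)] by (auto simp: frame_bundle_def forall_2)

text \<open>The Gram matrix is nondegenerate, so the two vectors form a basis and pairing with them
  reads off the coefficients; the minus sign is the square of the second vector.\<close>

lemma frame_expansion:
  assumes L: "lorentz_metric_on D g" and v: "(x, v) \<in> frame_bundle D g"
  shows "X = g x (v $ 1) X *\<^sub>R v $ 1 - g x (v $ 2) X *\<^sub>R v $ 2"
proof -
  note fr = frame_bundleD[OF v]
  note lin = lorentz_metric_onD(3,4)[OF L fr(1)]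
  define p q r s where pqrs: "p = v $ 1 $ 1" "q = v $ 1 $ 2" "r = v $ 2 $ 1" "s = v $ 2 $ 2"
  have gl: "g x (v $ i) (a *\<^sub>R Y + b *\<^sub>R Z) = a * g x (v $ i) Y + b * g x (v $ i) Z" for i a b Y Z
    using lin by (simp add: linear_add linear_cmul)
  \<comment> \<open>A zero determinant would make the rows of cofactors linear relations between the
    frame vectors; pairing these with the frame kills every entry.\<close>
  have det: "p * s - q * r \<noteq> 0"
  proof
    assume 0: "p * s - q * r = 0"
    have z1: "s *\<^sub>R v $ 1 + (- q) *\<^sub>R v $ 2 = 0" "r *\<^sub>R v $ 1 + (- p) *\<^sub>R v $ 2 = 0"
      using 0 by (auto simp: vec_eq_iff forall_2 pqrs algebra_simps)
    have g0: "g x (v $ i) 0 = 0" for i using lin by (simp add: linear_0)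
    have "s = 0" "q = 0" "r = 0" "p = 0"
      using gl[of 1 s "v $ 1" "- q" "v $ 2"] gl[of 2 s "v $ 1" "- q" "v $ 2"]
        gl[of 1 r "v $ 1" "- p" "v $ 2"] gl[of 2 r "v $ 1" "- p" "v $ 2"]
      unfolding z1 g0 fr by auto
    then have "v $ 1 = 0" by (simp add: vec_eq_iff forall_2 pqrs)
    then show False using fr(2) g0[of 1] by simp
  qed
  define a b where ab: "a = (X $ 1 * s - X $ 2 * r) / (p * s - q * r)" "b = (p * X $ 2 - q * X $ 1) / (p * s - q * r)"
  have X: "X = a *\<^sub>R v $ 1 + b *\<^sub>R v $ 2"
  proof -
    have "(p * s - q * r) * X $ 1 = (X $ 1 * s - X $ 2 * r) * p + (p * X $ 2 - q * X $ 1) * r"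
      "(p * s - q * r) * X $ 2 = (X $ 1 * s - X $ 2 * r) * q + (p * X $ 2 - q * X $ 1) * s"
      by (simp_all add: algebra_simps)
    then have "X $ 1 = a * p + b * r" "X $ 2 = a * q + b * s"
      using det by (simp_all add: ab add_divide_distrib[symmetric] nonzero_eq_divide_eq mult.commute)
    then show ?thesis by (simp add: vec_eq_iff forall_2 pqrs)
  qed
  have "g x (v $ 1) X = a" "g x (v $ 2) X = - b"
    using gl[of 1 a "v $ 1" b "v $ 2"] gl[of 2 a "v $ 1" b "v $ 2"] unfolding X[symmetric] fr by auto
  with X show ?thesis by simp
qed

text \<open>The left-hand side is the square of the \<open>g\<close>-gradient of the functional \<open>l\<close>.\<close>

lemma frame_invariance:
  assumes L: "lorentz_metric_on D g" and v: "(x, v) \<in> frame_bundle D g" and w: "(x, w) \<in> frame_bundle D g"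
    and l: "linear l"
  shows "(l (v $ 1))\<^sup>2 - (l (v $ 2))\<^sup>2 = (l (w $ 1))\<^sup>2 - (l (w $ 2 :: real^2) :: real)\<^sup>2"
proof -
  define n where "n u = l (u $ 1) *\<^sub>R u $ 1 - l (u $ 2) *\<^sub>R u $ (2::2)" for u :: "(real^2)^2"
  have rep: "g x (n u) X = l X" and nn: "l (n u) = (l (u $ 1))\<^sup>2 - (l (u $ 2))\<^sup>2"
    if u: "(x, u) \<in> frame_bundle D g" for u X
  proof -
    note lin = metric_algebra[OF L frame_bundleD(1)[OF u]]
    have "l X = l (g x (u $ 1) X *\<^sub>R u $ 1 - g x (u $ 2) X *\<^sub>R u $ 2)"
      by (rule arg_cong[OF frame_expansion[OF L u]])
    also have "\<dots> = g x (n u) X"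
      using l by (simp add: n_def linear_diff linear_cmul lin)
    finally show "g x (n u) X = l X" ..
    show "l (n u) = (l (u $ 1))\<^sup>2 - (l (u $ 2))\<^sup>2"
      using l by (simp add: n_def linear_diff linear_cmul power2_eq_square)
  qed
  have "l (n v) = g x (n w) (n v)" using rep[OF w] by simp
  also have "\<dots> = g x (n v) (n w)" by (rule lorentz_metric_onD(2)[OF L frame_bundleD(1)[OF v]])
  also have "\<dots> = l (n w)" using rep[OF v] by simp
  finally show ?thesis using nn[OF v] nn[OF w] by simp
qed

lemma smooth_on_metric:
  fixes \<phi> :: "'a::euclidean_space \<Rightarrow> real^2"
  assumes L: "lorentz_metric_on D g" and o: "open D" "open S"
    and \<phi>: "\<And>x. x \<in> S \<Longrightarrow> \<phi> x \<in> D" "smooth_on S \<phi>" and YZ: "smooth_on S Y" "smooth_on S Z"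
  shows "smooth_on S (\<lambda>x. g (\<phi> x) (Y x) (Z x))"
proof -
  have 1: "smooth_on S (\<lambda>x. g (\<phi> x) v w)" for v w
    by (rule smooth_on_compose[OF o(2,1) \<phi>]) (use L in \<open>simp_all add: lorentz_metric_on_def\<close>)
  have 2: "smooth_on S (\<lambda>x. g (\<phi> x) (Y x) w)" for w
    by (rule smooth_on_apply_linear[where L = "\<lambda>x v. g (\<phi> x) v w", OF o(2) _ 1 YZ(1)])
      (use lorentz_metric_onD(4)[OF L \<phi>(1)] in blast)
  show ?thesis
    by (rule smooth_on_apply_linear[OF o(2) _ 2 YZ(2)])
      (use lorentz_metric_onD(3)[OF L \<phi>(1)] in blast)
qed

lemma smooth_form_eta:
  assumes L: "lorentz_metric_on D g" and o: "open D"
  shows "smooth_form (D \<times> UNIV) (eta g i)"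
  unfolding smooth_form_def
proof (intro conjI ballI allI)
  have oD: "open (D \<times> (UNIV :: ((real^2)^2) set))" by (intro open_Times o open_UNIV)
  fix q :: frame2 assume "q \<in> D \<times> UNIV"
  then have "fst q \<in> D" by auto
  note lin = lorentz_metric_onD(3)[OF L this]
  show "linear (eta g i q)"
    unfolding eta_def
    by (intro linearI) (auto simp: linear_add[OF lin] linear_cmul[OF lin] distrib_left)
next
  fix X :: frame2
  have oD: "open (D \<times> (UNIV :: ((real^2)^2) set))" by (intro open_Times o open_UNIV)
  note id = smooth_on_ident[OF oD]
  show "smooth_on (D \<times> UNIV) (\<lambda>q. eta g i q X)"
    unfolding eta_def
    by (intro smooth_on_mult[OF oD] smooth_on_const[OF oD] smooth_on_metric[OF L o oD]
        smooth_on_vec_nth[OF oD smooth_on_snd[OF oD id]] smooth_on_fst[OF oD id]) auto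
qed

section \<open>Lifts of vector fields to a frame field\<close>

definition section_lift :: "(real^2 \<Rightarrow> (real^2)^2) \<Rightarrow> (real^2 \<Rightarrow> real^2) \<Rightarrow> frame2 \<Rightarrow> frame2" where
  "section_lift E Z q = (Z (fst q), fderiv E (fst q) (Z (fst q)))"

lemma section_lift_derivative:
  assumes S: "open S" "x \<in> S" and E: "smooth_on S E" and Z: "smooth_on S Z"
  shows "(section_lift E Z has_derivative (\<lambda>h. (fderiv Z x (fst h),
      fderiv (\<lambda>y. fderiv E y (Z x)) x (fst h)
        + fderiv E x (fderiv Z x (fst h))))) (at (x, v))"
proof -
  have fst: "(fst has_derivative fst) (at (x, v))" by (auto intro!: derivative_eq_intros)
  have Z': "(Z has_derivative fderiv Z x) (at x)"
    by (rule smooth_on_has_derivative[OF Z S(2)])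
  have "((\<lambda>y. fderiv E y (Z y)) has_derivative (\<lambda>h.
      fderiv (\<lambda>y. fderiv E y (Z x)) x h
        + fderiv E x (fderiv Z x h))) (at x)"
    by (rule has_derivative_apply_linear[OF S _ _ Z'])
      (auto intro: linear_frechet_derivative smooth_on_differentiable[OF E]
        smooth_on_has_derivative[OF smooth_on_frechet[OF E] S(2)])
  from has_derivative_Pair[OF Z' this]
  have "((\<lambda>y. (Z y, fderiv E y (Z y))) has_derivative (\<lambda>h. (fderiv Z x h,
      fderiv (\<lambda>y. fderiv E y (Z x)) x h
        + fderiv E x (fderiv Z x h)))) (at (fst (x, v)))" by simp
  from has_derivative_compose[OF fst this] show ?thesis
    by (simp add: section_lift_def[abs_def])
qed

definition lie :: "(real^2 \<Rightarrow> real^2) \<Rightarrow> (real^2 \<Rightarrow> real^2) \<Rightarrow> real^2 \<Rightarrow> real^2" where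
  "lie Y Z x = fderiv Z x (Y x) - fderiv Y x (Z x)"

text \<open>Lifts are constant along the fibres and tangent to the graph of \<open>E\<close>. In
  their bracket the second derivatives of \<open>E\<close> cancel by symmetry, so the bracket of the
  lifts is the lift of the bracket.\<close>

lemma section_lift_bracket:
  fixes E :: "real^2 \<Rightarrow> (real^2)^2"
  assumes S: "open S" "x \<in> S" and E: "smooth_on S E"
  shows "(fderiv Z x (Y x),
      fderiv (\<lambda>y. fderiv E y (Z x)) x (Y x)
        + fderiv E x (fderiv Z x (Y x)))
    - (fderiv Y x (Z x),
      fderiv (\<lambda>y. fderiv E y (Y x)) x (Z x)
        + fderiv E x (fderiv Y x (Z x)))
    = (lie Y Z x, fderiv E x (lie Y Z x))"
  using symmetric_second_derivative[OF S E, of "Z x" "Y x"]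
    linear_frechet_derivative[OF smooth_on_differentiable[OF E S(2)]]
  by (simp add: lie_def linear_diff)

locale frame_section =
  fixes D :: "(real^2) set" and g :: metric2 and \<beta> :: "frame2 \<Rightarrow> frame2 \<Rightarrow> real" and \<kappa> :: "real^2 \<Rightarrow> real"
    and S :: "(real^2) set" and E :: "real^2 \<Rightarrow> (real^2)^2"
  assumes oD: "open D" and metric: "lorentz_metric_on D g" and struct: "structure_equations D g \<beta> \<kappa>"
    and oS: "open S" and SD: "S \<subseteq> D" and smE: "smooth_on S E"
    and frameE: "\<And>x. x \<in> S \<Longrightarrow> (x, E x) \<in> frame_bundle D g"
begin

definition DE :: "real^2 \<Rightarrow> real^2 \<Rightarrow> (real^2)^2" where "DE x = fderiv E x"
definition E1 :: "real^2 \<Rightarrow> real^2" where "E1 x = E x $ 1"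
definition E2 :: "real^2 \<Rightarrow> real^2" where "E2 x = E x $ 2"
definition bb :: "real^2 \<Rightarrow> real^2 \<Rightarrow> real" where "bb x X = \<beta> (x, E x) (X, DE x X)"
definition b1 :: "real^2 \<Rightarrow> real" where "b1 x = bb x (E1 x)"
definition b2 :: "real^2 \<Rightarrow> real" where "b2 x = bb x (E2 x)"

abbreviation sec :: "frame2 set" where "sec \<equiv> (\<lambda>x. (x, E x)) ` S"

lemma sec_subset: "sec \<subseteq> frame_bundle D g"
  using frameE by auto

lemma dE: "x \<in> S \<Longrightarrow> (E has_derivative DE x) (at x)"
  unfolding DE_def by (rule smooth_on_has_derivative[OF smE])

lemma linear_DE: "x \<in> S \<Longrightarrow> linear (DE x)"
  using dE has_derivative_linear by blast

lemma smE1: "smooth_on S E1" and smE2: "smooth_on S E2"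
  unfolding E1_def[abs_def] E2_def[abs_def] by (rule smooth_on_vec_nth[OF oS smE])+

lemma frame_metric:
  assumes "x \<in> S"
  shows "g x (E1 x) (E1 x) = 1" "g x (E2 x) (E2 x) = -1" "g x (E1 x) (E2 x) = 0" "g x (E2 x) (E1 x) = 0"
  using frame_bundleD[OF frameE[OF assms]] by (simp_all add: E1_def E2_def)

lemma expansion: "x \<in> S \<Longrightarrow> X = g x (E1 x) X *\<^sub>R E1 x - g x (E2 x) X *\<^sub>R E2 x"
  unfolding E1_def E2_def by (rule frame_expansion[OF metric frameE])

lemma section_tangent:
  assumes x: "x \<in> S"
  shows "(X, DE x X) \<in> tangent_space sec (x, E x)"
proof -
  have line: "((\<lambda>t. x + t *\<^sub>R X) has_derivative (\<lambda>t. t *\<^sub>R X)) (at 0)"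
    by (auto intro!: derivative_eq_intros)
  have "((\<lambda>t. E (x + t *\<^sub>R X)) has_derivative (\<lambda>t. DE x (t *\<^sub>R X))) (at (0::real))"
  proof -
    have "(E has_derivative DE x) (at (x + 0 *\<^sub>R X))" using dE[OF x] by simp
    from has_derivative_compose[OF line this] show ?thesis .
  qed
  then have "((\<lambda>t. (x + t *\<^sub>R X, E (x + t *\<^sub>R X))) has_derivative (\<lambda>t. t *\<^sub>R (X, DE x X))) (at 0)"
    using has_derivative_Pair[OF line] linear_DE[OF x] by (simp add: linear_cmul)
  moreover have "\<forall>\<^sub>F t in nhds (0::real). (x + t *\<^sub>R X, E (x + t *\<^sub>R X)) \<in> sec"
  proof -
    have "open ((\<lambda>t. x + t *\<^sub>R X) -` S)"
      by (intro open_vimage oS continuous_intros)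
    then have "\<forall>\<^sub>F t in nhds (0::real). x + t *\<^sub>R X \<in> S"
      using x unfolding eventually_nhds by (intro exI[of _ "(\<lambda>t. x + t *\<^sub>R X) -` S"]) auto
    then show ?thesis by eventually_elim auto
  qed
  ultimately show ?thesis
    unfolding tangent_space_def has_vector_derivative_def
    by (auto intro!: exI[of _ "\<lambda>t. (x + t *\<^sub>R X, E (x + t *\<^sub>R X))"])
qed

lemma section_tangent_frame: "x \<in> S \<Longrightarrow> (X, DE x X) \<in> tangent_space (frame_bundle D g) (x, E x)"
  using section_tangent tangent_space_mono[OF sec_subset] by blast

lemma lift_eq: "section_lift E Z (x, v) = (Z x, DE x (Z x))"
  by (simp add: section_lift_def DE_def)

lemma smooth_bb:
  assumes Z: "smooth_on S Z"
  shows "smooth_on S (\<lambda>x. bb x (Z x))"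
proof -
  have oDU: "open (D \<times> (UNIV :: ((real^2)^2) set))" by (intro open_Times oD open_UNIV)
  have sf: "smooth_form (D \<times> UNIV) \<beta>" using struct by (simp add: structure_equations_def)
  have "smooth_on S (\<lambda>x. \<beta> (x, E x) (Z x, DE x (Z x)))"
  proof (rule smooth_on_apply_linear[where L = "\<lambda>x. \<beta> (x, E x)" and Z = "\<lambda>x. (Z x, DE x (Z x))", OF oS])
    show "linear (\<beta> (x, E x))" if "x \<in> S" for x
      using sf that SD by (auto simp: smooth_form_def)
    show "smooth_on S (\<lambda>x. \<beta> (x, E x) v)" for v
      by (rule smooth_on_compose[OF oS oDU _ smooth_on_Pair[OF oS smooth_on_ident[OF oS] smE],
            where g = "\<lambda>q. \<beta> q v"])
        (use sf SD in \<open>auto simp: smooth_form_def simp del: split_paired_All\<close>)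
    show "smooth_on S (\<lambda>x. (Z x, DE x (Z x)))"
      unfolding DE_def by (intro smooth_on_Pair[OF oS] Z smooth_on_frechet_apply[OF oS smE])
  qed
  then show ?thesis by (simp add: bb_def)
qed

lemma smooth_b: "smooth_on S b1" "smooth_on S b2"
  unfolding b1_def[abs_def] b2_def[abs_def] by (intro smooth_bb smE1 smE2)+

lemma linear_bb: "x \<in> S \<Longrightarrow> linear (bb x)"
proof -
  assume x: "x \<in> S"
  have "linear (\<beta> (x, E x))"
    using struct x SD by (auto simp: structure_equations_def smooth_form_def)
  then show "linear (bb x)"
    unfolding bb_def using linear_DE[OF x]
    by (intro linearI) (simp_all add: linear_add linear_cmul flip: add_Pair scaleR_Pair)
qed

lemma vector_fields:
  assumes x: "x \<in> S" and \<alpha>: "smooth_form (D \<times> UNIV) \<alpha>" and YZ: "smooth_on S Y" "smooth_on S Z"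
  shows "ext_d \<alpha> (x, E x) (Y x, DE x (Y x)) (Z x, DE x (Z x)) =
      fderiv (\<lambda>p. \<alpha> p (section_lift E Z p)) (x, E x) (Y x, DE x (Y x))
    - fderiv (\<lambda>p. \<alpha> p (section_lift E Y p)) (x, E x) (Z x, DE x (Z x))
    - \<alpha> (x, E x) (lie Y Z x, DE x (lie Y Z x))"
proof -
  have oDU: "open (D \<times> (UNIV :: ((real^2)^2) set))" by (intro open_Times oD open_UNIV)
  have m: "(x, E x) \<in> D \<times> UNIV" using x SD by auto
  show ?thesis
    using ext_d_vector_fields[OF \<alpha> oDU m section_lift_derivative[OF oS x smE YZ(1)]
        section_lift_derivative[OF oS x smE YZ(2)]] section_lift_bracket[OF oS x smE, of Z Y]
    unfolding lift_eq fst_conv by (simp only: DE_def)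
qed

lemma lift_derivative:
  assumes x: "x \<in> S" and \<alpha>: "smooth_form (D \<times> UNIV) \<alpha>" and Z: "smooth_on S Z"
  shows "fderiv (\<lambda>p. \<alpha> p (section_lift E Z p)) (x, E x) (X, DE x X)
    = fderiv (\<lambda>y. \<alpha> (y, E y) (Z y, DE y (Z y))) x X"
proof -
  have oDU: "open (D \<times> (UNIV :: ((real^2)^2) set))" by (intro open_Times oD open_UNIV)
  have m: "(x, E x) \<in> D \<times> UNIV" using x SD by auto
  have "((\<lambda>y. (y, E y)) has_derivative (\<lambda>h. (h, DE x h))) (at x)"
    by (intro has_derivative_Pair has_derivative_ident dE x)
  from has_derivative_compose[OF this smooth_form_has_derivative[OF \<alpha> oDU m section_lift_derivative[OF oS x smE Z]]]
  have 1: "((\<lambda>y. \<alpha> (y, E y) (Z y, DE y (Z y))) has_derivative (\<lambda>h.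
      fderiv (\<lambda>p. \<alpha> p (section_lift E Z p)) (x, E x) (h, DE x h))) (at x)"
    unfolding frechet_derivative_eqI[OF smooth_form_has_derivative[OF \<alpha> oDU m section_lift_derivative[OF oS x smE Z]]] lift_eq .
  show ?thesis unfolding frechet_derivative_eqI[OF 1] ..
qed

lemma eta_lift:
  assumes x: "x \<in> S"
  shows "eta g 1 (x, E x) (E1 x, V) = 1" "eta g 1 (x, E x) (E2 x, V) = 0"
    "eta g 2 (x, E x) (E1 x, V) = 0" "eta g 2 (x, E x) (E2 x, V) = 1"
  using frame_metric[OF x] by (simp_all add: eta_def E1_def E2_def)

lemma frechet_const_on:
  assumes "x \<in> S" "\<And>y. y \<in> S \<Longrightarrow> f y = c"
  shows "fderiv f x X = 0"
  using frechet_derivative_cong_open[OF oS assms(1), of f "\<lambda>y. c"] assms(2) by simp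

text \<open>On the lifts of \<open>E1\<close> and \<open>E2\<close> the forms \<open>eta g i\<close>
  take constant values, so in Cartan's formula only the bracket survives and the first two structure
  equations compute it. The third one, treated the same way, is the Gauss equation.\<close>

lemma structure_section:
  assumes x: "x \<in> S"
  shows "lie E1 E2 x = b1 x *\<^sub>R E1 x - b2 x *\<^sub>R E2 x"
    and "fderiv b2 x (E1 x) - fderiv b1 x (E2 x) - (b1 x)\<^sup>2 + (b2 x)\<^sup>2 = - \<kappa> x"
proof -
  let ?q = "(x, E x)" and ?X = "(E1 x, DE x (E1 x))" and ?Y = "(E2 x, DE x (E2 x))"
  have s: "ext_d (eta g 1) ?q ?X ?Y = - wedge (\<beta> ?q) (eta g 2 ?q) ?X ?Y"
    "ext_d (eta g 2) ?q ?X ?Y = - wedge (\<beta> ?q) (eta g 1 ?q) ?X ?Y"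
    "ext_d \<beta> ?q ?X ?Y = - \<kappa> x * wedge (eta g 1 ?q) (eta g 2 ?q) ?X ?Y"
    using struct frameE[OF x] section_tangent_frame[OF x]
    unfolding structure_equations_def by (fastforce)+
  have sf: "smooth_form (D \<times> UNIV) \<beta>" using struct by (simp add: structure_equations_def)
  note se = smooth_form_eta[OF metric oD]
  have z: "fderiv (\<lambda>y. eta g i (y, E y) (Z y, DE y (Z y))) x X = 0"
    if "Z = E1 \<or> Z = E2" "i = 1 \<or> i = 2" for Z i X
    by (rule frechet_const_on[OF x, where c = "eta g i (x, E x) (Z x, DE x (Z x))"])
      (use that eta_lift x in auto)
  have e: "eta g i ?q (lie E1 E2 x, DE x (lie E1 E2 x)) = - ext_d (eta g i) ?q ?X ?Y" if "i = 1 \<or> i = 2" for i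
    using vector_fields[OF x se smE1 smE2, of i] that
    unfolding lift_derivative[OF x se smE1] lift_derivative[OF x se smE2] by (simp add: z)
  have "g x (E1 x) (lie E1 E2 x) = b1 x" "g x (E2 x) (lie E1 E2 x) = b2 x"
    using e[of 1] e[of 2] s(1,2) eta_lift[OF x]
    by (simp_all add: wedge_def b1_def b2_def bb_def eta_def E1_def[symmetric] E2_def[symmetric] frame_metric[OF x])
  then show lie: "lie E1 E2 x = b1 x *\<^sub>R E1 x - b2 x *\<^sub>R E2 x"
    using expansion[OF x, of "lie E1 E2 x"] by simp
  have "- \<kappa> x = fderiv b2 x (E1 x) - fderiv b1 x (E2 x) - bb x (lie E1 E2 x)"
    using vector_fields[OF x sf smE1 smE2] s(3) eta_lift[OF x]
    unfolding lift_derivative[OF x sf smE1] lift_derivative[OF x sf smE2]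
    by (simp add: wedge_def b1_def[abs_def] b2_def[abs_def] bb_def[abs_def])
  then show "fderiv b2 x (E1 x) - fderiv b1 x (E2 x) - (b1 x)\<^sup>2 + (b2 x)\<^sup>2 = - \<kappa> x"
    unfolding lie using linear_bb[OF x]
    by (simp add: linear_diff linear_cmul b1_def[symmetric] b2_def[symmetric] power2_eq_square)
qed

text \<open>\<open>structure_equations\<close> contains no regularity condition on \<kappa>; the
  Gauss equation writes \<kappa> through derivatives of the smooth functions \<open>b1\<close> and
  \<open>b2\<close>.\<close>

lemma smooth_curvature: "smooth_on S \<kappa>"
proof (rule smooth_on_cong[OF oS])
  show "smooth_on S (\<lambda>x. - (fderiv b2 x (E1 x) - fderiv b1 x (E2 x) - (b1 x)\<^sup>2 + (b2 x)\<^sup>2))"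
    by (intro smooth_on_minus[OF oS] smooth_on_add[OF oS] smooth_on_diff[OF oS] smooth_on_power[OF oS]
        smooth_on_frechet_apply[OF oS] smooth_b smE1 smE2)
qed (use structure_section(2) in force)

text \<open>Torsion-freeness applied to \<open>f\<close>.\<close>

lemma second_derivative_commutator:
  fixes f :: "real^2 \<Rightarrow> real"
  assumes x: "x \<in> S" and f: "smooth_on S f"
  shows "fderiv (\<lambda>y. fderiv f y (E2 y)) x (E1 x)
    - fderiv (\<lambda>y. fderiv f y (E1 y)) x (E2 x)
    = b1 x * fderiv f x (E1 x) - b2 x * fderiv f x (E2 x)"
proof -
  have d: "((\<lambda>y. fderiv f y (Z y)) has_derivative (\<lambda>h.
      fderiv (\<lambda>y. fderiv f y (Z x)) x h
        + fderiv f x (fderiv Z x h))) (at x)"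
    if "smooth_on S Z" for Z
    by (rule has_derivative_apply_linear[OF oS x _ _ smooth_on_has_derivative[OF that x]])
      (auto intro: linear_frechet_derivative smooth_on_differentiable[OF f]
        smooth_on_has_derivative[OF smooth_on_frechet[OF f] x])
  have l: "linear (fderiv f x)"
    by (rule linear_frechet_derivative[OF smooth_on_differentiable[OF f x]])
  have "fderiv f x (lie E1 E2 x)
      = b1 x * fderiv f x (E1 x) - b2 x * fderiv f x (E2 x)"
    unfolding structure_section(1)[OF x] using l by (simp add: linear_diff linear_cmul)
  then show ?thesis
    unfolding frechet_derivative_eqI[OF d[OF smE1]] frechet_derivative_eqI[OF d[OF smE2]]
    using symmetric_second_derivative[OF oS x f, of "E1 x" "E2 x"] l
    by (simp add: lie_def linear_diff)
qed

end

text \<open>Gram-Schmidt applied to two constant fields that are orthonormal at \<open>x0\<close>,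
  on the neighbourhood where both radicands stay positive.\<close>

lemma local_frame_exists:
  assumes o: "open D" and L: "lorentz_metric_on D g" and x0: "x0 \<in> D"
  obtains S E where "open S" "x0 \<in> S" "S \<subseteq> D" "smooth_on S E" "\<And>x. x \<in> S \<Longrightarrow> (x, E x) \<in> frame_bundle D g"
proof -
  obtain X Y where XY: "g x0 X X = 1" "g x0 Y Y = -1" "g x0 X Y = 0"
    using L x0 unfolding lorentz_metric_on_def by blast
  define A B C where ABC: "A = (\<lambda>x. g x X X)" "B = (\<lambda>x. g x X Y)" "C = (\<lambda>x. g x Y Y)"
  have sm: "smooth_on D A" "smooth_on D B" "smooth_on D C"
    using L unfolding ABC lorentz_metric_on_def by auto
  define U where "U = {x \<in> D. A x \<in> {0<..}}"
  have U: "open U" "x0 \<in> U" "U \<subseteq> D"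
    using continuous_open_preimage[OF smooth_on_continuous[OF sm(1)] o, of "{0<..}"] x0 XY
    by (auto simp: U_def ABC vimage_def Int_def)
  note smU = sm[THEN smooth_on_subset[OF _ U(3)]]
  \<comment> \<open>\<open>- G x\<close> is the square of
    \<open>Y - (B x / A x) *\<^sub>R X\<close>, the component of \<open>Y\<close> orthogonal to
    \<open>X\<close>; at \<open>x0\<close> it is -1.\<close>
  define G where "G x = (B x)\<^sup>2 / A x - C x" for x
  have smG: "smooth_on U G"
    unfolding G_def[abs_def] using U
    by (intro smooth_on_diff smooth_on_divide smooth_on_power smU) (auto simp: U_def)
  define S where "S = {x \<in> U. G x \<in> {0<..}}"
  have S: "open S" "x0 \<in> S" "S \<subseteq> D" "S \<subseteq> U"
    using continuous_open_preimage[OF smooth_on_continuous[OF smG] U(1), of "{0<..}"] U XY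
    by (auto simp: S_def G_def ABC vimage_def Int_def)
  note smS = smU[THEN smooth_on_subset[OF _ S(4)]] smG[THEN smooth_on_subset[OF _ S(4)]]
  have pos: "A x > 0" "G x > 0" if "x \<in> S" for x using that by (auto simp: S_def U_def)
  define e1 where "e1 x = inverse (sqrt (A x)) *\<^sub>R X" for x
  define e2 where "e2 x = inverse (sqrt (G x)) *\<^sub>R (Y - (B x / A x) *\<^sub>R X)" for x
  define E where "E x = (\<chi> i. if i = (1::2) then e1 x else e2 x)" for x
  have sm1: "smooth_on S e1"
    unfolding e1_def[abs_def] using pos
    by (intro smooth_on_scaleR[OF S(1)] smooth_on_inverse[OF S(1)] smooth_on_sqrt[OF S(1)] smooth_on_const[OF S(1)] smS)
      (auto simp: less_imp_neq[symmetric])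
  have sm2: "smooth_on S e2"
    unfolding e2_def[abs_def] using pos
    by (intro smooth_on_scaleR[OF S(1)] smooth_on_inverse[OF S(1)] smooth_on_sqrt[OF S(1)] smooth_on_const[OF S(1)]
        smooth_on_diff[OF S(1)] smooth_on_divide[OF S(1)] smS)
      (auto simp: less_imp_neq[symmetric])
  have smE: "smooth_on S E"
    unfolding E_def[abs_def]
  proof (rule smooth_on_vec_lambda[OF S(1)])
    show "smooth_on S (\<lambda>x. if i = (1::2) then e1 x else e2 x)" for i
      by (cases "i = 1") (use sm1 sm2 in simp_all)
  qed
  have fr: "(x, E x) \<in> frame_bundle D g" if x: "x \<in> S" for x
  proof -
    have xD: "x \<in> D" using x S by auto
    note lin = metric_algebra[OF L xD]
    have r: "sqrt (A x) * sqrt (A x) = A x" "sqrt (G x) * sqrt (G x) = G x" using pos[OF x] by auto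
    have YX: "g x Y X = B x" using lorentz_metric_onD(2)[OF L xD] by (simp add: ABC)
    have gg: "g x X X = A x" "g x X Y = B x" "g x Y Y = C x" by (simp_all add: ABC)
    have "g x (e1 x) (e1 x) = A x / (sqrt (A x) * sqrt (A x))"
      by (simp add: e1_def lin gg field_simps)
    then have 1: "g x (e1 x) (e1 x) = 1" using pos[OF x] by (simp add: r)
    have 2: "g x (e1 x) (e2 x) = 0"
      using pos[OF x] by (simp add: e1_def e2_def lin gg)
    have "g x (e2 x) (e2 x) = (C x - (B x)\<^sup>2 / A x) / (sqrt (G x) * sqrt (G x))"
      using pos[OF x]
      by (simp add: e2_def lin gg YX field_simps power2_eq_square)
    then have 3: "g x (e2 x) (e2 x) = -1" using pos[OF x] by (simp only: r) (simp add: G_def field_simps)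
    show ?thesis
      by (rule frame_bundleI[OF L xD]) (simp_all add: E_def 1 2 3)
  qed
  show ?thesis by (rule that[OF S(1-3) smE fr])
qed

subsection \<open>Frobenius systems over a frame field\<close>

text \<open>A sextuple \<open>(t\<^sub>1, t\<^sub>2, t\<^sub>3, w, u, v)\<close> stands for the element of the Lie algebra of isometries on which
  \<open>\<omega>\<^sup>1, \<omega>\<^sup>2, \<omega>\<^sup>3, \<omega>\<^sup>1\<^sub>2, \<omega>\<^sup>3\<^sub>1, \<omega>\<^sup>3\<^sub>2\<close> take these values; \<open>act\<close> is the left-invariant vector field on frames
  that it generates.\<close>

type_synonym 'a sextuple = "'a \<times> 'a \<times> 'a \<times> 'a \<times> 'a \<times> 'a"

fun act :: "real sextuple \<Rightarrow> frame3 \<Rightarrow> frame3" where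
  "act (t1, t2, t3, w, u, v) (\<rho>, e) = (t1 *\<^sub>R e $ 1 + t2 *\<^sub>R e $ 2 + t3 *\<^sub>R e $ 3,
     \<chi> i. if i = 1 then w *\<^sub>R e $ 2 + u *\<^sub>R e $ 3
          else if i = 2 then w *\<^sub>R e $ 1 + v *\<^sub>R e $ 3 else u *\<^sub>R e $ 1 - v *\<^sub>R e $ 2)"

text \<open>The signs are those of the Lie bracket of the generated vector fields, see
  \<open>act_commutator\<close>. The scalars are left open because brackets are formed over the
  complex numbers and split into real and imaginary parts afterwards.\<close>

fun br :: "'a::comm_ring sextuple \<Rightarrow> 'a sextuple \<Rightarrow> 'a sextuple" where
  "br (t1, t2, t3, w, u, v) (t1', t2', t3', w', u', v') =
     (w * t2' - t2 * w' + u * t3' - t3 * u',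
      w * t1' - t1 * w' - (v * t3' - t3 * v'),
      u * t1' - t1 * u' + v * t2' - t2 * v',
      u * v' - v * u', v * w' - w * v', u * w' - w * u')"

fun re6 :: "complex sextuple \<Rightarrow> real sextuple" where
  "re6 (t1, t2, t3, w, u, v) = (Re t1, Re t2, Re t3, Re w, Re u, Re v)"

fun im6 :: "complex sextuple \<Rightarrow> real sextuple" where
  "im6 (t1, t2, t3, w, u, v) = (Im t1, Im t2, Im t3, Im w, Im u, Im v)"

section \<open>The isometry algebra acting on Minkowski frames\<close>

lemma bounded_bilinear_act: "bounded_bilinear act"
proof -
  have "linear (act \<xi>)" for \<xi>
    by (cases \<xi> rule: prod_cases6)
      (auto intro!: linearI simp: vec_eq_iff forall_3 algebra_simps)
  moreover have "linear (\<lambda>\<xi>. act \<xi> f)" for f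
    by (cases f) (auto intro!: linearI simp: vec_eq_iff forall_3 algebra_simps)
  ultimately show ?thesis
    by (simp add: bilinear_conv_bounded_bilinear[symmetric] bilinear_def)
qed

lemma act_linear:
  "act (\<xi> + \<zeta>) f = act \<xi> f + act \<zeta> f" "act (\<xi> - \<zeta>) f = act \<xi> f - act \<zeta> f" "act 0 f = 0" "act \<xi> 0 = 0"
  using bounded_bilinear.add_left[OF bounded_bilinear_act] bounded_bilinear.diff_left[OF bounded_bilinear_act]
    bounded_bilinear.zero_left[OF bounded_bilinear_act] bounded_bilinear.zero_right[OF bounded_bilinear_act] by auto

text \<open>\<open>act \<xi>\<close> is linear in the frame and hence its own derivative, so the
  left-hand side is the Lie bracket of the fields \<open>act \<xi>\<close> and
  \<open>act \<zeta>\<close>.\<close>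

lemma act_commutator: "act \<zeta> (act \<xi> f) - act \<xi> (act \<zeta> f) = act (br \<xi> \<zeta>) f"
  by (cases \<xi> rule: prod_cases6; cases \<zeta> rule: prod_cases6; cases f)
    (auto simp: vec_eq_iff forall_3 algebra_simps)

lemma bounded_linear_re6: "bounded_linear re6" and bounded_linear_im6: "bounded_linear im6"
  by (auto simp: linear_conv_bounded_linear[symmetric] intro!: linearI)

lemma re6_br: "re6 (br \<xi> \<zeta>) = br (re6 \<xi>) (re6 \<zeta>) - br (im6 \<xi>) (im6 \<zeta>)"
  and im6_br: "im6 (br \<xi> \<zeta>) = br (re6 \<xi>) (im6 \<zeta>) + br (im6 \<xi>) (re6 \<zeta>)"
  by (cases \<xi> rule: prod_cases6; cases \<zeta> rule: prod_cases6; simp add: algebra_simps)+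

lemma mink_algebra:
  "mink (X + Y) Z = mink X Z + mink Y Z" "mink Z (X + Y) = mink Z X + mink Z Y"
  "mink (X - Y) Z = mink X Z - mink Y Z" "mink Z (X - Y) = mink Z X - mink Z Y"
  "mink (a *\<^sub>R X) Z = a * mink X Z" "mink Z (a *\<^sub>R X) = a * mink Z X"
  "mink 0 Z = 0" "mink Z 0 = 0"
  by (simp_all add: mink_def sum_3 algebra_simps)

lemma mink_frames_iff:
  "(\<rho>, e) \<in> mink_frames \<longleftrightarrow>
    mink (e $ 1) (e $ 1) = 1 \<and> mink (e $ 2) (e $ 2) = -1 \<and> mink (e $ 3) (e $ 3) = -1 \<and>
    mink (e $ 1) (e $ 2) = 0 \<and> mink (e $ 2) (e $ 1) = 0 \<and> mink (e $ 1) (e $ 3) = 0 \<and>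
    mink (e $ 3) (e $ 1) = 0 \<and> mink (e $ 2) (e $ 3) = 0 \<and> mink (e $ 3) (e $ 2) = 0"
  by (auto simp: mink_frames_def forall_3)

lemma mink_frames_nonempty: "(0, \<chi> i. axis i 1) \<in> mink_frames"
  by (simp add: mink_frames_iff mink_def sum_3 axis_def)

lemma omega_act:
  assumes "f \<in> mink_frames"
  shows "omega 1 f (act (t1, t2, t3, w, u, v) f) = t1" "omega 2 f (act (t1, t2, t3, w, u, v) f) = t2"
    "omega 3 f (act (t1, t2, t3, w, u, v) f) = t3" "omega_conn 1 2 f (act (t1, t2, t3, w, u, v) f) = w"
    "omega_conn 3 1 f (act (t1, t2, t3, w, u, v) f) = u" "omega_conn 3 2 f (act (t1, t2, t3, w, u, v) f) = v"
  using assms by (cases f; simp add: omega_def omega_conn_def mink_algebra mink_frames_iff)+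

definition rot12 :: "real \<Rightarrow> (real^3)^3 \<Rightarrow> (real^3)^3" where
  "rot12 s e = (\<chi> i. if i = 1 then cosh s *\<^sub>R e $ 1 + sinh s *\<^sub>R e $ 2
     else if i = 2 then sinh s *\<^sub>R e $ 1 + cosh s *\<^sub>R e $ 2 else e $ 3)"

definition rot31 :: "real \<Rightarrow> (real^3)^3 \<Rightarrow> (real^3)^3" where
  "rot31 s e = (\<chi> i. if i = 1 then cosh s *\<^sub>R e $ 1 + sinh s *\<^sub>R e $ 3
     else if i = 2 then e $ 2 else sinh s *\<^sub>R e $ 1 + cosh s *\<^sub>R e $ 3)"

definition rot32 :: "real \<Rightarrow> (real^3)^3 \<Rightarrow> (real^3)^3" where
  "rot32 s e = (\<chi> i. if i = 1 then e $ 1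
     else if i = 2 then cos s *\<^sub>R e $ 2 + sin s *\<^sub>R e $ 3 else cos s *\<^sub>R e $ 3 - sin s *\<^sub>R e $ 2)"

lemma cosh_sinh_square: "cosh s * cosh s = 1 + sinh s * sinh (s::real)"
  using cosh_square_eq[of s] by (simp add: power2_eq_square)

lemma cos_sin_square: "cos s * cos s = 1 - sin s * sin (s::real)"
  using sin_cos_squared_add[of s] by (simp add: power2_eq_square algebra_simps)

lemma rot_mink_frames:
  assumes "(\<rho>, e) \<in> mink_frames"
  shows "(\<rho>', rot12 s e) \<in> mink_frames" "(\<rho>', rot31 s e) \<in> mink_frames" "(\<rho>', rot32 s e) \<in> mink_frames"
  using assms
  by (simp_all add: mink_frames_iff rot12_def rot31_def rot32_def mink_algebra algebra_simps
      cosh_sinh_square cos_sin_square)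

lemma has_vector_derivative_vec:
  fixes f :: "real \<Rightarrow> ('b::euclidean_space)^'n::finite"
  assumes "\<And>i. ((\<lambda>s. f s $ i) has_vector_derivative f' $ i) (at t)"
  shows "(f has_vector_derivative f') (at t)"
proof -
  have e: "y = (\<Sum>i\<in>UNIV. axis i (y $ i))" for y :: "'b^'n"
    by (auto simp: vec_eq_iff axis_def if_distrib cong: if_cong)
  have "bounded_linear (axis i :: 'b \<Rightarrow> 'b^'n)" for i
    by (auto simp: linear_conv_bounded_linear[symmetric] axis_def vec_eq_iff intro!: linearI)
  from has_vector_derivative_sum[OF bounded_linear.has_vector_derivative[OF this assms]]
  have "((\<lambda>s. \<Sum>i\<in>UNIV. axis i (f s $ i)) has_vector_derivative (\<Sum>i\<in>UNIV. axis i (f' $ i))) (at t)" .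
  then show ?thesis by (simp flip: e)
qed

text \<open>A product of three one-parameter groups of rotations and boosts, together with a
  straight line for the basepoint, stays in the frame bundle. It is in general not a one-parameter
  group itself, but its velocity at 0 is the sum of the three generators.\<close>

lemma act_tangent:
  assumes f: "f \<in> mink_frames"
  shows "act \<xi> f \<in> tangent_space mink_frames f"
proof -
  obtain t1 t2 t3 w u v where \<xi>: "\<xi> = (t1, t2, t3, w, u, v)" by (cases \<xi> rule: prod_cases6)
  obtain \<rho> e where fe: "f = (\<rho>, e)" by (cases f)
  define c where "c t = rot12 (w * t) (rot31 (u * t) (rot32 (v * t) e))" for t
  define T where "T = t1 *\<^sub>R e $ 1 + t2 *\<^sub>R e $ 2 + t3 *\<^sub>R e $ 3"
  have "(c has_vector_derivative snd (act \<xi> f)) (at 0)"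
  proof (rule has_vector_derivative_vec)
    fix i :: 3
    show "((\<lambda>s. c s $ i) has_vector_derivative snd (act \<xi> f) $ i) (at 0)"
      using exhaust_3[of i] unfolding has_vector_derivative_def
      by (elim disjE; simp add: c_def rot12_def rot31_def rot32_def \<xi> fe)
        (auto intro!: derivative_eq_intros simp: algebra_simps)
  qed
  moreover have "((\<lambda>t. \<rho> + t *\<^sub>R T) has_vector_derivative fst (act \<xi> f)) (at 0)"
    unfolding has_vector_derivative_def by (auto intro!: derivative_eq_intros simp: \<xi> fe T_def)
  ultimately have "((\<lambda>t. (\<rho> + t *\<^sub>R T, c t)) has_vector_derivative act \<xi> f) (at 0)"
    using has_vector_derivative_Pair by fastforce
  moreover have "(\<rho> + 0 *\<^sub>R T, c 0) = f"
    by (simp add: c_def rot12_def rot31_def rot32_def fe vec_eq_iff forall_3)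
  moreover have "(\<rho> + t *\<^sub>R T, c t) \<in> mink_frames" for t
    unfolding c_def using f[unfolded fe] by (intro rot_mink_frames)
  ultimately show ?thesis
    unfolding tangent_space_def by (auto intro!: exI[of _ "\<lambda>t. (\<rho> + t *\<^sub>R T, c t)"])
qed

section \<open>Vector fields on the product of the frame bundles\<close>

definition bundle_field :: "(real^2 \<Rightarrow> (real^2)^2) \<Rightarrow> (real^2 \<Rightarrow> real^2) \<Rightarrow> (real^2 \<Rightarrow> real sextuple)
    \<Rightarrow> frame2 \<times> frame3 \<Rightarrow> frame2 \<times> frame3" where
  "bundle_field E Z \<xi> q = (section_lift E Z (fst q), act (\<xi> (fst (fst q))) (snd q))"

context frame_section
begin

definition field_deriv where
  "field_deriv Z \<xi> d\<xi> x f h = ((fderiv Z x (fst (fst h)),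
      fderiv (\<lambda>y. fderiv E y (Z x)) x (fst (fst h))
        + fderiv E x (fderiv Z x (fst (fst h)))),
      act (\<xi> x) (snd h) + act (d\<xi> (fst (fst h))) f)"
    for h :: "frame2 \<times> frame3"

lemma bundle_field_derivative:
  assumes x: "x \<in> S" and Z: "smooth_on S Z" and \<xi>: "(\<xi> has_derivative d\<xi>) (at x)"
  shows "(bundle_field E Z \<xi> has_derivative field_deriv Z \<xi> d\<xi> x f) (at ((x, v), f))"
proof -
  have 1: "((\<lambda>q. section_lift E Z (fst q)) has_derivative (\<lambda>h. (fderiv Z x (fst (fst h)),
      fderiv (\<lambda>y. fderiv E y (Z x)) x (fst (fst h))
        + fderiv E x (fderiv Z x (fst (fst h)))))) (at ((x, v), f))"
    by (rule has_derivative_compose[where f = fst and f' = fst])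
      (use section_lift_derivative[OF oS x smE Z, of v] in \<open>auto intro!: derivative_eq_intros\<close>)
  have 2: "((\<lambda>q. \<xi> (fst (fst q))) has_derivative (\<lambda>h. d\<xi> (fst (fst h)))) (at ((x, v), f))"
    by (rule has_derivative_compose[where f = "\<lambda>q. fst (fst q)" and f' = "\<lambda>q. fst (fst q)"])
      (use \<xi> in \<open>auto intro!: derivative_eq_intros\<close>)
  have 3: "(snd has_derivative snd) (at ((x, v), f))" by (auto intro!: derivative_eq_intros)
  show ?thesis
    using has_derivative_Pair[OF 1 bounded_bilinear.FDERIV[OF bounded_bilinear_act 2 3]]
    by (simp add: bundle_field_def[abs_def] field_deriv_def[abs_def])
qed

lemma bundle_field_eq: "bundle_field E Z \<xi> ((x, E x), f) = ((Z x, DE x (Z x)), act (\<xi> x) f)"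
  by (simp add: bundle_field_def lift_eq)

text \<open>The base fields differentiate the coefficients \<open>\<xi>'\<close> and
  \<open>\<xi>\<close>, while the left-invariant fields contribute only their commutator
  \<open>br\<close>.\<close>

lemma bundle_field_bracket:
  assumes x: "x \<in> S"
  shows "field_deriv Z' \<xi>' d\<xi>' x f (bundle_field E Z \<xi> ((x, E x), f))
      - field_deriv Z \<xi> d\<xi> x f (bundle_field E Z' \<xi>' ((x, E x), f))
    = ((lie Z Z' x, DE x (lie Z Z' x)), act (d\<xi>' (Z x) - d\<xi> (Z' x) + br (\<xi> x) (\<xi>' x)) f)"
proof -
  have a: "act (\<xi>' x) (act (\<xi> x) f) + act (d\<xi>' (Z x)) f - (act (\<xi> x) (act (\<xi>' x) f) + act (d\<xi> (Z' x)) f)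
      = act (d\<xi>' (Z x) - d\<xi> (Z' x) + br (\<xi> x) (\<xi>' x)) f"
    using act_commutator[of "\<xi>' x" "\<xi> x" f] by (simp add: act_linear algebra_simps)
  show ?thesis
    using section_lift_bracket[OF oS x smE, of Z' Z] a
    by (simp add: field_deriv_def bundle_field_eq DE_def)
qed

lemma bundle_field_tangent:
  assumes "x \<in> S" "f \<in> mink_frames"
  shows "bundle_field E Z \<xi> ((x, E x), f) \<in> tangent_space (sec \<times> mink_frames) ((x, E x), f)"
  unfolding bundle_field_eq by (intro tangent_space_Times section_tangent act_tangent assms)

end

section \<open>Fields annihilated by the Frobenius subbundle\<close>

locale darboux_section = frame_section +
  fixes W :: "(frame2 \<times> frame3) set" and \<alpha>s :: "(frame2 \<times> frame3 \<Rightarrow> frame2 \<times> frame3 \<Rightarrow> complex) list"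
    and f0 :: frame3
  assumes oW: "open W" and len: "length \<alpha>s \<ge> 2"
    and frob: "frobenius_frame (frame_bundle D g \<times> mink_frames) W \<alpha>s"
    and span: "\<And>q \<alpha>. q \<in> (frame_bundle D g \<times> mink_frames) \<inter> W \<Longrightarrow> \<alpha> \<in> set \<alpha>s \<Longrightarrow>
      in_span_on (tangent_space (frame_bundle D g \<times> mink_frames) q) (forms_at (singular_forms g \<beta> \<kappa> \<i>) q) (\<alpha> q)"
    and trans: "\<And>q v. q \<in> (frame_bundle D g \<times> mink_frames) \<inter> W \<Longrightarrow>
      in_span_on (tangent_space (frame_bundle D g \<times> mink_frames) q) (forms_at \<alpha>s q) v \<Longrightarrow>
      in_span_on (tangent_space (frame_bundle D g \<times> mink_frames) q) (forms_at (theta_forms g \<beta>) q) v \<Longrightarrow>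
      (\<forall>X\<in>tangent_space (frame_bundle D g \<times> mink_frames) q. v X = 0)"
    and f0: "f0 \<in> mink_frames" and base: "\<And>x. x \<in> S \<Longrightarrow> ((x, E x), f0) \<in> W"
    and kpos: "\<And>x. x \<in> S \<Longrightarrow> \<kappa> x > 0"
    and adapted: "\<And>x. x \<in> S \<Longrightarrow> fderiv \<kappa> x (E x $ 2) = 0"
      "\<And>x. x \<in> S \<Longrightarrow> fderiv \<kappa> x (E x $ 1) \<noteq> 0"
begin

abbreviation N where "N \<equiv> frame_bundle D g \<times> mink_frames"

definition at_pt where "at_pt \<alpha> x f \<longleftrightarrow> \<alpha> \<in> set \<alpha>s \<and> x \<in> S \<and> f \<in> mink_frames \<and> ((x, E x), f) \<in> W"

definition h1 where "h1 \<alpha> x f = (\<alpha> ((x, E x), f) (0, act (1, 0, 0, 0, 0, 0) f) :: complex)"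
definition h2 where "h2 \<alpha> x f = (\<alpha> ((x, E x), f) (0, act (0, 1, 0, 0, 0, 0) f) :: complex)"
definition h3 where "h3 \<alpha> x f = (\<alpha> ((x, E x), f) (0, act (0, 0, 1, 0, 0, 0) f) :: complex)"
definition h4 where "h4 \<alpha> x f = (\<alpha> ((x, E x), f) (0, act (0, 0, 0, 1, 0, 0) f) :: complex)"
definition h5 where "h5 \<alpha> x f = (\<alpha> ((x, E x), f) (0, act (0, 0, 0, 0, 1, 0) f) :: complex)"
definition h6 where "h6 \<alpha> x f = (\<alpha> ((x, E x), f) (0, act (0, 0, 0, 0, 0, 1) f) :: complex)"
definition hor where "hor \<alpha> x f Z = (\<alpha> ((x, E x), f) ((Z, DE x Z), 0) :: complex)"

fun ev where
  "ev \<alpha> x f Z (t1, t2, t3, w, u, v) = hor \<alpha> x f Z + t1 * h1 \<alpha> x f + t2 * h2 \<alpha> x f + t3 * h3 \<alpha> x f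
     + w * h4 \<alpha> x f + u * h5 \<alpha> x f + v * h6 \<alpha> x f"

definition kills :: "(real^2 \<Rightarrow> real^2) \<Rightarrow> (real^2 \<Rightarrow> complex sextuple) \<Rightarrow> bool" where
  "kills Z \<xi> \<longleftrightarrow> (\<forall>\<alpha> x f. at_pt \<alpha> x f \<longrightarrow> ev \<alpha> x f (Z x) (\<xi> x) = 0)"

lemma at_pt_linear: "at_pt \<alpha> x f \<Longrightarrow> linear (\<alpha> ((x, E x), f))"
  using frob by (auto simp: at_pt_def frobenius_frame_def smooth_form_def)

lemma ev_eq:
  assumes p: "at_pt \<alpha> x f"
  shows "ev \<alpha> x f Z \<xi> = \<alpha> ((x, E x), f) ((Z, DE x Z), act (re6 \<xi>) f)
    + \<i> * \<alpha> ((x, E x), f) (0, act (im6 \<xi>) f)"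
proof -
  obtain t1 t2 t3 w u v where \<xi>: "\<xi> = (t1, t2, t3, w, u, v)" by (cases \<xi> rule: prod_cases6)
  note lin = at_pt_linear[OF p]
  have b: "\<alpha> ((x, E x), f) (0, act (a1, a2, a3, a4, a5, a6) f) = of_real a1 * h1 \<alpha> x f + of_real a2 * h2 \<alpha> x f
      + of_real a3 * h3 \<alpha> x f + of_real a4 * h4 \<alpha> x f + of_real a5 * h5 \<alpha> x f + of_real a6 * h6 \<alpha> x f"
    for a1 a2 a3 a4 a5 a6
  proof -
    have sc: "act (c *\<^sub>R \<xi>) f = c *\<^sub>R act \<xi> f" for c \<xi>
      by (rule bounded_bilinear.scaleR_left[OF bounded_bilinear_act])
    have "(0 :: frame2, act (a1, a2, a3, a4, a5, a6) f) =
        a1 *\<^sub>R (0, act (1, 0, 0, 0, 0, 0) f) + a2 *\<^sub>R (0, act (0, 1, 0, 0, 0, 0) f)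
      + a3 *\<^sub>R (0, act (0, 0, 1, 0, 0, 0) f) + a4 *\<^sub>R (0, act (0, 0, 0, 1, 0, 0) f)
      + a5 *\<^sub>R (0, act (0, 0, 0, 0, 1, 0) f) + a6 *\<^sub>R (0, act (0, 0, 0, 0, 0, 1) f)"
      by (simp flip: sc act_linear)
    from arg_cong[OF this, of "\<alpha> ((x, E x), f)"] show ?thesis
      by (simp only: linear_add[OF lin] linear_cmul[OF lin] h1_def h2_def h3_def h4_def h5_def h6_def
          scaleR_conv_of_real)
  qed
  have c: "of_real (Re z) + \<i> * of_real (Im z) = z" for z by (simp add: complex_eq[symmetric])
  have s: "\<alpha> ((x, E x), f) ((Z, DE x Z), act (re6 \<xi>) f)
      = hor \<alpha> x f Z + \<alpha> ((x, E x), f) (0, act (re6 \<xi>) f)"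
    unfolding hor_def linear_add[OF lin, symmetric] by simp
  have d: "z * y = of_real (Re z) * y + \<i> * (of_real (Im z) * y)" for z y
    by (subst (1) c[of z, symmetric]) (simp add: algebra_simps)
  show ?thesis
    unfolding s unfolding \<xi> re6.simps im6.simps b ev.simps
    by (subst d[of t1], subst d[of t2], subst d[of t3], subst d[of w], subst d[of u], subst d[of v])
      (simp add: algebra_simps)
qed

text \<open>Forms act real-linearly on tangent vectors, so \<open>Z + \<xi>\<close> enters the
  Frobenius condition as the pair of real fields \<open>Z + re6 \<xi>\<close> and
  \<open>im6 \<xi>\<close>, the second of them vertical. The real and imaginary parts recombine by
  \<open>re6_br\<close> and \<open>im6_br\<close>.\<close>

lemma kills_bracket:
  assumes K: "kills Z \<xi>" "kills Z' \<xi>'" and Z: "smooth_on S Z" "smooth_on S Z'"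
    and d: "\<And>x. x \<in> S \<Longrightarrow> (\<xi> has_derivative d\<xi> x) (at x)" "\<And>x. x \<in> S \<Longrightarrow> (\<xi>' has_derivative d\<xi>' x) (at x)"
  shows "kills (lie Z Z') (\<lambda>x. d\<xi>' x (Z x) - d\<xi> x (Z' x) + br (\<xi> x) (\<xi>' x))"
  unfolding kills_def
proof (intro allI impI)
  fix \<alpha> x f assume p: "at_pt \<alpha> x f"
  then have x: "x \<in> S" and f: "f \<in> mink_frames" and \<alpha>: "\<alpha> \<in> set \<alpha>s" and qW: "((x, E x), f) \<in> W"
    by (auto simp: at_pt_def)
  let ?q = "((x, E x), f)"
  note lin = at_pt_linear[OF p]
  have z: "smooth_on S (\<lambda>x. 0 :: real^2)" by (rule smooth_on_const[OF oS])
  note dr = bounded_linear.has_derivative[OF bounded_linear_re6]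
  note di = bounded_linear.has_derivative[OF bounded_linear_im6]
  note fd = bundle_field_derivative[OF x]
  have ann0: "\<alpha>' p (bundle_field E Y (\<lambda>x. re6 (\<zeta> x)) p) + \<i> * \<alpha>' p (bundle_field E (\<lambda>x. 0) (\<lambda>x. im6 (\<zeta> x)) p) = 0"
    if K: "kills Y \<zeta>" and m: "\<alpha>' \<in> set \<alpha>s" "p \<in> sec \<times> mink_frames" "p \<in> W" for Y \<zeta> \<alpha>' p
  proof -
    obtain y f' where y: "y \<in> S" "f' \<in> mink_frames" "p = ((y, E y), f')" using m(2) by auto
    then have a: "at_pt \<alpha>' y f'" using m by (simp add: at_pt_def)
    have "ev \<alpha>' y f' (Y y) (\<zeta> y) = 0" using K a unfolding kills_def by blast
    then show ?thesis
      using linear_0[OF linear_DE[OF y(1)]]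
      unfolding ev_eq[OF a] y bundle_field_eq by (simp flip: zero_prod_def)
  qed
  have ann: "\<forall>\<alpha>\<in>set \<alpha>s. \<forall>p\<in>(sec \<times> mink_frames) \<inter> W.
      \<alpha> p (bundle_field E Y (\<lambda>x. re6 (\<zeta> x)) p) + \<i> * \<alpha> p (bundle_field E (\<lambda>x. 0) (\<lambda>x. im6 (\<zeta> x)) p) = 0"
    if "kills Y \<zeta>" for Y \<zeta>
    using ann0[OF that] by blast
  have l0: "lie (\<lambda>x. 0) Y x = 0" "lie Y (\<lambda>x. 0) x = 0" if "smooth_on S Y" for Y
    using linear_0[OF linear_frechet_derivative[OF smooth_on_differentiable[OF that x]]]
    by (simp_all add: lie_def)
  have D0: "DE x 0 = 0" using linear_0[OF linear_DE[OF x]] .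
  have sub: "sec \<times> mink_frames \<subseteq> N" using sec_subset by auto
  have qS: "?q \<in> sec \<times> mink_frames" using x f by auto
  note r = frobenius_bracket[where Y = "bundle_field E Z (\<lambda>x. re6 (\<xi> x))" and Z = "bundle_field E (\<lambda>x. 0) (\<lambda>x. im6 (\<xi> x))"
    and Y' = "bundle_field E Z' (\<lambda>x. re6 (\<xi>' x))" and Z' = "bundle_field E (\<lambda>x. 0) (\<lambda>x. im6 (\<xi>' x))"
    and q = "((x, E x), f)" and \<alpha> = \<alpha>, OF oW qW qS sub frob
    fd[OF Z(1) dr[OF d(1)[OF x]]] fd[OF z di[OF d(1)[OF x]]]
    fd[OF Z(2) dr[OF d(2)[OF x]]] fd[OF z di[OF d(2)[OF x]]]
    bundle_field_tangent[OF x f] bundle_field_tangent[OF x f] bundle_field_tangent[OF x f] bundle_field_tangent[OF x f]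
    ann[OF K(1)] ann[OF K(2)] \<alpha>]
  note r = r[unfolded bundle_field_bracket[OF x] l0[OF Z(1)] l0[OF Z(2)] l0[OF z] D0]
  have i0: "im6 (d\<xi> x 0) = 0" "im6 (d\<xi>' x 0) = 0" "re6 (d\<xi> x 0) = 0" "re6 (d\<xi>' x 0) = 0"
    using linear_0[OF has_derivative_linear[OF d(1)[OF x]]] linear_0[OF has_derivative_linear[OF d(2)[OF x]]]
      linear_0[OF bounded_linear.linear[OF bounded_linear_re6]] linear_0[OF bounded_linear.linear[OF bounded_linear_im6]]
    by simp_all
  have re: "re6 (a - b + c) = re6 a - re6 b + re6 c" and im: "im6 (a - b + c) = im6 a - im6 b + im6 c" for a b c
    using bounded_linear.linear[OF bounded_linear_re6] bounded_linear.linear[OF bounded_linear_im6]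
    by (simp_all add: linear_add linear_diff)
  let ?A = "re6 (d\<xi>' x (Z x)) - re6 (d\<xi> x (Z' x)) + br (re6 (\<xi> x)) (re6 (\<xi>' x))"
  let ?B = "br (im6 (\<xi> x)) (im6 (\<xi>' x))"
  let ?C = "im6 (d\<xi>' x (Z x)) + br (re6 (\<xi> x)) (im6 (\<xi>' x))"
  let ?F = "- im6 (d\<xi> x (Z' x)) + br (im6 (\<xi> x)) (re6 (\<xi>' x))"
  let ?L = "(lie Z Z' x, DE x (lie Z Z' x))"
  have main: "\<alpha> ?q (?L, act ?A f) - \<alpha> ?q ((0, 0), act ?B f) + \<i> * (\<alpha> ?q ((0, 0), act ?C f) + \<alpha> ?q ((0, 0), act ?F f)) = 0"
    using r i0 by simp
  have s1: "\<alpha> ?q (?L, act (?A - ?B) f) = \<alpha> ?q (?L, act ?A f) - \<alpha> ?q ((0, 0), act ?B f)"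
    unfolding linear_diff[OF lin, symmetric] by (simp add: act_linear)
  have s2: "\<alpha> ?q (0, act (?C + ?F) f) = \<alpha> ?q ((0, 0), act ?C f) + \<alpha> ?q ((0, 0), act ?F f)"
    unfolding linear_add[OF lin, symmetric] by (simp add: act_linear zero_prod_def)
  have e1: "re6 (d\<xi>' x (Z x) - d\<xi> x (Z' x) + br (\<xi> x) (\<xi>' x)) = ?A - ?B"
    unfolding re re6_br by (simp add: algebra_simps)
  have e2: "im6 (d\<xi>' x (Z x) - d\<xi> x (Z' x) + br (\<xi> x) (\<xi>' x)) = ?C + ?F"
    unfolding im im6_br by (simp add: algebra_simps)
  show "ev \<alpha> x f (lie Z Z' x) (d\<xi>' x (Z x) - d\<xi> x (Z' x) + br (\<xi> x) (\<xi>' x)) = 0"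
    unfolding ev_eq[OF p] e1 e2 s1 s2 by (rule main)
qed

lemma kills_bracket_vertical:
  assumes K: "kills Z \<xi>" "kills (\<lambda>x. 0) \<zeta>" and Z: "smooth_on S Z"
    and d: "\<And>x. x \<in> S \<Longrightarrow> (\<xi> has_derivative d\<xi> x) (at x)" "\<And>x. x \<in> S \<Longrightarrow> (\<zeta> has_derivative d\<zeta> x) (at x)"
    and p: "at_pt \<alpha> x f"
  shows "ev \<alpha> x f 0 (d\<zeta> x (Z x) + br (\<xi> x) (\<zeta> x)) = 0"
proof -
  have x: "x \<in> S" using p by (simp add: at_pt_def)
  have "ev \<alpha> x f (lie Z (\<lambda>x. 0) x) (d\<zeta> x (Z x) - d\<xi> x 0 + br (\<xi> x) (\<zeta> x)) = 0"
    using kills_bracket[OF K Z smooth_on_const[OF oS] d] p unfolding kills_def by blast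
  moreover have "lie Z (\<lambda>x. 0) x = 0"
    using linear_0[OF linear_frechet_derivative[OF smooth_on_differentiable[OF Z x]]] by (simp add: lie_def)
  moreover have "d\<xi> x 0 = 0" using linear_0[OF has_derivative_linear[OF d(1)[OF x]]] .
  ultimately show ?thesis by simp
qed

lemma hor_0 [simp]: "at_pt \<alpha> x f \<Longrightarrow> hor \<alpha> x f 0 = 0"
  using linear_0[OF at_pt_linear] linear_0[OF linear_DE, of x]
  by (auto simp: hor_def at_pt_def simp flip: zero_prod_def)

lemma length_forms: "length (forms_at (singular_forms g \<beta> \<kappa> \<i>) q) = 6" "length (forms_at (theta_forms g \<beta>) q) = 4"
  by (simp_all add: forms_at_def singular_forms_def theta_forms_def Let_def)

lemma sum_6: "(\<Sum>i<6. f i) = f 0 + f 1 + f 2 + f 3 + f 4 + (f 5 :: complex)" for f :: "nat \<Rightarrow> complex"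
  by (simp add: eval_nat_numeral)

lemma sum_4: "(\<Sum>i<4. f i) = f 0 + f 1 + f 2 + (f 3 :: complex)" for f :: "nat \<Rightarrow> complex"
  by (simp add: eval_nat_numeral)

lemma pt_N: "at_pt \<alpha> x f \<Longrightarrow> ((x, E x), f) \<in> N \<inter> W"
  using frameE by (auto simp: at_pt_def)

lemma field_tangent_N:
  "x \<in> S \<Longrightarrow> f \<in> mink_frames \<Longrightarrow> ((Z, DE x Z), act \<xi> f) \<in> tangent_space N ((x, E x), f)"
  by (intro tangent_space_Times section_tangent_frame act_tangent)

lemma vertical_tangent_N:
  "x \<in> S \<Longrightarrow> f \<in> mink_frames \<Longrightarrow> (0, act \<xi> f) \<in> tangent_space N ((x, E x), f)"
  using field_tangent_N[of x f 0 \<xi>] linear_0[OF linear_DE, of x] by (simp flip: zero_prod_def)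

lemma kills_singular:
  assumes "\<And>x f i. x \<in> S \<Longrightarrow> f \<in> mink_frames \<Longrightarrow> i < 6 \<Longrightarrow>
      (forms_at (singular_forms g \<beta> \<kappa> \<i>) ((x, E x), f) ! i) ((Z x, DE x (Z x)), act (re6 (\<xi> x)) f)
      + \<i> * (forms_at (singular_forms g \<beta> \<kappa> \<i>) ((x, E x), f) ! i) (0, act (im6 (\<xi> x)) f) = 0"
  shows "kills Z \<xi>"
  unfolding kills_def
proof (intro allI impI)
  fix \<alpha> x f assume p: "at_pt \<alpha> x f"
  then have x: "x \<in> S" and f: "f \<in> mink_frames" and \<alpha>: "\<alpha> \<in> set \<alpha>s" by (auto simp: at_pt_def)
  let ?q = "((x, E x), f)"
  obtain c where c: "\<And>X. X \<in> tangent_space N ?q \<Longrightarrow>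
      \<alpha> ?q X = (\<Sum>i<6. c i * (forms_at (singular_forms g \<beta> \<kappa> \<i>) ?q ! i) X)"
    using span[OF pt_N[OF p] \<alpha>] unfolding in_span_on_def length_forms by blast
  show "ev \<alpha> x f (Z x) (\<xi> x) = 0"
    unfolding ev_eq[OF p] c[OF field_tangent_N[OF x f]] c[OF vertical_tangent_N[OF x f]]
      sum_distrib_left sum.distrib[symmetric]
    by (intro sum.neutral ballI)
      (use assms[OF x f] in \<open>simp add: mult.left_commute[of \<i>] flip: distrib_left\<close>)
qed

definition k where "k x = sqrt (\<kappa> x)"
definition a where "a x = fderiv k x (E1 x) / (2 * k x)"

lemma k_pos: "x \<in> S \<Longrightarrow> k x > 0" and k_square: "x \<in> S \<Longrightarrow> (k x)\<^sup>2 = \<kappa> x"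
  using kpos by (auto simp: k_def less_imp_le)

lemma lt6: "i < 6 \<longleftrightarrow> i = 0 \<or> i = 1 \<or> i = 2 \<or> i = 3 \<or> i = 4 \<or> i = (5::nat)" by auto

text \<open>The six generators with \<open>s = \<i>\<close> determine the coefficients: the
  \<theta>s copy the dual forms and the connection form of the frame field, and the last two
  generators force \<open>u = \<i> k \<eta>2\<close> and
  \<open>v = - \<i> k \<eta>1\<close>.\<close>

lemma kills_X:
  shows "kills E1 (\<lambda>x. (1, 0, 0, of_real (b1 x), 0, - \<i> * of_real (k x)))"
    and "kills E2 (\<lambda>x. (0, 1, 0, of_real (b2 x), \<i> * of_real (k x), 0))"
proof -
  have e0: "eta g i q 0 = 0" if "fst q \<in> D" for i q
    using metric_algebra[OF metric that] by (simp add: eta_def)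
  have b0: "\<beta> (x, E x) 0 = 0" if "x \<in> S" for x
    using linear_0[of "\<beta> (x, E x)"] struct that SD by (auto simp: structure_equations_def smooth_form_def)
  show "kills E1 (\<lambda>x. (1, 0, 0, of_real (b1 x), 0, - \<i> * of_real (k x)))"
  proof (rule kills_singular, goal_cases)
    case (1 x f i)
    then show ?case
      using eta_lift[OF 1(1)] e0[of "(x, E x)"] b0[OF 1(1)] SD kpos[OF 1(1)]
      by (auto simp: lt6 forms_at_def singular_forms_def theta_forms_def Let_def omega_act[OF 1(2)] k_def
          b1_def bb_def)
  qed
  show "kills E2 (\<lambda>x. (0, 1, 0, of_real (b2 x), \<i> * of_real (k x), 0))"
  proof (rule kills_singular, goal_cases)
    case (1 x f i)
    then show ?case
      using eta_lift[OF 1(1)] e0[of "(x, E x)"] b0[OF 1(1)] SD kpos[OF 1(1)]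
      by (auto simp: lt6 forms_at_def singular_forms_def theta_forms_def Let_def omega_act[OF 1(2)] k_def
          b2_def bb_def)
  qed
qed

text \<open>Modulo the \<theta>s a form of the subbundle is determined by its coefficients at the
  last two singular generators, which are \<open>h5\<close> and \<open>h6\<close>. If all these
  pairs lay on one line, two independent forms would have a nontrivial combination in the span of
  the \<theta>s.\<close>

lemma transversality:
  assumes x: "x \<in> S" and f: "f \<in> mink_frames" and W: "((x, E x), f) \<in> W"
    and v: "\<And>\<alpha>. at_pt \<alpha> x f \<Longrightarrow> c1 * h5 \<alpha> x f + c2 * h6 \<alpha> x f = 0"
  shows "c1 = 0 \<and> c2 = 0"
proof (rule ccontr)
  assume ne: "\<not> (c1 = 0 \<and> c2 = 0)"
  let ?q = "((x, E x), f)" and ?T = "tangent_space N ((x, E x), f)"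
  let ?\<sigma> = "\<lambda>i. forms_at (singular_forms g \<beta> \<kappa> \<i>) ((x, E x), f) ! i"
  define A where "A = (\<lambda>j. \<alpha>s ! j)"
  have A: "at_pt (A j) x f" if "j < 2" for j
    using len that x f W by (auto simp: A_def at_pt_def)
  have ex: "\<exists>c. \<forall>X\<in>?T. A j ?q X = (\<Sum>i<6. c i * ?\<sigma> i X)" if "j < 2" for j
    using span[OF pt_N[OF A[OF that]], of "A j"] A[OF that] unfolding in_span_on_def length_forms at_pt_def by blast
  obtain p r where c01: "\<And>X. X \<in> ?T \<Longrightarrow> A 0 ?q X = (\<Sum>i<6. p i * ?\<sigma> i X)"
    "\<And>X. X \<in> ?T \<Longrightarrow> A 1 ?q X = (\<Sum>i<6. r i * ?\<sigma> i X)"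
    using ex[of 0] ex[of 1] by auto
  define c where "c j = (if j = 0 then p else r)" for j :: nat
  have c: "A j ?q X = (\<Sum>i<6. c j i * ?\<sigma> i X)" if "j < 2" "X \<in> ?T" for j X
    using c01[OF that(2)] that(1) by (auto simp: c_def less_2_cases_iff)
  have e0: "eta g i (x, E x) 0 = 0" for i
    using metric_algebra[OF metric, of x] x SD by (auto simp: eta_def)
  have b0: "\<beta> (x, E x) 0 = 0"
    using linear_0[of "\<beta> (x, E x)"] struct x SD by (auto simp: structure_equations_def smooth_form_def)
  \<comment> \<open>The fifth and sixth unit elements of the algebra are annihilated by all singular
    generators except the fifth, respectively the sixth.\<close>
  have h: "h5 (A j) x f = c j 4" "h6 (A j) x f = c j 5" if "j < 2" for j
    unfolding h5_def h6_def c[OF that vertical_tangent_N[OF x f]]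
    by (simp_all add: sum_6 forms_at_def singular_forms_def theta_forms_def Let_def omega_act[OF f] e0 b0)
  have rel: "c1 * c j 4 + c2 * c j 5 = 0" if "j < 2" for j
    using v[OF A[OF that]] h[OF that] by simp
  obtain d0 d1 where d: "d0 \<noteq> 0 \<or> d1 \<noteq> 0" "d0 * c 0 4 + d1 * c 1 4 = 0" "d0 * c 0 5 + d1 * c 1 5 = 0"
  proof (cases "c 0 4 = 0 \<and> c 0 5 = 0")
    case True
    then show ?thesis using that[of 1 0] by simp
  next
    case False
    \<comment> \<open>Both coefficient pairs satisfy the same nontrivial linear equation with
      coefficients \<open>c1\<close>, \<open>c2\<close>.\<close>
    have det: "c 0 4 * c 1 5 = c 0 5 * c 1 4"
    proof -
      have "c1 * (c 0 4 * c 1 5 - c 0 5 * c 1 4) = 0" "c2 * (c 0 4 * c 1 5 - c 0 5 * c 1 4) = 0"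
        using rel[of 0] rel[of 1] by (auto, algebra+)
      then show ?thesis using ne by auto
    qed
    show ?thesis
    proof (cases "c 0 4 = 0")
      case True
      then show ?thesis using that[of "c 1 5" "- c 0 5"] False det by (auto simp: mult.commute)
    next
      case False
      then show ?thesis using that[of "c 1 4" "- c 0 4"] det by (auto simp: mult.commute)
    qed
  qed
  define v where "v X = d0 * A 0 ?q X + d1 * A 1 ?q X" for X
  define cc where "cc j = (if j = 0 then d0 else if j = 1 then d1 else 0)" for j :: nat
  have sv: "v X = (\<Sum>j<length \<alpha>s. cc j * (forms_at \<alpha>s ?q ! j) X)" for X
  proof -
    have "(\<Sum>j<length \<alpha>s. cc j * (forms_at \<alpha>s ?q ! j) X) = (\<Sum>j\<in>{0, 1}. cc j * (forms_at \<alpha>s ?q ! j) X)"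
      using len by (intro sum.mono_neutral_right) (auto simp: cc_def)
    also have "\<dots> = v X"
    proof -
      have "forms_at \<alpha>s ?q ! 0 = A 0 ?q" "forms_at \<alpha>s ?q ! 1 = A 1 ?q"
      proof -
        have "0 < length \<alpha>s" "1 < length \<alpha>s" using len by auto
        then show "forms_at \<alpha>s ?q ! 0 = A 0 ?q" "forms_at \<alpha>s ?q ! 1 = A 1 ?q"
          by (simp_all add: forms_at_def A_def)
      qed
      then show ?thesis by (simp add: cc_def v_def)
    qed
    finally show ?thesis ..
  qed
  have 1: "in_span_on ?T (forms_at \<alpha>s ?q) v"
    unfolding in_span_on_def using sv by (auto simp: forms_at_def intro!: exI[of _ cc])
  have 2: "in_span_on ?T (forms_at (theta_forms g \<beta>) ?q) v"
    unfolding in_span_on_def length_forms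
  proof (intro exI[of _ "\<lambda>i. d0 * c 0 i + d1 * c 1 i"] ballI)
    fix X assume X: "X \<in> ?T"
    have t: "?\<sigma> i = forms_at (theta_forms g \<beta>) ?q ! i" if "i < 4" for i
    proof -
      have "i = 0 \<or> i = 1 \<or> i = 2 \<or> i = 3" using that by auto
      then show ?thesis
        by (elim disjE) (simp_all add: forms_at_def singular_forms_def theta_forms_def Let_def)
    qed
    have "v X = (\<Sum>i<6. (d0 * c 0 i + d1 * c 1 i) * ?\<sigma> i X)"
      unfolding v_def using c[of 0, OF _ X] c[of 1, OF _ X]
      by (simp add: sum_distrib_left sum.distrib algebra_simps)
    also have "\<dots> = (\<Sum>i<4. (d0 * c 0 i + d1 * c 1 i) * ?\<sigma> i X)"
      unfolding sum_6 sum_4 using d(2,3) by simp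
    also have "\<dots> = (\<Sum>i<4. (d0 * c 0 i + d1 * c 1 i) * (forms_at (theta_forms g \<beta>) ?q ! i) X)"
      by (intro sum.cong refl) (simp add: t)
    finally show "v X = (\<Sum>i<4. (d0 * c 0 i + d1 * c 1 i) * (forms_at (theta_forms g \<beta>) ?q ! i) X)" .
  qed
  have "\<forall>X\<in>?T. v X = 0" by (rule trans[OF pt_N[OF A[of 0]] 1 2]) simp
  then have "\<forall>X\<in>?T. (\<Sum>j<length (forms_at \<alpha>s ?q). cc j * (forms_at \<alpha>s ?q ! j) X) = 0"
    using sv by (simp add: forms_at_def)
  moreover have "independent_on ?T (forms_at \<alpha>s ?q)"
    using frob pt_N[OF A[of 0]] by (simp add: frobenius_frame_def)
  ultimately have "\<forall>j<length (forms_at \<alpha>s ?q). cc j = 0" unfolding independent_on_def by blast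
  moreover have "0 < length (forms_at \<alpha>s ?q)" "1 < length (forms_at \<alpha>s ?q)" using len by (auto simp: forms_at_def)
  ultimately have "cc 0 = 0" "cc 1 = 0" by blast+
  then show False using d(1) by (auto simp: cc_def)
qed

end

section \<open>Iterated brackets in the adapted frame\<close>

context darboux_section
begin

lemma smooth_k: "smooth_on S k"
  unfolding k_def[abs_def] by (rule smooth_on_sqrt[OF oS smooth_curvature kpos])

lemma smooth_a: "smooth_on S a"
  unfolding a_def[abs_def]
  by (rule smooth_on_divide[OF oS smooth_on_frechet_apply[OF oS smooth_k smE1]
        smooth_on_mult[OF oS smooth_on_const[OF oS] smooth_k]])
    (use k_pos in fastforce)

lemma k_derivative:
  assumes x: "x \<in> S"
  shows "fderiv k x (E1 x) = 2 * k x * a x" "fderiv k x (E2 x) = 0" "a x \<noteq> 0"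
proof -
  have "((\<lambda>y. sqrt (\<kappa> y)) has_derivative (\<lambda>h. fderiv \<kappa> x h * (inverse (sqrt (\<kappa> x)) / 2))) (at x)"
    by (rule DERIV_real_sqrt[THEN DERIV_compose_FDERIV, OF kpos[OF x]
          smooth_on_has_derivative[OF smooth_curvature x]])
  then have d: "fderiv k x = (\<lambda>h. fderiv \<kappa> x h * (inverse (sqrt (\<kappa> x)) / 2))"
    unfolding k_def[abs_def] by (rule frechet_derivative_eqI)
  show "fderiv k x (E1 x) = 2 * k x * a x"
    using k_pos[OF x] by (simp add: a_def)
  show "fderiv k x (E2 x) = 0"
    using adapted(1)[OF x] by (simp add: d E2_def)
  show "a x \<noteq> 0"
    using adapted(2)[OF x] k_pos[OF x] kpos[OF x] by (simp add: a_def d E1_def)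
qed

text \<open>With \<open>L = ln k / 2\<close> the adapted frame has \<open>E1 L = a\<close> and
  \<open>E2 L = 0\<close>, so torsion-freeness applied to \<open>L\<close> reads
  \<open>- E2 a = b1 * a\<close>.\<close>

lemma a_derivative:
  assumes x: "x \<in> S"
  shows "fderiv a x (E2 x) = - a x * b1 x"
proof -
  define L where "L y = 1 / 2 * ln (k y)" for y
  have smL: "smooth_on S L"
    unfolding L_def[abs_def]
    by (rule smooth_on_mult[OF oS smooth_on_const[OF oS] smooth_on_ln[OF oS smooth_k k_pos]])
  have dL: "fderiv L y h = fderiv k y h / (2 * k y)" if "y \<in> S" for y h
  proof -
    have "(L has_derivative (\<lambda>h. 1 / 2 * (fderiv k y h * inverse (k y)))) (at y)"
      unfolding L_def[abs_def]
      by (rule has_derivative_mult_right[OF has_derivative_ln[OF k_pos[OF that] smooth_on_has_derivative[OF smooth_k that]]])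
    from frechet_derivative_eqI[OF this] show ?thesis using k_pos[OF that] by (simp add: field_simps)
  qed
  have 1: "fderiv L y (E1 y) = a y" "fderiv L y (E2 y) = 0" if "y \<in> S" for y
    using dL[OF that] k_derivative[OF that] by (simp_all add: a_def)
  have "fderiv (\<lambda>y. fderiv L y (E2 y)) x (E1 x) = 0"
    by (rule frechet_const_on[OF x]) (use 1 in auto)
  moreover have "fderiv (\<lambda>y. fderiv L y (E1 y)) x = fderiv a x"
    by (rule frechet_derivative_cong_open[OF oS x]) (use 1 in auto)
  ultimately show ?thesis
    using second_derivative_commutator[OF x smL] 1[OF x] by (simp add: mult.commute)
qed

text \<open>With \<open>L = ln K / 4\<close>, so that \<open>a = E\<^sub>1 L\<close> and \<open>E\<^sub>2 L = 0\<close>, the components of \<open>Hess L - dL\<^sup>2 + K g\<close> are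
  \<open>2 k p, 2 k q, 2 k r\<close>; the brackets will show \<open>q = r = 0\<close> and \<open>p = a\<^sup>2 / k\<close>.\<close>

definition a1 where "a1 x = fderiv a x (E1 x)"
definition p where "p x = ((k x)\<^sup>2 + a1 x - (a x)\<^sup>2) / (2 * k x)"
definition q where "q x = - (a x * b1 x) / (2 * k x)"
definition r where "r x = - (a x * b2 x + (k x)\<^sup>2) / (2 * k x)"
definition n where "n x = (p x + r x) / a x"

lemma smooth_pqrn: "smooth_on S p" "smooth_on S q" "smooth_on S r" "smooth_on S n"
proof -
  have 2: "smooth_on S (\<lambda>x. 2 * k x)" by (rule smooth_on_mult[OF oS smooth_on_const[OF oS] smooth_k])
  have nz: "2 * k x \<noteq> 0" if "x \<in> S" for x using k_pos[OF that] by simp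
  have sa1: "smooth_on S a1"
    unfolding a1_def[abs_def] by (rule smooth_on_frechet_apply[OF oS smooth_a smE1])
  note pw = smooth_on_power[OF oS]
  show p: "smooth_on S p"
    unfolding p_def[abs_def]
    by (rule smooth_on_divide[OF oS smooth_on_diff[OF oS smooth_on_add[OF oS pw[OF smooth_k] sa1] pw[OF smooth_a]] 2 nz])
  show "smooth_on S q"
    unfolding q_def[abs_def]
    by (rule smooth_on_divide[OF oS smooth_on_minus[OF oS smooth_on_mult[OF oS smooth_a smooth_b(1)]] 2 nz])
  show r: "smooth_on S r"
    unfolding r_def[abs_def]
    by (rule smooth_on_divide[OF oS smooth_on_minus[OF oS smooth_on_add[OF oS
          smooth_on_mult[OF oS smooth_a smooth_b(2)] pw[OF smooth_k]]] 2 nz])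
  show "smooth_on S n"
    unfolding n_def[abs_def]
    by (rule smooth_on_divide[OF oS smooth_on_add[OF oS p r] smooth_a k_derivative(3)])
qed

lemma pqrn_eqs:
  assumes x: "x \<in> S"
  shows "2 * k x * p x = (k x)\<^sup>2 + a1 x - (a x)\<^sup>2" "2 * k x * q x = - (a x * b1 x)"
    "2 * k x * r x = - (a x * b2 x + (k x)\<^sup>2)" "n x * a x = p x + r x"
  using k_pos[OF x] k_derivative(3)[OF x] by (simp_all add: p_def q_def r_def n_def)

definition ofr :: "real \<Rightarrow> complex" where "ofr = of_real"

lemma ofr_cong: "x = y \<Longrightarrow> ofr x = ofr y"
  by simp

lemma ofr_eqs: "ofr (x + y) = ofr x + ofr y" "ofr (x - y) = ofr x - ofr y" "ofr (x * y) = ofr x * ofr y" "ofr (- x) = - ofr x"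
  "ofr (x\<^sup>2) = (ofr x)\<^sup>2" "ofr 2 = 2" "ofr 0 = 0" "ofr x = 0 \<longleftrightarrow> x = 0"
  by (simp_all add: ofr_def)

lemma has_derivative_ofr:
  assumes "smooth_on S f" "x \<in> S"
  shows "((\<lambda>x. ofr (f x)) has_derivative (\<lambda>h. ofr (fderiv f x h))) (at x)"
  unfolding ofr_def by (rule has_derivative_of_real[OF smooth_on_has_derivative[OF assms]])

text \<open>Writing \<open>X\<^sub>i = E\<^sub>i + \<xi>\<^sub>i\<close>, the sections \<open>Om, Z4, Z5, G\<close> are the normalized brackets
  \<open>[X\<^sub>1, X\<^sub>2]\<close>, \<open>[X\<^sub>1, Om]\<close>, \<open>[X\<^sub>2, Om]\<close> and \<open>[Om, Z5]\<close>, each modulo the preceding sections.\<close>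

definition Xi1 where "Xi1 x = (1, 0, 0, ofr (b1 x), 0, - \<i> * ofr (k x))"
definition Xi2 where "Xi2 x = (0, 1, 0, ofr (b2 x), \<i> * ofr (k x), 0)"
definition Om where "Om x = (0, 0, 1, - \<i> * ofr (k x), - ofr (a x), 0)"
definition Z4 where "Z4 x = (0, 1, 0, - ofr (a x), \<i> * ofr (p x), \<i> * ofr (q x))"
definition Z5 where "Z5 x = (1, 0, 0, 0, \<i> * ofr (q x), \<i> * ofr (r x))"
definition G where "G x = (0, 0, 0, 1, - \<i> * ofr (n x), 0)"

lemma kills_Xi: "kills E1 Xi1" "kills E2 Xi2"
  using kills_X unfolding Xi1_def[abs_def] Xi2_def[abs_def] ofr_def .

lemma derivs:
  assumes x: "x \<in> S"
  shows "(Xi1 has_derivative (\<lambda>h. (0, 0, 0, ofr (fderiv b1 x h), 0, - \<i> * ofr (fderiv k x h)))) (at x)"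
    "(Xi2 has_derivative (\<lambda>h. (0, 0, 0, ofr (fderiv b2 x h), \<i> * ofr (fderiv k x h), 0))) (at x)"
    "(Om has_derivative (\<lambda>h. (0, 0, 0, - \<i> * ofr (fderiv k x h), - ofr (fderiv a x h), 0))) (at x)"
    "(Z4 has_derivative (\<lambda>h. (0, 0, 0, - ofr (fderiv a x h), \<i> * ofr (fderiv p x h),
        \<i> * ofr (fderiv q x h)))) (at x)"
    "(Z5 has_derivative (\<lambda>h. (0, 0, 0, 0, \<i> * ofr (fderiv q x h), \<i> * ofr (fderiv r x h)))) (at x)"
    "(G has_derivative (\<lambda>h. (0, 0, 0, 0, - \<i> * ofr (fderiv n x h), 0))) (at x)"
  unfolding Xi1_def[abs_def] Xi2_def[abs_def] Om_def[abs_def] Z4_def[abs_def] Z5_def[abs_def] G_def[abs_def]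
  by (intro has_derivative_Pair has_derivative_const has_derivative_mult_right has_derivative_minus
      has_derivative_ofr smooth_b smooth_k smooth_a smooth_pqrn x)+

text \<open>The bracket of \<open>E1 + Xi1\<close> and \<open>E2 + Xi2\<close>. Its horizontal part
  is \<open>b1 E1 - b2 E2\<close>, which these two fields eliminate; the Gauss equation then turns
  the coefficient of \<open>h4\<close> into \<open>- 2 k^2\<close>, and a factor
  \<open>2 \<i> k\<close> can be cancelled throughout.\<close>

lemma h3_eq:
  assumes pt: "at_pt \<alpha> x f"
  shows "h3 \<alpha> x f = \<i> * ofr (k x) * h4 \<alpha> x f + ofr (a x) * h5 \<alpha> x f"
proof -
  have x: "x \<in> S" using pt by (simp add: at_pt_def)
  have e0: "ev \<alpha> x f (E1 x) (Xi1 x) = 0" "ev \<alpha> x f (E2 x) (Xi2 x) = 0"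
    using kills_Xi pt unfolding kills_def by blast+
  note kb = kills_bracket[OF kills_Xi smE1 smE2 derivs(1) derivs(2)]
  have e: "ev \<alpha> x f (lie E1 E2 x) ((0, 0, 0, ofr (fderiv b2 x (E1 x)), \<i> * ofr (fderiv k x (E1 x)), 0)
      - (0, 0, 0, ofr (fderiv b1 x (E2 x)), 0, - \<i> * ofr (fderiv k x (E2 x))) + br (Xi1 x) (Xi2 x)) = 0"
    using kb pt unfolding kills_def by blast
  have hl: "hor \<alpha> x f (lie E1 E2 x) = ofr (b1 x) * hor \<alpha> x f (E1 x) - ofr (b2 x) * hor \<alpha> x f (E2 x)"
  proof -
    note lin = at_pt_linear[OF pt] and lD = linear_DE[OF x]
    have "((lie E1 E2 x, DE x (lie E1 E2 x)), 0 :: frame3)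
        = b1 x *\<^sub>R ((E1 x, DE x (E1 x)), 0) - b2 x *\<^sub>R ((E2 x, DE x (E2 x)), 0)"
      unfolding structure_section(1)[OF x] by (simp add: linear_diff[OF lD] linear_cmul[OF lD])
    from arg_cong[OF this, of "\<alpha> ((x, E x), f)"] show ?thesis
      by (simp only: hor_def ofr_def linear_diff[OF lin] linear_cmul[OF lin] scaleR_conv_of_real[where 'a = complex])
  qed
  define H1 H2 H3 H4 H5 H6 where H: "H1 = h1 \<alpha> x f" "H2 = h2 \<alpha> x f" "H3 = h3 \<alpha> x f" "H4 = h4 \<alpha> x f" "H5 = h5 \<alpha> x f" "H6 = h6 \<alpha> x f"
  define A B C K D2 D1 where abc: "A = ofr (a x)" "B = ofr (b1 x)" "C = ofr (b2 x)" "K = ofr (k x)"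
    "D2 = ofr (fderiv b2 x (E1 x))" "D1 = ofr (fderiv b1 x (E2 x))"
  define u v where uv: "u = hor \<alpha> x f (E1 x)" "v = hor \<alpha> x f (E2 x)"
  have s: "D2 - D1 - B\<^sup>2 + C\<^sup>2 = - K\<^sup>2"
    using ofr_cong[OF structure_section(2)[OF x]] unfolding k_square[OF x, symmetric] ofr_eqs abc .
  have u: "u + H1 + B * H4 - \<i> * K * H6 = 0" and v: "v + H2 + C * H4 + \<i> * K * H5 = 0"
    using e0 by (simp_all add: Xi1_def Xi2_def H abc uv)
  have "(B * u - C * v) + B * H1 - C * H2 - 2 * \<i> * K * H3 + (D2 - D1 - K\<^sup>2) * H4 + (2 * \<i> * K * A - \<i> * K * C) * H5 - \<i> * K * B * H6 = 0"
    using e by (simp add: Xi1_def Xi2_def hl k_derivative[OF x] ofr_eqs H[symmetric] abc[symmetric] uv[symmetric]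
        power2_eq_square algebra_simps)
  with s u v have "2 * \<i> * K * (H3 - \<i> * K * H4 - A * H5) = 0"
    using i_squared by algebra
  moreover have "K \<noteq> 0" using k_pos[OF x] by (simp add: abc ofr_eqs)
  ultimately have "H3 - \<i> * K * H4 - A * H5 = 0" by simp
  then have "H3 = \<i> * K * H4 + A * H5" by algebra
  then show ?thesis by (simp add: H abc)
qed

lemma kills_Om: "kills (\<lambda>x. 0) Om"
  unfolding kills_def Om_def by (simp add: h3_eq)

text \<open>The bracket of \<open>E1 + Xi1\<close> with \<open>Om\<close>, after eliminating
  \<open>h3\<close> and cancelling \<open>2 \<i> k\<close>. The functions \<open>p\<close> and
  \<open>q\<close> are defined as the coefficients that remain.\<close>

lemma h2_eq:
  assumes pt: "at_pt \<alpha> x f"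
  shows "h2 \<alpha> x f = ofr (a x) * h4 \<alpha> x f - \<i> * ofr (p x) * h5 \<alpha> x f - \<i> * ofr (q x) * h6 \<alpha> x f"
proof -
  have x: "x \<in> S" using pt by (simp add: at_pt_def)
  note e = kills_bracket_vertical[OF kills_Xi(1) kills_Om smE1 derivs(1) derivs(3) pt]
  define H1 H2 H3 H4 H5 H6 where H: "H1 = h1 \<alpha> x f" "H2 = h2 \<alpha> x f" "H3 = h3 \<alpha> x f" "H4 = h4 \<alpha> x f" "H5 = h5 \<alpha> x f" "H6 = h6 \<alpha> x f"
  define A B K A1 P Q where abc: "A = ofr (a x)" "B = ofr (b1 x)" "K = ofr (k x)" "A1 = ofr (a1 x)" "P = ofr (p x)" "Q = ofr (q x)"
  have pq: "2 * K * P = K\<^sup>2 + A1 - A\<^sup>2" "2 * K * Q = - (A * B)"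
    using pqrn_eqs(1,2)[OF x, THEN ofr_cong] unfolding ofr_eqs abc by auto
  have 3: "H3 = \<i> * K * H4 + A * H5" using h3_eq[OF pt] by (simp add: H abc)
  have "2 * \<i> * K * H2 + A * H3 - 3 * \<i> * K * A * H4 - (A1 + K\<^sup>2) * H5 + A * B * H6 = 0"
    using e pt by (simp add: Xi1_def Om_def k_derivative[OF x] a1_def[symmetric] ofr_eqs H[symmetric] abc[symmetric]
        power2_eq_square algebra_simps)
  with 3 pq have "2 * \<i> * K * (H2 - A * H4 + \<i> * P * H5 + \<i> * Q * H6) = 0"
    using i_squared by algebra
  moreover have "K \<noteq> 0" using k_pos[OF x] by (simp add: abc ofr_eqs)
  ultimately have "H2 - A * H4 + \<i> * P * H5 + \<i> * Q * H6 = 0" by simp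
  then have "H2 = A * H4 - \<i> * P * H5 - \<i> * Q * H6" by algebra
  then show ?thesis by (simp add: H abc)
qed

text \<open>The bracket of \<open>E2 + Xi2\<close> with \<open>Om\<close>. By
  \<open>a_derivative\<close> the coefficient of \<open>h5\<close> is the \<open>q\<close> already
  met in \<open>h2_eq\<close>, which reflects the symmetry of the Hessian.\<close>

lemma h1_eq:
  assumes pt: "at_pt \<alpha> x f"
  shows "h1 \<alpha> x f = - \<i> * ofr (q x) * h5 \<alpha> x f - \<i> * ofr (r x) * h6 \<alpha> x f"
proof -
  have x: "x \<in> S" using pt by (simp add: at_pt_def)
  note e = kills_bracket_vertical[OF kills_Xi(2) kills_Om smE2 derivs(2) derivs(3) pt]
  define H1 H2 H3 H4 H5 H6 where H: "H1 = h1 \<alpha> x f" "H2 = h2 \<alpha> x f" "H3 = h3 \<alpha> x f" "H4 = h4 \<alpha> x f" "H5 = h5 \<alpha> x f" "H6 = h6 \<alpha> x f"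
  define A B C K Q R where abc: "A = ofr (a x)" "B = ofr (b1 x)" "C = ofr (b2 x)" "K = ofr (k x)" "Q = ofr (q x)" "R = ofr (r x)"
  have pq: "2 * K * Q = - (A * B)" "2 * K * R = - (A * C + K\<^sup>2)"
    using pqrn_eqs(2,3)[OF x, THEN ofr_cong] unfolding ofr_eqs abc by auto
  have "2 * \<i> * K * H1 + A * B * H5 + (A * C + K\<^sup>2) * H6 = 0"
    using e pt by (simp add: Xi2_def Om_def k_derivative[OF x] a_derivative[OF x] ofr_eqs H[symmetric] abc[symmetric]
        power2_eq_square algebra_simps)
  with pq have "2 * \<i> * K * (H1 + \<i> * Q * H5 + \<i> * R * H6) = 0"
    using i_squared by algebra
  moreover have "K \<noteq> 0" using k_pos[OF x] by (simp add: abc ofr_eqs)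
  ultimately have "H1 + \<i> * Q * H5 + \<i> * R * H6 = 0" by simp
  then have "H1 = - \<i> * Q * H5 - \<i> * R * H6" by algebra
  then show ?thesis by (simp add: H abc)
qed

lemma kills_Z: "kills (\<lambda>x. 0) Z4" "kills (\<lambda>x. 0) Z5"
  unfolding kills_def Z4_def Z5_def by (auto simp: h2_eq h1_eq algebra_simps)

lemma derivs_0:
  assumes "x \<in> S"
  shows "fderiv b1 x 0 = 0" "fderiv k x 0 = 0" "fderiv a x 0 = 0"
    "fderiv p x 0 = 0" "fderiv q x 0 = 0" "fderiv r x 0 = 0"
  using linear_0[OF linear_frechet_derivative] smooth_on_differentiable assms smooth_k smooth_a smooth_b smooth_pqrn
  by blast+

text \<open>In the bracket of \<open>Om\<close> with \<open>Z4\<close> the \<open>h4\<close> terms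
  cancel once \<open>h1\<close> and \<open>h2\<close> are substituted. What is left involves
  \<open>h5\<close> and \<open>h6\<close> alone, so \<open>transversality\<close> makes both
  coefficients vanish.\<close>

lemma vertical_bracket_1:
  assumes x: "x \<in> S"
  shows "q x = 0" and "(a x)\<^sup>2 - k x * (p x + r x) - p x * r x = 0"
proof -
  have z: "smooth_on S (\<lambda>x. 0 :: real^2)" by (rule smooth_on_const[OF oS])
  define A K P Q R where abc: "A = ofr (a x)" "K = ofr (k x)" "P = ofr (p x)" "Q = ofr (q x)" "R = ofr (r x)"
  have "(- 2 * K * Q) * h5 \<alpha> x f0 + (A\<^sup>2 - K * (P + R) - P * R + Q\<^sup>2) * h6 \<alpha> x f0 = 0" if pt: "at_pt \<alpha> x f0" for \<alpha>
  proof -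
    note e = kills_bracket_vertical[OF kills_Om kills_Z(1) z derivs(3) derivs(4) pt]
    define H1 H2 H3 H4 H5 H6 where H: "H1 = h1 \<alpha> x f0" "H2 = h2 \<alpha> x f0" "H3 = h3 \<alpha> x f0" "H4 = h4 \<alpha> x f0" "H5 = h5 \<alpha> x f0" "H6 = h6 \<alpha> x f0"
    have "(- \<i> * K - \<i> * P) * H1 + \<i> * Q * H2 - \<i> * A * Q * H4 + (\<i> * \<i>) * K * Q * H5 + (A\<^sup>2 + (\<i> * \<i>) * K * P) * H6 = 0"
      using e pt by (simp add: Om_def Z4_def derivs_0[OF x] ofr_eqs H[symmetric] abc[symmetric]
        power2_eq_square algebra_simps del: i_squared)
    moreover have "H1 = - \<i> * Q * H5 - \<i> * R * H6" using h1_eq[OF pt] by (simp add: H abc)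
    moreover have "H2 = A * H4 - \<i> * P * H5 - \<i> * Q * H6" using h2_eq[OF pt] by (simp add: H abc)
    ultimately show ?thesis
      unfolding H[symmetric] using i_squared by algebra
  qed
  from transversality[OF x f0 base[OF x] this]
  have "K * Q = 0" "A\<^sup>2 - K * (P + R) - P * R + Q\<^sup>2 = 0" by auto
  then show q: "q x = 0" using k_pos[OF x] by (simp add: abc ofr_eqs)
  have "ofr ((a x)\<^sup>2 - k x * (p x + r x) - p x * r x) = 0"
    using \<open>A\<^sup>2 - K * (P + R) - P * R + Q\<^sup>2 = 0\<close> q by (simp add: abc ofr_eqs)
  then show "(a x)\<^sup>2 - k x * (p x + r x) - p x * r x = 0" by (rule ofr_eqs(8)[THEN iffD1])
qed

text \<open>The bracket of \<open>Om\<close> with \<open>Z5\<close> keeps \<open>h4\<close>, with a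
  factor \<open>2 k a\<close> up to a unit. The relation among \<open>a\<close>, \<open>p\<close>,
  \<open>r\<close> just obtained makes the coefficient of \<open>h5\<close> proportional to
  \<open>2 k (p + r)\<close>; this is the origin of \<open>n = (p + r) / a\<close>.\<close>

lemma vertical_bracket_2:
  assumes pt: "at_pt \<alpha> x f"
  shows "h4 \<alpha> x f = \<i> * ofr (n x) * h5 \<alpha> x f"
proof -
  have x: "x \<in> S" using pt by (simp add: at_pt_def)
  have z: "smooth_on S (\<lambda>x. 0 :: real^2)" by (rule smooth_on_const[OF oS])
  define A K P R n' where abc: "A = ofr (a x)" "K = ofr (k x)" "P = ofr (p x)" "R = ofr (r x)" "n' = ofr (n x)"
  note e = kills_bracket_vertical[OF kills_Om kills_Z(2) z derivs(3) derivs(5) pt]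
  define H1 H2 H3 H4 H5 H6 where H: "H1 = h1 \<alpha> x f" "H2 = h2 \<alpha> x f" "H3 = h3 \<alpha> x f" "H4 = h4 \<alpha> x f" "H5 = h5 \<alpha> x f" "H6 = h6 \<alpha> x f"
  note v1 = vertical_bracket_1[OF x]
  have "- (\<i> * K + \<i> * (- R)) * H2 - A * H3 - \<i> * A * R * H4 + (\<i> * \<i>) * K * R * H5 = 0"
    using e pt v1(1) by (simp add: Om_def Z5_def derivs_0[OF x] ofr_eqs H[symmetric] abc[symmetric]
        power2_eq_square algebra_simps del: i_squared)
  moreover have "H2 = A * H4 - \<i> * P * H5" using h2_eq[OF pt] v1(1) by (simp add: H abc ofr_eqs)
  moreover have "H3 = \<i> * K * H4 + A * H5" using h3_eq[OF pt] by (simp add: H abc)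
  moreover have "A\<^sup>2 - K * (P + R) - P * R = 0" using v1(2)[THEN ofr_cong] unfolding ofr_eqs abc .
  moreover have "n' * A = P + R" using pqrn_eqs(4)[OF x, THEN ofr_cong] unfolding ofr_eqs abc .
  ultimately have "2 * K * A * (H4 - \<i> * n' * H5) = 0"
    using i_squared by algebra
  moreover have "K \<noteq> 0" "A \<noteq> 0" using k_pos[OF x] k_derivative(3)[OF x] by (simp_all add: abc ofr_eqs)
  ultimately show ?thesis by (simp add: H abc)
qed

lemma kills_G: "kills (\<lambda>x. 0) G"
  unfolding kills_def G_def by (simp add: vertical_bracket_2)

text \<open>The bracket of \<open>E2 + Xi2\<close> with \<open>G\<close>. All of \<open>h1\<close>
  to \<open>h4\<close> are now expressible by \<open>h5\<close> and \<open>h6\<close>, so it can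
  produce only equations; the stated one is the coefficient of \<open>h6\<close>.\<close>

lemma horizontal_bracket_1:
  assumes x: "x \<in> S"
  shows "r x + n x * b2 x + k x = 0"
proof -
  define K R n' C N2 where abc: "K = ofr (k x)" "R = ofr (r x)" "n' = ofr (n x)" "C = ofr (b2 x)"
    "N2 = ofr (fderiv n x (E2 x))"
  have "(- \<i> * N2) * h5 \<alpha> x f0 + (\<i> * R + \<i> * n' * C + \<i> * K) * h6 \<alpha> x f0 = 0" if pt: "at_pt \<alpha> x f0" for \<alpha>
  proof -
    note e = kills_bracket_vertical[OF kills_Xi(2) kills_G smE2 derivs(2) derivs(6) pt]
    define H1 H5 H6 where H: "H1 = h1 \<alpha> x f0" "H5 = h5 \<alpha> x f0" "H6 = h6 \<alpha> x f0"
    have "- H1 - \<i> * N2 * H5 + (\<i> * n' * C + \<i> * K) * H6 = 0"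
      using e pt by (simp add: Xi2_def G_def ofr_eqs H[symmetric] abc[symmetric] algebra_simps)
    moreover have "H1 = - \<i> * R * H6" using h1_eq[OF pt] vertical_bracket_1(1)[OF x] by (simp add: H abc ofr_eqs)
    ultimately show ?thesis unfolding H[symmetric] by algebra
  qed
  from transversality[OF x f0 base[OF x] this]
  have "\<i> * (R + n' * C + K) = 0" by (simp add: algebra_simps)
  then have "ofr (r x + n x * b2 x + k x) = 0" by (simp add: ofr_eqs abc)
  then show ?thesis by (rule ofr_eqs(8)[THEN iffD1])
qed

text \<open>The coefficient of \<open>h5\<close> in the bracket of \<open>E2 + Xi2\<close> with
  \<open>Z5\<close>. Since \<open>q\<close> vanishes on all of \<open>S\<close>, its derivative
  drops out as well.\<close>

lemma horizontal_bracket_2: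
  assumes x: "x \<in> S"
  shows "n x * (k x)\<^sup>2 = a x * (k x - r x)"
proof -
  define A K P R n' C R2 where abc: "A = ofr (a x)" "K = ofr (k x)" "P = ofr (p x)" "R = ofr (r x)" "n' = ofr (n x)" "C = ofr (b2 x)"
    "R2 = ofr (fderiv r x (E2 x))"
  have q0: "fderiv q x h = 0" for h
    by (rule frechet_const_on[OF x]) (use vertical_bracket_1(1) in auto)
  have "(\<i> * (A * (K - R) - n' * K\<^sup>2)) * h5 \<alpha> x f0 + (\<i> * R2) * h6 \<alpha> x f0 = 0" if pt: "at_pt \<alpha> x f0" for \<alpha>
  proof -
    note e = kills_bracket_vertical[OF kills_Xi(2) kills_Z(2) smE2 derivs(2) derivs(5) pt]
    define H2 H3 H4 H5 H6 where H: "H2 = h2 \<alpha> x f0" "H3 = h3 \<alpha> x f0" "H4 = h4 \<alpha> x f0" "H5 = h5 \<alpha> x f0" "H6 = h6 \<alpha> x f0"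
    have "C * H2 + (\<i> * K - \<i> * R) * H3 + (\<i> * \<i>) * K * R * H4 - \<i> * C * R * H5 + \<i> * R2 * H6 = 0"
      using e pt vertical_bracket_1(1)[OF x]
      by (simp add: Xi2_def Z5_def q0 ofr_eqs H[symmetric] abc[symmetric] algebra_simps del: i_squared)
    moreover have "H2 = A * H4 - \<i> * P * H5" using h2_eq[OF pt] vertical_bracket_1(1)[OF x] by (simp add: H abc ofr_eqs)
    moreover have "H3 = \<i> * K * H4 + A * H5" using h3_eq[OF pt] by (simp add: H abc)
    moreover have "H4 = \<i> * n' * H5" using vertical_bracket_2[OF pt] by (simp add: H abc)
    moreover have "n' * A = P + R" "2 * K * R = - (A * C + K\<^sup>2)"
      using pqrn_eqs(3,4)[OF x, THEN ofr_cong] unfolding ofr_eqs abc by auto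
    ultimately show ?thesis unfolding H[symmetric] using i_squared by algebra
  qed
  from transversality[OF x f0 base[OF x] this]
  have "n' * K\<^sup>2 = A * (K - R)" by simp
  then have "ofr (n x * (k x)\<^sup>2 - a x * (k x - r x)) = 0" by (simp add: ofr_eqs abc)
  then show ?thesis unfolding ofr_eqs(8) by simp
qed

lemma darboux_structure:
  assumes x: "x \<in> S"
  shows "b1 x = 0" "a x * b2 x = - (k x)\<^sup>2" "fderiv a x (E1 x) = 3 * (a x)\<^sup>2 - (k x)\<^sup>2"
    "fderiv a x (E2 x) = 0"
proof -
  note pos = k_pos[OF x] k_derivative(3)[OF x]
  note pe = pqrn_eqs[OF x] and h1 = horizontal_bracket_1[OF x] and h2 = horizontal_bracket_2[OF x]
  show b1: "b1 x = 0" using pe(2) vertical_bracket_1(1)[OF x] pos by simp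
  then show "fderiv a x (E2 x) = 0" using a_derivative[OF x] by simp
  \<comment> \<open>Eliminating \<open>n x\<close> and \<open>b2 x\<close> from the definition of
    \<open>r\<close> and the two horizontal relations leaves only this square.\<close>
  have "2 * a x * (r x * r x) = 0"
    using pe(3) h1 h2 by algebra
  then have r: "r x = 0" using pos by simp
  show "a x * b2 x = - (k x)\<^sup>2" using pe(3) r by simp
  have "k x * (n x * k x - a x) = 0" using h2 r by (simp add: algebra_simps power2_eq_square)
  then have nk: "n x * k x = a x" using pos by simp
  have "2 * k x * p x = 2 * (a x)\<^sup>2" using pe(4) nk r by algebra
  then show "fderiv a x (E1 x) = 3 * (a x)\<^sup>2 - (k x)\<^sup>2"
    using pe(1) by (simp add: a1_def)
qed

end

subsection \<open>Normal forms\<close>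

lemma vec2_eq_iff: "(v :: 'a^2) = w \<longleftrightarrow> v $ 1 = w $ 1 \<and> v $ 2 = w $ 2"
  by (simp add: vec_eq_iff forall_2)

section \<open>Coordinates adapted to a frame\<close>

context frame_section
begin

text \<open>\<open>dU\<close> and \<open>dV\<close> are multiples of the two dual forms, so the
  normalizations by \<open>A\<close> and \<open>C\<close> say that the metric is
  \<open>A dU^2 - C dV^2\<close>. They also make both multiples nonzero, so that the inverse
  function theorem applies to \<open>(U, V)\<close>.\<close>

lemma local_chart:
  fixes U V :: "real^2 \<Rightarrow> real"
  assumes B: "open B" "x0 \<in> B" "B \<subseteq> S" and smU: "smooth_on B U" and smV: "smooth_on B V"
    and dU: "\<And>x. x \<in> B \<Longrightarrow> fderiv U x (E2 x) = 0"
    and dV: "\<And>x. x \<in> B \<Longrightarrow> fderiv V x (E1 x) = 0"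
    and A: "\<And>x. x \<in> B \<Longrightarrow> A (U x) * (fderiv U x (E1 x))\<^sup>2 = 1"
    and C: "\<And>x. x \<in> B \<Longrightarrow> C (U x) * (fderiv V x (E2 x))\<^sup>2 = 1"
  obtains O' T \<psi> \<theta> where "open O'" "O' \<subseteq> B" "x0 \<in> O'" "open T" "homeomorphism O' T \<psi> \<theta>"
    "smooth_on O' \<psi>" "smooth_on T \<theta>" "\<And>x. x \<in> O' \<Longrightarrow> \<psi> x $ 1 = U x"
    "\<And>x X Y. x \<in> O' \<Longrightarrow> g x X Y = diag_metric A C (\<psi> x) (fderiv \<psi> x X) (fderiv \<psi> x Y)"
proof -
  define U1 where "U1 x = fderiv U x (E1 x)" for x
  define V2 where "V2 x = fderiv V x (E2 x)" for x
  have nz: "U1 x \<noteq> 0" "V2 x \<noteq> 0" if "x \<in> B" for x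
    using A[OF that] C[OF that] by (auto simp: U1_def V2_def)
  note smE1B = smooth_on_subset[OF smE1 B(3)] and smE2B = smooth_on_subset[OF smE2 B(3)]
  have sm1: "smooth_on B U1" "smooth_on B V2"
    unfolding U1_def[abs_def] V2_def[abs_def]
    by (rule smooth_on_frechet_apply[OF B(1) smU smE1B] smooth_on_frechet_apply[OF B(1) smV smE2B])+
  define \<psi> where "\<psi> x = (\<chi> i. if i = (1::2) then U x else V x)" for x
  define d\<psi> where "d\<psi> x h = (\<chi> i. if i = (1::2) then fderiv U x h else fderiv V x h)" for x h
  have vecD: "((\<lambda>x. \<chi> i. if i = (1::2) then f x else h x) has_derivative
      (\<lambda>t. \<chi> i. if i = (1::2) then f' t else h' t)) (at x)"
    if "(f has_derivative f') (at x)" "(h has_derivative h') (at x)" for f h :: "real^2 \<Rightarrow> real" and f' h' x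
  proof -
    have e: "(\<chi> i. if i = (1::2) then a else b) = a *\<^sub>R axis 1 1 + b *\<^sub>R axis 2 (1::real)" for a b
      by (simp add: vec2_eq_iff axis_def)
    show ?thesis unfolding e by (intro has_derivative_add has_derivative_scaleR_left that)
  qed
  have d\<psi>: "(\<psi> has_derivative d\<psi> x) (at x)" if "x \<in> B" for x
    unfolding \<psi>_def[abs_def] d\<psi>_def[abs_def]
    by (rule vecD[OF smooth_on_has_derivative[OF smU that] smooth_on_has_derivative[OF smV that]])
  have sm\<psi>: "smooth_on B \<psi>"
    unfolding \<psi>_def[abs_def]
  proof (rule smooth_on_vec_lambda[OF B(1)])
    show "smooth_on B (\<lambda>x. if i = (1::2) then U x else V x)" for i
      by (cases "i = 1") (use smU smV in simp_all)
  qed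
  have exp: "h = g x (E1 x) h *\<^sub>R E1 x - g x (E2 x) h *\<^sub>R E2 x" if "x \<in> B" for x h
    using expansion[of x h] that B(3) by auto
  have DU: "fderiv U x h = g x (E1 x) h * U1 x"
    and DV: "fderiv V x h = - g x (E2 x) h * V2 x" if x: "x \<in> B" for x h
  proof -
    note lU = linear_frechet_derivative[OF smooth_on_differentiable[OF smU x]]
    note lV = linear_frechet_derivative[OF smooth_on_differentiable[OF smV x]]
    show "fderiv U x h = g x (E1 x) h * U1 x"
      using arg_cong[OF exp[OF x, of h], of "fderiv U x"] dU[OF x]
      by (simp only: linear_diff[OF lU] linear_cmul[OF lU]) (simp add: U1_def)
    show "fderiv V x h = - g x (E2 x) h * V2 x"
      using arg_cong[OF exp[OF x, of h], of "fderiv V x"] dV[OF x]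
      by (simp only: linear_diff[OF lV] linear_cmul[OF lV]) (simp add: V2_def)
  qed
  \<comment> \<open>The inverse of the differential in closed form; its smooth dependence on
    \<open>x\<close> carries the regularity of \<theta> below.\<close>
  define inv where "inv x y = (y $ 1 / U1 x) *\<^sub>R E1 x + (y $ 2 / V2 x) *\<^sub>R E2 x" for x and y :: "real^2"
  have inv1: "d\<psi> x (inv x y) = y" if x: "x \<in> B" for x y
  proof -
    note fm = frame_metric[of x] metric_algebra[OF metric, of x]
    have "x \<in> S" "x \<in> D" using x B(3) SD by auto
    then show ?thesis
      using nz[OF x] by (simp add: d\<psi>_def DU[OF x] DV[OF x] inv_def vec2_eq_iff fm)
  qed
  have inv2: "inv x (d\<psi> x h) = h" if x: "x \<in> B" for x h
    using nz[OF x] exp[OF x, of h] by (simp add: d\<psi>_def DU[OF x] DV[OF x] inv_def)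
  have lin\<psi>: "bounded_linear (d\<psi> x)" if "x \<in> B" for x
    using d\<psi>[OF that] by (rule has_derivative_bounded_linear)
  have lin_inv: "bounded_linear (inv x)" for x
    unfolding inv_def linear_conv_bounded_linear[symmetric]
    by (intro linearI) (simp_all add: algebra_simps add_divide_distrib)
  define f' where "f' x = Blinfun (d\<psi> x)" for x
  have f': "blinfun_apply (f' x) = d\<psi> x" if "x \<in> B" for x
    unfolding f'_def by (rule bounded_linear_Blinfun_apply[OF lin\<psi>[OF that]])
  have contf: "continuous_on B f'"
  proof (rule continuous_on_blinfun_componentwise)
    fix i :: "real^2" assume "i \<in> Basis"
    show "continuous_on B (\<lambda>x. blinfun_apply (f' x) i)"
    proof (rule continuous_on_eq[OF smooth_on_continuous[OF smooth_on_frechet[OF sm\<psi>, of i]]])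
      show "fderiv \<psi> x i = blinfun_apply (f' x) i" if "x \<in> B" for x
        using frechet_derivative_eqI[OF d\<psi>[OF that]] f'[OF that] by simp
    qed
  qed
  have invf: "Blinfun (inv x0) o\<^sub>L f' x0 = id_blinfun"
    by (rule blinfun_eqI) (simp add: f'[OF B(2)] bounded_linear_Blinfun_apply[OF lin_inv] inv2[OF B(2)])
  obtain O' T \<theta> g' where O': "open O'" "O' \<subseteq> B" "x0 \<in> O'" "open T" "\<psi> x0 \<in> T" "homeomorphism O' T \<psi> \<theta>"
    "\<And>y. y \<in> T \<Longrightarrow> (\<theta> has_derivative (g' y)) (at y)"
    "\<And>y. y \<in> T \<Longrightarrow> g' y = Hilbert_Choice.inv (blinfun_apply (f' (\<theta> y)))"
    "\<And>y. y \<in> T \<Longrightarrow> bij (blinfun_apply (f' (\<theta> y)))"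
  proof (rule inverse_function_theorem[OF B(1) _ contf B(2) invf])
    show "(\<psi> has_derivative blinfun_apply (f' x)) (at x)" if "x \<in> B" for x
      using d\<psi>[OF that] f'[OF that] by simp
  qed blast
  have \<theta>B: "\<theta> y \<in> B" if "y \<in> T" for y
    using O'(6) that O'(2) by (auto simp: homeomorphism_def)
  have d\<theta>: "(\<theta> has_derivative inv (\<theta> y)) (at y)" if y: "y \<in> T" for y
  proof -
    have "Hilbert_Choice.inv (d\<psi> (\<theta> y)) = inv (\<theta> y)"
      by (rule inv_unique_comp) (auto simp: fun_eq_iff inv1 inv2 \<theta>B y)
    then show ?thesis using O'(7)[OF y] O'(8)[OF y] f'[OF \<theta>B[OF y]] by simp
  qed
  have sminv: "smooth_on B (\<lambda>x. inv x v)" for v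
    unfolding inv_def
    by (rule smooth_on_add[OF B(1)]; rule smooth_on_scaleR[OF B(1)];
      rule smE1B smE2B smooth_on_divide[OF B(1) smooth_on_const[OF B(1)] sm1(1) nz(1)]
        smooth_on_divide[OF B(1) smooth_on_const[OF B(1)] sm1(2) nz(2)])
  \<comment> \<open>Bootstrapping: the derivative of \<theta> is \<open>inv\<close> composed with
    \<theta>, so each order of differentiability yields the next.\<close>
  have "Ck_on k T \<theta>" for k
  proof (induction k)
    case 0
    then show ?case using O'(6) by (simp add: homeomorphism_def)
  next
    case (Suc k)
    have "\<theta> ` T \<subseteq> B" using \<theta>B by auto
    then have "Ck_on k T (\<lambda>y. inv (\<theta> y) v)" for v
      using Ck_on_compose[OF O'(4) B(1) _ Suc.IH, of "\<lambda>x. inv x v"] sminv[of v] by (auto simp: smooth_on_def)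
    then show ?case by (intro Ck_on_SucI[OF O'(4) d\<theta>])
  qed
  then have sm\<theta>: "smooth_on T \<theta>" by (simp add: smooth_on_def)
  have iso: "g x X Y = diag_metric A C (\<psi> x) (fderiv \<psi> x X) (fderiv \<psi> x Y)"
    if "x \<in> O'" for x X Y
  proof -
    have x: "x \<in> B" using that O'(2) by auto
    have xD: "x \<in> S" "x \<in> D" using x B(3) SD by auto
    have "diag_metric A C (\<psi> x) (d\<psi> x X) (d\<psi> x Y) = (A (U x) * (U1 x)\<^sup>2) * g x (E1 x) X * g x (E1 x) Y
        - (C (U x) * (V2 x)\<^sup>2) * g x (E2 x) X * g x (E2 x) Y"
      by (simp add: diag_metric_def d\<psi>_def \<psi>_def DU[OF x] DV[OF x] power2_eq_square)
    also have "\<dots> = g x (E1 x) X * g x (E1 x) Y - g x (E2 x) X * g x (E2 x) Y"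
      using A[OF x] C[OF x] by (simp add: U1_def V2_def)
    also have "\<dots> = g x (g x (E1 x) X *\<^sub>R E1 x - g x (E2 x) X *\<^sub>R E2 x) Y"
      by (simp add: metric_algebra[OF metric xD(2)])
    also have "\<dots> = g x X Y" by (simp flip: exp[OF x])
    finally show ?thesis using frechet_derivative_eqI[OF d\<psi>[OF x]] by simp
  qed
  show ?thesis
    by (rule that[OF O'(1-4,6) smooth_on_subset[OF sm\<psi> O'(2)] sm\<theta> _ iso]) (simp add: \<psi>_def)
qed

text \<open>A 2-form in the plane is determined by its value on one frame. \<open>ext_d\<close>
  treats its two vector arguments as constants, hence is bilinear in them.\<close>

lemma closed_form_frame:
  fixes \<mu> :: "real^2 \<Rightarrow> real^2 \<Rightarrow> real"
  assumes x: "x \<in> S" and sf: "smooth_form S \<mu>"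
    and e: "ext_d \<mu> x (E1 x) (E2 x) = 0"
  shows "ext_d \<mu> x X Y = 0"
proof -
  have dm: "((\<lambda>q. \<mu> q v) has_derivative fderiv (\<lambda>q. \<mu> q v) x) (at x)" for v
    using sf x by (auto simp: smooth_form_def intro: smooth_on_has_derivative)
  have lin: "linear (\<mu> q)" if "q \<in> S" for q using sf that by (auto simp: smooth_form_def)
  have l1: "linear (fderiv (\<lambda>q. \<mu> q v) x)" for v
    using dm has_derivative_linear by blast
  have l2: "fderiv (\<lambda>q. \<mu> q (a *\<^sub>R v + b *\<^sub>R w)) x h
      = a * fderiv (\<lambda>q. \<mu> q v) x h + b * fderiv (\<lambda>q. \<mu> q w) x h" for a b v w h
  proof -
    have 1: "((\<lambda>q. a * \<mu> q v + b * \<mu> q w) has_derivative (\<lambda>h. a * fderiv (\<lambda>q. \<mu> q v) x h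
        + b * fderiv (\<lambda>q. \<mu> q w) x h)) (at x)"
      by (intro has_derivative_add has_derivative_mult_right dm)
    have 2: "fderiv (\<lambda>q. \<mu> q (a *\<^sub>R v + b *\<^sub>R w)) x
        = fderiv (\<lambda>q. a * \<mu> q v + b * \<mu> q w) x"
      by (rule frechet_derivative_cong_open[OF oS x]) (simp add: linear_add[OF lin] linear_cmul[OF lin])
    show ?thesis unfolding 2 frechet_derivative_eqI[OF 1] ..
  qed
  have ex: "V = g x (E1 x) V *\<^sub>R E1 x + (- g x (E2 x) V) *\<^sub>R E2 x" for V
    using expansion[OF x, of V] by simp
  show ?thesis
    using e unfolding ext_d_def
    by (subst (1 2) ex[of X], subst (1 2) ex[of Y])
      (simp only: l2 linear_add[OF l1] linear_cmul[OF l1], simp add: algebra_simps)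
qed

end

text \<open>The square of the Killing field is minus that of the gradient of \<open>q\<close>, so
  spacelike means that \<kappa> has a timelike gradient. The adapted frame consists of the unit
  field along the gradient of \<open>- \<kappa>\<close> and the normalized Killing field.\<close>

lemma adapted_frame_exists:
  assumes o: "open D" and L: "lorentz_metric_on D g" and st: "structure_equations D g \<beta> \<kappa>"
    and pos: "\<And>x. x \<in> D \<Longrightarrow> \<kappa> x > 0"
    and sp: "\<And>f. f \<in> frame_bundle D g \<Longrightarrow> g (fst f) (killing_vector \<kappa> f) (killing_vector \<kappa> f) < 0"
    and x0: "x0 \<in> D"
  obtains S E where "open S" "x0 \<in> S" "S \<subseteq> D" "smooth_on S E" "\<And>x. x \<in> S \<Longrightarrow> (x, E x) \<in> frame_bundle D g"
    "\<And>x. x \<in> S \<Longrightarrow> fderiv \<kappa> x (E x $ 2) = 0"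
    "\<And>x. x \<in> S \<Longrightarrow> fderiv \<kappa> x (E x $ 1) < 0"
    "smooth_on S \<kappa>"
proof -
  obtain S F where S: "open S" "x0 \<in> S" "S \<subseteq> D" "smooth_on S F" "\<And>x. x \<in> S \<Longrightarrow> (x, F x) \<in> frame_bundle D g"
    using local_frame_exists[OF o L x0] by blast
  interpret frame_section D g \<beta> \<kappa> S F
    by unfold_locales (use o L st S in auto)
  have kS: "\<kappa> x > 0" if "x \<in> S" for x using pos that S(3) by auto
  \<comment> \<open>The factor in \<open>dq = - w d\<kappa>\<close>; its positivity lets the sign of
    the square pass from \<open>q\<close> to \<kappa>.\<close>
  define w where "w x = 3 / 4 * \<kappa> x powr (-7/4)" for x
  have wpos: "w x > 0" if "x \<in> S" for x using kS[OF that] by (simp add: w_def)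
  have dq: "fderiv (\<lambda>y. \<bar>\<kappa> y\<bar> powr (-3/4)) x h = - w x * fderiv \<kappa> x h"
    if x: "x \<in> S" for x h
  proof -
    have "((\<lambda>y. \<kappa> y powr (-3/4)) has_derivative (\<lambda>h. fderiv \<kappa> x h * (-3/4 * \<kappa> x powr (-3/4 - 1)))) (at x)"
      by (rule has_real_derivative_powr[THEN DERIV_compose_FDERIV, OF kS[OF x]
            smooth_on_has_derivative[OF smooth_curvature x]])
    moreover have "fderiv (\<lambda>y. \<bar>\<kappa> y\<bar> powr (-3/4)) x = fderiv (\<lambda>y. \<kappa> y powr (-3/4)) x"
      by (rule frechet_derivative_cong_open[OF oS x]) (simp add: abs_of_pos[OF kS])
    ultimately show ?thesis by (simp add: frechet_derivative_eqI w_def)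
  qed
  define c1 c2 where c: "c1 = (\<lambda>x. - fderiv \<kappa> x (F x $ 1))" "c2 = (\<lambda>x. - fderiv \<kappa> x (F x $ 2))"
  have smc: "smooth_on S c1" "smooth_on S c2"
    unfolding c by (intro smooth_on_minus[OF oS] smooth_on_frechet_apply[OF oS smooth_curvature] smooth_on_vec_nth[OF oS S(4)])+
  have pc: "(c1 x)\<^sup>2 - (c2 x)\<^sup>2 > 0" if x: "x \<in> S" for x
  proof -
    note fm = frame_bundleD[OF S(5)[OF x]]
    have kv: "killing_vector \<kappa> (x, F x) = w x *\<^sub>R (c1 x *\<^sub>R F x $ 2 - c2 x *\<^sub>R F x $ 1)"
      unfolding killing_vector_def Let_def fst_conv snd_conv dq[OF x] c by (simp add: algebra_simps)
    have "g x (killing_vector \<kappa> (x, F x)) (killing_vector \<kappa> (x, F x)) = (w x)\<^sup>2 * ((c2 x)\<^sup>2 - (c1 x)\<^sup>2)"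
      unfolding kv by (simp add: metric_algebra[OF L fm(1)] fm power2_eq_square algebra_simps)
    then have "(w x)\<^sup>2 * ((c2 x)\<^sup>2 - (c1 x)\<^sup>2) < 0" using sp[OF S(5)[OF x]] by simp
    then show ?thesis using wpos[OF x] by (auto simp: mult_less_0_iff)
  qed
  define \<rho> where "\<rho> x = inverse (sqrt ((c1 x)\<^sup>2 - (c2 x)\<^sup>2))" for x
  have sq: "sqrt ((c1 x)\<^sup>2 - (c2 x)\<^sup>2) \<noteq> 0" if "x \<in> S" for x
    using pc[OF that] by (simp only: real_sqrt_eq_0_iff)
  have sm\<rho>: "smooth_on S \<rho>"
    unfolding \<rho>_def[abs_def]
    by (rule smooth_on_inverse[OF oS smooth_on_sqrt[OF oS smooth_on_diff[OF oS smooth_on_power[OF oS smc(1)] smooth_on_power[OF oS smc(2)]] pc] sq])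
  have \<rho>: "\<rho> x > 0" "(\<rho> x)\<^sup>2 * ((c1 x)\<^sup>2 - (c2 x)\<^sup>2) = 1" if "x \<in> S" for x
    using pc[OF that] by (simp_all add: \<rho>_def power_inverse)
  define E where "E x = (\<chi> i. if i = (1::2) then \<rho> x *\<^sub>R (c1 x *\<^sub>R F x $ 1 - c2 x *\<^sub>R F x $ 2)
      else \<rho> x *\<^sub>R (c1 x *\<^sub>R F x $ 2 - c2 x *\<^sub>R F x $ 1))" for x
  have smE: "smooth_on S E"
    unfolding E_def[abs_def]
  proof (rule smooth_on_vec_lambda[OF oS])
    note v = smooth_on_vec_nth[OF oS S(4)]
    note t = smooth_on_scaleR[OF oS sm\<rho> smooth_on_diff[OF oS smooth_on_scaleR[OF oS smc(1) v] smooth_on_scaleR[OF oS smc(2) v]]]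
    show "smooth_on S (\<lambda>x. if i = (1::2) then \<rho> x *\<^sub>R (c1 x *\<^sub>R F x $ 1 - c2 x *\<^sub>R F x $ 2)
      else \<rho> x *\<^sub>R (c1 x *\<^sub>R F x $ 2 - c2 x *\<^sub>R F x $ 1))" for i
      using t[of 1 2] t[of 2 1] by (cases "i = 1") simp_all
  qed
  have fr: "(x, E x) \<in> frame_bundle D g" if x: "x \<in> S" for x
  proof (rule frame_bundleI[OF L])
    note fm = frame_bundleD[OF S(5)[OF x]]
    note ma = metric_algebra[OF L fm(1)]
    show "x \<in> D" by (rule fm(1))
    have "g x (E x $ 1) (E x $ 1) = (\<rho> x)\<^sup>2 * ((c1 x)\<^sup>2 - (c2 x)\<^sup>2)"
      by (simp add: E_def ma fm power2_eq_square algebra_simps)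
    then show "g x (E x $ 1) (E x $ 1) = 1" using \<rho>[OF x] by simp
    have "g x (E x $ 2) (E x $ 2) = - ((\<rho> x)\<^sup>2 * ((c1 x)\<^sup>2 - (c2 x)\<^sup>2))"
      by (simp add: E_def ma fm power2_eq_square algebra_simps)
    then show "g x (E x $ 2) (E x $ 2) = -1" using \<rho>[OF x] by simp
    show "g x (E x $ 1) (E x $ 2) = 0"
      by (simp add: E_def ma fm algebra_simps)
  qed
  have d: "fderiv \<kappa> x (E x $ 2) = 0" "fderiv \<kappa> x (E x $ 1) < 0" if x: "x \<in> S" for x
  proof -
    note l = linear_frechet_derivative[OF smooth_on_differentiable[OF smooth_curvature x]]
    have k: "fderiv \<kappa> x (F x $ 1) = - c1 x" "fderiv \<kappa> x (F x $ 2) = - c2 x"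
      by (simp_all add: c)
    show "fderiv \<kappa> x (E x $ 2) = 0"
      by (simp add: E_def linear_diff[OF l] linear_cmul[OF l] k)
    have "fderiv \<kappa> x (E x $ 1) = - (\<rho> x * ((c1 x)\<^sup>2 - (c2 x)\<^sup>2))"
      by (simp add: E_def linear_diff[OF l] linear_cmul[OF l] k power2_eq_square algebra_simps)
    then show "fderiv \<kappa> x (E x $ 1) < 0" using \<rho>(1)[OF x] pc[OF x] by simp
  qed
  show ?thesis by (rule that[OF S(1-3) smE fr d smooth_curvature])
qed


text \<open>The metric \<open>u\<^sup>4 du\<^sup>2 / (u\<^sup>2 + J) - (u\<^sup>2 + J) dv\<^sup>2\<close> with \<open>u = \<kappa>\<^sup>-\<^sup>1\<^sup>/\<^sup>4\<close>, after the substitution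
  \<open>u = \<bar>J\<bar>\<^sup>1\<^sup>/\<^sup>2 cosh U\<close>, \<open>u = J\<^sup>1\<^sup>/\<^sup>2 sinh U\<close> or \<open>u = U\<close> and a rescaling of \<open>v\<close>.\<close>

definition model_u :: "real \<Rightarrow> real \<Rightarrow> real" where
  "model_u J U = (if J < 0 then J\<^sup>2 * cosh U ^ 4 else if J > 0 then J\<^sup>2 * sinh U ^ 4 else U\<^sup>2)"

definition model_v :: "real \<Rightarrow> real \<Rightarrow> real" where
  "model_v J U = (if J < 0 then J\<^sup>2 * sinh U ^ 2 else if J > 0 then J\<^sup>2 * cosh U ^ 2 else U\<^sup>2)"

definition model_K :: "real \<Rightarrow> real \<Rightarrow> real" where
  "model_K J U = (if J < 0 then 1 / (J\<^sup>2 * cosh U ^ 4) else if J > 0 then 1 / (J\<^sup>2 * sinh U ^ 4) else 1 / U ^ 4)"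

definition model_chart :: "metric2 \<Rightarrow> (real^2 \<Rightarrow> real) \<Rightarrow> real \<Rightarrow> (real^2) set \<Rightarrow> (real^2) set
    \<Rightarrow> (real^2 \<Rightarrow> real^2) \<Rightarrow> (real^2 \<Rightarrow> real^2) \<Rightarrow> bool" where
  "model_chart g \<kappa> J U T \<psi> \<theta> \<longleftrightarrow> open U \<and> open T \<and> homeomorphism U T \<psi> \<theta> \<and> smooth_on U \<psi> \<and> smooth_on T \<theta> \<and>
     (\<forall>x\<in>U. \<kappa> x = model_K J (\<psi> x $ 1) \<and>
       (\<forall>X Y. g x X Y = diag_metric (model_u J) (model_v J) (\<psi> x)
          (fderiv \<psi> x X) (fderiv \<psi> x Y)))"

text \<open>Since \<open>- \<langle>V, V\<rangle>\<close> is the square of the gradient of \<open>q = u\<^sup>3\<close>, this is \<open>J\<close>, expressed without an adapted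
  frame.\<close>

definition first_integral :: "metric2 \<Rightarrow> (real^2 \<Rightarrow> real) \<Rightarrow> frame2 \<Rightarrow> real" where
  "first_integral g \<kappa> f =
     - g (fst f) (killing_vector \<kappa> f) (killing_vector \<kappa> f) / 9 - \<kappa> (fst f) powr (-1/2)"

definition coord_u :: "real \<Rightarrow> real \<Rightarrow> real" where
  "coord_u J t = (if J < 0 then arcosh (t / sqrt (- J)) else if J > 0 then arsinh (t / sqrt J) else t)"

text \<open>Supplies the normalizations required by \<open>local_chart\<close>. With
  \<open>E1 u = w / u^2\<close> and \<open>dv(E2) = 1 / w\<close>, the number \<open>d\<close> is
  \<open>dU/du\<close>, so \<open>d * (w / u^2)\<close> is \<open>E1 U\<close>, and \<open>c\<close>
  rescales \<open>v\<close>. Divided by \<open>\<bar>J\<bar>\<close>, the relation between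
  \<open>w\<close> and \<open>u\<close> becomes the identity between \<open>cosh\<close> and
  \<open>sinh\<close>.\<close>

lemma coordinate_function:
  fixes u w J :: real
  assumes u: "u > 0" and w: "w > 0" and wu: "w\<^sup>2 = u\<^sup>2 + J"
  defines "d \<equiv> (if J = 0 then 1 else 1 / w)" and "c \<equiv> (if J = 0 then 1 else 1 / sqrt \<bar>J\<bar>)"
  shows "(coord_u J has_real_derivative d) (at u)" "model_u J (coord_u J u) * (d * (w / u\<^sup>2))\<^sup>2 = 1"
    "model_v J (coord_u J u) * (c / w)\<^sup>2 = 1" "model_K J (coord_u J u) = 1 / u ^ 4"
proof -
  have *: "(coord_u J has_real_derivative d) (at u) \<and> model_u J (coord_u J u) * (d * (w / u\<^sup>2))\<^sup>2 = 1 \<and>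
    model_v J (coord_u J u) * (c / w)\<^sup>2 = 1 \<and> model_K J (coord_u J u) = 1 / u ^ 4"
  proof (cases "J = 0")
    case True
    then have "w = u" using wu u w by (simp add: power2_eq_iff)
    moreover have "(coord_u J has_real_derivative d) (at u)"
      using True by (simp add: coord_u_def[abs_def] d_def)
    moreover have "u\<^sup>2 * (1 * (u / u\<^sup>2))\<^sup>2 = 1" "u\<^sup>2 * (1 / u)\<^sup>2 = 1"
      using u by (simp_all add: power2_eq_square)
    ultimately show ?thesis
      using True by (simp add: coord_u_def model_u_def model_v_def model_K_def d_def c_def)
  next
    case False
    define m where "m = sqrt \<bar>J\<bar>"
    have m: "m > 0" "m\<^sup>2 = \<bar>J\<bar>" using False by (auto simp: m_def)
    have m4: "J\<^sup>2 = m ^ 4"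
    proof -
      have "m ^ 4 = (m\<^sup>2)\<^sup>2" by simp
      then show ?thesis by (simp add: m)
    qed
    have uv: "m ^ 4 * (u / m) ^ 4 = u ^ 4" "m ^ 4 * (w / m)\<^sup>2 = m\<^sup>2 * w\<^sup>2"
      using m(1) by (simp_all add: power_divide power4_eq_xxxx power2_eq_square)
    have d: "d = 1 / w" and c: "c = 1 / m" using False by (simp_all add: d_def c_def m_def)
    have fin: "u ^ 4 * (d * (w / u\<^sup>2))\<^sup>2 = 1" "m\<^sup>2 * w\<^sup>2 * (c / w)\<^sup>2 = 1"
      using u w m(1) by (simp_all add: d c power_divide power_mult_distrib)
    show ?thesis
    proof (cases "J < 0")
      case True
      then have J: "J = - m\<^sup>2" "sqrt (- J) = m" by (simp_all add: m m_def)
      have um: "(u / m)\<^sup>2 - 1 = (w / m)\<^sup>2"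
        using m(1) wu J by (simp add: power_divide field_simps)
      then have "(u / m)\<^sup>2 > 1" using w m(1) by (smt (verit) divide_pos_pos zero_less_power)
      \<comment> \<open>Positivity of \<open>w\<close> keeps \<open>u / m\<close> off the branch
        point 1 of \<open>arcosh\<close>.\<close>
      then have u1: "u / m > 1" using u m(1) by (smt (verit) divide_pos_pos one_le_power power_le_one)
      have sq: "sqrt ((u / m)\<^sup>2 - 1) = w / m" unfolding um using w m(1) by simp
      have cu: "coord_u J = (\<lambda>t. arcosh (t / m))" using True J(2) by (simp add: coord_u_def[abs_def])
      have ch: "cosh (coord_u J u) = u / m" and sh: "sinh (coord_u J u) = w / m"
        unfolding cu using sinh_arcosh_real[OF less_imp_le[OF u1]] cosh_arcosh_real[OF less_imp_le[OF u1]]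
        by (simp_all only: sq)
      have "((\<lambda>t. t / m) has_real_derivative 1 / m) (at u)"
        using m(1) by (auto intro!: derivative_eq_intros)
      from DERIV_chain2[OF arcosh_real_has_field_derivative[OF u1] this]
      have "((\<lambda>t. arcosh (t / m)) has_real_derivative 1 / sqrt ((u / m)\<^sup>2 - 1) * (1 / m)) (at u)" .
      then have "(coord_u J has_real_derivative d) (at u)"
        using True w less_imp_neq[OF m(1)] unfolding sq cu by (simp add: d_def)
      moreover have "model_u J (coord_u J u) = u ^ 4" "model_v J (coord_u J u) = m\<^sup>2 * w\<^sup>2" "model_K J (coord_u J u) = 1 / u ^ 4"
        unfolding model_u_def model_v_def model_K_def ch sh m4 uv using True by simp_all
      ultimately show ?thesis using fin by simp
    next
      case F: False
      then have J: "J > 0" "J = m\<^sup>2" "sqrt J = m" using False by (simp_all add: m m_def)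
      have um: "(u / m)\<^sup>2 + 1 = (w / m)\<^sup>2"
        using m(1) wu J by (simp add: power_divide field_simps)
      have sq: "sqrt ((u / m)\<^sup>2 + 1) = w / m" unfolding um using w m(1) by simp
      have cu: "coord_u J = (\<lambda>t. arsinh (t / m))" using F J(1,3) by (simp add: coord_u_def[abs_def])
      have sh: "sinh (coord_u J u) = u / m" and ch: "cosh (coord_u J u) = w / m"
        unfolding cu by (simp_all add: cosh_arsinh_real sq)
      have "((\<lambda>t. t / m) has_real_derivative 1 / m) (at u)"
        using m(1) by (auto intro!: derivative_eq_intros)
      from DERIV_chain2[OF arsinh_real_has_field_derivative this]
      have "((\<lambda>t. arsinh (t / m)) has_real_derivative 1 / sqrt ((u / m)\<^sup>2 + 1) * (1 / m)) (at u)" .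
      then have "(coord_u J has_real_derivative d) (at u)"
        using J(1) w less_imp_neq[OF m(1)] unfolding sq cu by (simp add: d_def)
      moreover have "model_u J (coord_u J u) = u ^ 4" "model_v J (coord_u J u) = m\<^sup>2 * w\<^sup>2" "model_K J (coord_u J u) = 1 / u ^ 4"
        unfolding model_u_def model_v_def model_K_def ch sh m4 uv using J(1) by simp_all
      ultimately show ?thesis using fin by simp
    qed
  qed
  show "(coord_u J has_real_derivative d) (at u)" "model_u J (coord_u J u) * (d * (w / u\<^sup>2))\<^sup>2 = 1"
    "model_v J (coord_u J u) * (c / w)\<^sup>2 = 1" "model_K J (coord_u J u) = 1 / u ^ 4"
    using * by blast+
qed

section \<open>Integration of the structure equations\<close>

context darboux_section
begin

definition u where "u x = k x powr (-1/2)"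
text \<open>Equal to \<open>u^2 E1 u\<close>, that is, one third of \<open>E1 q\<close> for
  \<open>q = u^3\<close>.\<close>

definition w where "w x = - (u x ^ 3 * a x)"
definition J where "J x = (w x)\<^sup>2 - (u x)\<^sup>2"

lemma k_powr_derivative:
  assumes x: "x \<in> S"
  shows "((\<lambda>y. k y powr s) has_derivative (\<lambda>h. fderiv k x h * (s * k x powr (s - 1)))) (at x)"
  by (rule has_real_derivative_powr[THEN DERIV_compose_FDERIV, OF k_pos[OF x] smooth_on_has_derivative[OF smooth_k x]])

lemma u_props:
  assumes x: "x \<in> S"
  shows "u x > 0" "k x = 1 / (u x)\<^sup>2" "\<kappa> x = 1 / u x ^ 4" "\<kappa> x powr (-1/2) = (u x)\<^sup>2"
    "fderiv u x (E1 x) = - u x * a x" "fderiv u x (E2 x) = 0"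
proof -
  note kp = k_pos[OF x]
  show up: "u x > 0" using kp by (simp add: u_def)
  have "(u x)\<^sup>2 = k x powr (-1/2) * k x powr (-1/2)" by (simp add: u_def power2_eq_square)
  also have "\<dots> = k x powr (-1)" by (simp flip: powr_add)
  also have "\<dots> = 1 / k x" using kp by (simp add: powr_minus_divide)
  finally have u2: "(u x)\<^sup>2 = 1 / k x" .
  then show k: "k x = 1 / (u x)\<^sup>2" using kp by simp
  have "\<kappa> x = (1 / (u x)\<^sup>2)\<^sup>2" using k_square[OF x] k by simp
  then show "\<kappa> x = 1 / u x ^ 4" by (simp add: power_divide)
  have "\<kappa> x powr (-1/2) = 1 / sqrt (\<kappa> x)" using kpos[OF x] by (simp add: powr_minus_divide powr_half_sqrt)
  then show "\<kappa> x powr (-1/2) = (u x)\<^sup>2" by (simp add: u2 k_def)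
  have d: "fderiv u x h = fderiv k x h * (-1/2 * k x powr (-1/2 - 1))" for h
    unfolding u_def[abs_def] frechet_derivative_eqI[OF k_powr_derivative[OF x]] ..
  have "k x * k x powr (-1/2 - 1) = u x"
    using powr_add[of "k x" 1 "-1/2 - 1"] kp by (simp add: u_def)
  then show "fderiv u x (E1 x) = - u x * a x"
    unfolding d k_derivative[OF x] by (simp add: algebra_simps)
  show "fderiv u x (E2 x) = 0" by (simp add: d k_derivative[OF x])
qed

lemma smooth_u: "smooth_on S u"
  unfolding u_def[abs_def] by (rule smooth_on_powr[OF oS smooth_k k_pos])

lemma smooth_w: "smooth_on S w"
  unfolding w_def[abs_def]
  by (rule smooth_on_minus[OF oS smooth_on_mult[OF oS smooth_on_power[OF oS smooth_u] smooth_a]])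

text \<open>The terms in \<open>a^2\<close> cancel and leave \<open>u^3 k^2\<close>. With
  \<open>E1 q = 3 w\<close>, this is the equation for the Hessian of \<open>q\<close> on the pair
  \<open>E1, E1\<close>.\<close>

lemma w_derivative:
  assumes x: "x \<in> S"
  shows "fderiv w x (E1 x) = 1 / u x" "fderiv w x (E2 x) = 0"
proof -
  note du = smooth_on_has_derivative[OF smooth_u x] and da = smooth_on_has_derivative[OF smooth_a x]
  have "(w has_derivative (\<lambda>h. - (u x ^ 3 * fderiv a x h
      + 3 * (u x)\<^sup>2 * fderiv u x h * a x))) (at x)"
    unfolding w_def[abs_def] by (auto intro!: derivative_eq_intros du da simp: algebra_simps)
  note d = frechet_derivative_eqI[OF this]
  note ds = darboux_structure[OF x] and up = u_props[OF x]
  have "fderiv w x (E1 x) = u x ^ 3 * (k x)\<^sup>2"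
    unfolding d ds up(5) by (simp add: algebra_simps power2_eq_square power3_eq_cube)
  also have "\<dots> = 1 / u x" using up(1) unfolding up(2) by (simp add: field_simps power2_eq_square power3_eq_cube)
  finally show "fderiv w x (E1 x) = 1 / u x" .
  show "fderiv w x (E2 x) = 0" unfolding d by (simp add: ds up)
qed

lemma J_derivative:
  assumes x: "x \<in> S"
  shows "(J has_derivative (\<lambda>h. 0)) (at x)"
proof -
  define d where "d h = 2 * w x * fderiv w x h - 2 * u x * fderiv u x h" for h
  have dJ: "(J has_derivative d) (at x)"
    unfolding J_def[abs_def] d_def
    by (auto intro!: derivative_eq_intros smooth_on_has_derivative[OF smooth_u x] smooth_on_has_derivative[OF smooth_w x])
  note up = u_props[OF x] and l = has_derivative_linear[OF dJ]
  have "d (E1 x) = 0" "d (E2 x) = 0"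
    using up(1) by (simp_all add: d_def w_derivative[OF x] up w_def power3_eq_cube)
  then have "d h = 0" for h
    using arg_cong[OF expansion[OF x, of h], of d] by (simp only: linear_diff[OF l] linear_cmul[OF l])  simp
  then have "d = (\<lambda>h. 0)" by auto
  then show ?thesis using dJ by simp
qed

text \<open>In the adapted frame the Killing field is \<open>3 w E2\<close>, which explains the
  divisor 9.\<close>

lemma first_integral_eq:
  assumes x: "x \<in> S"
  shows "first_integral g \<kappa> (x, E x) = J x"
proof -
  note up = u_props[OF x] and xD = subsetD[OF SD x]
  have "fderiv (\<lambda>y. \<bar>\<kappa> y\<bar> powr (-3/4)) x = fderiv (\<lambda>y. k y powr (-3/2)) x"
  proof (rule frechet_derivative_cong_open[OF oS x])
    fix y assume y: "y \<in> S"
    have "\<bar>\<kappa> y\<bar> = k y powr 2" using k_pos[OF y] kpos[OF y] by (simp add: k_square[OF y])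
    then show "\<bar>\<kappa> y\<bar> powr (-3/4) = k y powr (-3/2)" by (simp only: powr_powr) simp
  qed
  then have d: "fderiv (\<lambda>y. \<bar>\<kappa> y\<bar> powr (-3/4)) x h
      = fderiv k x h * (-3/2 * k x powr (-3/2 - 1))" for h
    unfolding frechet_derivative_eqI[OF k_powr_derivative[OF x]] by simp
  have "k x * k x powr (-3/2 - 1) = u x ^ 3"
  proof -
    have "u x ^ 3 = u x powr 3" using up(1) by simp
    also have "\<dots> = k x powr (-3/2)" unfolding u_def by (simp only: powr_powr) simp
    finally show ?thesis using powr_add[of "k x" 1 "-3/2 - 1"] k_pos[OF x] by simp
  qed
  then have d1: "fderiv (\<lambda>y. \<bar>\<kappa> y\<bar> powr (-3/4)) x (E1 x) = 3 * w x"
    unfolding d k_derivative[OF x] w_def by (simp add: algebra_simps)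
  have d2: "fderiv (\<lambda>y. \<bar>\<kappa> y\<bar> powr (-3/4)) x (E2 x) = 0"
    unfolding d k_derivative[OF x] by simp
  have "killing_vector \<kappa> (x, E x) = (3 * w x) *\<^sub>R E2 x"
    unfolding killing_vector_def Let_def fst_conv snd_conv E1_def[symmetric] E2_def[symmetric] d1 d2 by simp
  then show ?thesis
    unfolding first_integral_def fst_conv up(4)
    by (simp add: metric_algebra[OF metric xD] frame_metric[OF x] J_def power2_eq_square)
qed

lemma normal_form:
  assumes neg: "\<And>x. x \<in> S \<Longrightarrow> fderiv \<kappa> x (E x $ 1) < 0" and x0: "x0 \<in> S"
  obtains c U T \<psi> \<theta> where "x0 \<in> U" "U \<subseteq> S" "model_chart g \<kappa> c U T \<psi> \<theta>"
    "\<And>x. x \<in> U \<Longrightarrow> first_integral g \<kappa> (x, E x) = c"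
proof -
  \<comment> \<open>Orienting \<open>E1\<close> so that \<kappa> decreases makes \<open>u\<close>
    increase along it; \<open>coordinate_function\<close> needs \<open>w\<close> to be the positive
    root of \<open>u^2 + J\<close>.\<close>
  have wpos: "w x > 0" if x: "x \<in> S" for x
  proof -
    have "((\<lambda>y. (k y)\<^sup>2) has_derivative (\<lambda>h. 2 * k x * fderiv k x h)) (at x)"
      by (auto intro!: derivative_eq_intros smooth_on_has_derivative[OF smooth_k x])
    then have "fderiv (\<lambda>y. (k y)\<^sup>2) x (E1 x) = 4 * (k x)\<^sup>2 * a x"
      unfolding frechet_derivative_eqI[OF \<open>((\<lambda>y. (k y)\<^sup>2) has_derivative _) (at x)\<close>] k_derivative[OF x]
      by (simp add: power2_eq_square)
    moreover have "fderiv \<kappa> x = fderiv (\<lambda>y. (k y)\<^sup>2) x"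
      by (rule frechet_derivative_cong_open[OF oS x]) (simp add: k_square)
    ultimately have "4 * (k x)\<^sup>2 * a x < 0" using neg[OF x] by (simp add: E1_def)
    then have "a x < 0" using k_pos[OF x] by (simp add: mult_less_0_iff)
    then show ?thesis using u_props(1)[OF x] by (simp add: w_def mult_pos_neg)
  qed
  obtain r where r: "r > 0" "ball x0 r \<subseteq> S" using oS x0 open_contains_ball by blast
  \<comment> \<open>A ball serves twice: convexity makes \<open>J\<close> constant on it, and the
    Poincare lemma provides the second coordinate.\<close>
  define B where "B = ball x0 r"
  have B: "open B" "convex B" "x0 \<in> B" "B \<subseteq> S" using r by (auto simp: B_def)
  define c where "c = J x0"
  have Jc: "J x = c" if "x \<in> B" for x
    unfolding c_def
    by (rule has_derivative_zero_unique[OF B(2) _ that B(3)])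
      (use J_derivative B(4) in \<open>blast intro: has_derivative_at_withinI\<close>)
  have wu: "(w x)\<^sup>2 = (u x)\<^sup>2 + c" if "x \<in> B" for x
    using Jc[OF that] by (simp add: J_def)
  \<comment> \<open>The second dual form divided by \<open>w\<close>, so that
    \<open>w^2 \<mu>^2 = (u^2 + J) dv^2\<close> is the negative part of the metric.\<close>
  define \<mu> where "\<mu> x Y = - g x (E2 x) Y / w x" for x Y
  have sv: "smooth_on S (\<lambda>x. \<mu> x Y)" for Y
    unfolding \<mu>_def
    by (rule smooth_on_divide[OF oS smooth_on_minus[OF oS smooth_on_metric[OF metric oD oS _ smooth_on_ident[OF oS] smE2 smooth_on_const[OF oS]]] smooth_w])
      (use wpos SD in fastforce)+
  have sf: "smooth_form S \<mu>"
    unfolding smooth_form_def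
  proof (intro conjI ballI allI sv)
    fix x assume "x \<in> S"
    then show "linear (\<mu> x)"
      using metric_algebra[OF metric subsetD[OF SD]] unfolding \<mu>_def
      by (intro linearI) (simp_all add: diff_divide_distrib add_divide_distrib)
  qed
  have \<mu>E: "\<mu> x (E1 x) = 0" "\<mu> x (E2 x) = 1 / w x" if "x \<in> S" for x
    using frame_metric[OF that] by (simp_all add: \<mu>_def)
  have closed: "ext_d \<mu> x X Y = 0" if x: "x \<in> S" for x X Y
  proof (rule closed_form_frame[OF x sf])
    note v = ext_d_vector_fields[OF sf oS x smooth_on_has_derivative[OF smE1 x] smooth_on_has_derivative[OF smE2 x]]
    have 1: "fderiv (\<lambda>p. \<mu> p (E1 p)) x (E2 x) = 0"
      by (rule frechet_const_on[OF x]) (use \<mu>E in auto)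
    have "((\<lambda>p. inverse (w p)) has_derivative (\<lambda>h. - (inverse (w x) * fderiv w x h * inverse (w x)))) (at x)"
      by (rule Deriv.has_derivative_inverse[OF _ smooth_on_has_derivative[OF smooth_w x]])
        (use wpos[OF x] in auto)
    moreover have "fderiv (\<lambda>p. \<mu> p (E2 p)) x = fderiv (\<lambda>p. inverse (w p)) x"
      by (rule frechet_derivative_cong_open[OF oS x]) (simp add: \<mu>E inverse_eq_divide)
    ultimately have 2: "fderiv (\<lambda>p. \<mu> p (E2 p)) x (E1 x) = - (1 / (u x * (w x)\<^sup>2))"
      by (simp add: frechet_derivative_eqI w_derivative[OF x] divide_inverse power2_eq_square)
    have lie: "fderiv E2 x (E1 x) - fderiv E1 x (E2 x) = - b2 x *\<^sub>R E2 x"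
      using structure_section(1)[OF x] darboux_structure(1)[OF x] by (simp add: lie_def)
    have 3: "\<mu> x (- b2 x *\<^sub>R E2 x) = - b2 x / w x"
      using sf x \<mu>E(2)[OF x] linear_cmul[of "\<mu> x" "- b2 x" "E2 x"] by (simp add: smooth_form_def)
    \<comment> \<open>By this the bracket term \<open>b2 / w\<close> becomes
      \<open>1 / (u w^2)\<close> and cancels the derivative of \<open>1 / w\<close> along
      \<open>E1\<close>.\<close>
    have "w x * b2 x = 1 / u x"
    proof -
      have "w x * b2 x = - (u x ^ 3 * (a x * b2 x))" by (simp add: w_def)
      also have "\<dots> = 1 / u x"
        unfolding darboux_structure(2)[OF x] u_props(2)[OF x] using u_props(1)[OF x]
        by (simp add: power2_eq_square power3_eq_cube field_simps)
      finally show ?thesis .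
    qed
    then have "b2 x / w x = 1 / (u x * (w x)\<^sup>2)"
      using wpos[OF x] u_props(1)[OF x] by (simp add: field_simps power2_eq_square)
    then show "ext_d \<mu> x (E1 x) (E2 x) = 0"
      unfolding v 1 2 lie 3 by simp
  qed
  have sfB: "smooth_form (ball x0 r) \<mu>"
    using sf smooth_on_subset[OF _ r(2)] r(2) unfolding smooth_form_def by blast
  obtain V where V: "\<And>x. x \<in> B \<Longrightarrow> (V has_derivative \<mu> x) (at x)" "smooth_on B V"
    unfolding B_def by (rule poincare_ball[OF sfB closed[OF subsetD[OF r(2)]]]) blast+
  define d where "d x = (if c = 0 then 1 else 1 / w x)" for x
  define e where "e = (if c = 0 then 1 else 1 / sqrt \<bar>c\<bar>)"
  define U where "U x = coord_u c (u x)" for x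
  note cf = coordinate_function[OF u_props(1) wpos wu, folded d_def e_def]
  have dU: "(U has_derivative (\<lambda>h. fderiv u x h * d x)) (at x)" if x: "x \<in> B" for x
  proof -
    have xS: "x \<in> S" using x B(4) by auto
    show ?thesis
      unfolding U_def[abs_def]
      by (rule DERIV_compose_FDERIV[where g = u, OF cf(1)[OF xS xS x] smooth_on_has_derivative[OF smooth_u xS]])
  qed
  have smd: "smooth_on B d"
  proof (cases "c = 0")
    case True
    then show ?thesis unfolding d_def[abs_def] using smooth_on_const[OF B(1)] by simp
  next
    case False
    then show ?thesis
      unfolding d_def[abs_def]
      using smooth_on_divide[OF B(1) smooth_on_const[OF B(1)] smooth_on_subset[OF smooth_w B(4)], of 1] wpos B(4)
      by fastforce
  qed
  have smU: "smooth_on B U"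
    by (rule smooth_onI[OF B(1) dU]) (auto intro: smooth_on_mult[OF B(1) smooth_on_frechet[OF smooth_on_subset[OF smooth_u B(4)]] smd])
  define V' where "V' x = e * V x" for x
  have dV: "(V' has_derivative (\<lambda>h. e * \<mu> x h)) (at x)" if "x \<in> B" for x
    unfolding V'_def[abs_def] by (rule has_derivative_mult_right[OF V(1)[OF that]])
  have smV: "smooth_on B V'"
    unfolding V'_def[abs_def] by (rule smooth_on_mult[OF B(1) smooth_on_const[OF B(1)] V(2)])
  have fU: "fderiv U x (E1 x) = d x * (w x / (u x)\<^sup>2)" "fderiv U x (E2 x) = 0"
    if x: "x \<in> B" for x
  proof -
    have xS: "x \<in> S" using x B(4) by auto
    show "fderiv U x (E1 x) = d x * (w x / (u x)\<^sup>2)" "fderiv U x (E2 x) = 0"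
      unfolding frechet_derivative_eqI[OF dU[OF x]] u_props(5,6)[OF xS] w_def
      using u_props(1)[OF xS] by (simp_all add: power2_eq_square power3_eq_cube)
  qed
  have fV: "fderiv V' x (E2 x) = e / w x" "fderiv V' x (E1 x) = 0" if x: "x \<in> B" for x
    unfolding frechet_derivative_eqI[OF dV[OF x]] using \<mu>E x B(4) by auto
  have A: "model_u c (U x) * (fderiv U x (E1 x))\<^sup>2 = 1" if "x \<in> B" for x
    unfolding fU[OF that] using cf(2)[of x] that B(4) by (auto simp: U_def)
  have C: "model_v c (U x) * (fderiv V' x (E2 x))\<^sup>2 = 1" if "x \<in> B" for x
    unfolding fV[OF that] using cf(3)[of x] that B(4) by (auto simp: U_def)
  obtain O' T \<psi> \<theta> where lc: "open O'" "O' \<subseteq> B" "x0 \<in> O'" "open T" "homeomorphism O' T \<psi> \<theta>"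
    "smooth_on O' \<psi>" "smooth_on T \<theta>" "\<And>x. x \<in> O' \<Longrightarrow> \<psi> x $ 1 = U x"
    "\<And>x X Y. x \<in> O' \<Longrightarrow> g x X Y = diag_metric (model_u c) (model_v c) (\<psi> x)
      (fderiv \<psi> x X) (fderiv \<psi> x Y)"
    using local_chart[OF B(1,3,4) smU smV fU(2) fV(2) A C] by blast
  have "\<kappa> x = model_K c (\<psi> x $ 1)" if "x \<in> O'" for x
  proof -
    have xB: "x \<in> B" and xS: "x \<in> S" using that lc(2) B(4) by auto
    show ?thesis using cf(4)[OF xS xS xB] u_props(3)[OF xS] lc(8)[OF that] by (simp add: U_def)
  qed
  then have "model_chart g \<kappa> c O' T \<psi> \<theta>"
    using lc by (simp add: model_chart_def)
  then show ?thesis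
    by (rule that[OF lc(3) order_trans[OF lc(2) B(4)]])
      (use first_integral_eq Jc lc(2) B(4) in auto)
qed

end

subsection \<open>Lorentzian surfaces\<close>

definition curvature_q :: "(real^2 \<Rightarrow> real) \<Rightarrow> real^2 \<Rightarrow> real" where
  "curvature_q \<kappa> y = \<bar>\<kappa> y\<bar> powr (-3/4)"

text \<open>The Killing field has the components of the gradient of \<open>q\<close> interchanged up
  to sign, so minus its square is a difference of squares of \<open>dq\<close> on the frame, the
  expression to which \<open>frame_invariance\<close> applies.\<close>

lemma first_integral_frame:
  assumes L: "lorentz_metric_on D g" and f: "(x, v) \<in> frame_bundle D g"
  shows "first_integral g \<kappa> (x, v) = ((fderiv (curvature_q \<kappa>) x (v $ 1))\<^sup>2
    - (fderiv (curvature_q \<kappa>) x (v $ 2))\<^sup>2) / 9 - \<kappa> x powr (-1/2)"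
proof -
  note fb = frame_bundleD[OF f]
  have q: "(\<lambda>y. \<bar>\<kappa> y\<bar> powr (-3/4)) = curvature_q \<kappa>" by (simp add: curvature_q_def fun_eq_iff)
  show ?thesis
    unfolding first_integral_def killing_vector_def Let_def fst_conv snd_conv q
    by (simp add: metric_algebra[OF L fb(1)] fb power2_eq_square algebra_simps diff_divide_distrib)
qed

lemma curvature_q_differentiable:
  assumes o: "open D" and L: "lorentz_metric_on D g" and st: "structure_equations D g \<beta> \<kappa>"
    and pos: "\<And>x. x \<in> D \<Longrightarrow> \<kappa> x > 0" and x: "x \<in> D"
  shows "curvature_q \<kappa> differentiable (at x)"
proof -
  obtain S E where S: "open S" "x \<in> S" "S \<subseteq> D" "smooth_on S E" "\<And>y. y \<in> S \<Longrightarrow> (y, E y) \<in> frame_bundle D g"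
    using local_frame_exists[OF o L x] by blast
  interpret frame_section D g \<beta> \<kappa> S E
    by unfold_locales (use o L st S in auto)
  have "smooth_on S (\<lambda>y. \<kappa> y powr (-3/4))"
    by (rule smooth_on_powr[OF oS smooth_curvature]) (use pos S(3) in auto)
  then have "smooth_on S (curvature_q \<kappa>)"
    by (rule smooth_on_cong[OF oS]) (use pos S(3) in \<open>auto simp: curvature_q_def abs_of_pos\<close>)
  then show ?thesis using S(2) by (rule smooth_on_differentiable)
qed

text \<open>The constant is computed in the adapted frame, but \<open>frame_invariance\<close> gives
  it for every orthonormal frame over \<open>U\<close>; this makes the constants of different charts
  comparable.\<close>

lemma local_model:
  assumes o: "open D" and L: "lorentz_metric_on D g" and st: "structure_equations D g \<beta> \<kappa>"
    and pos: "\<And>x. x \<in> D \<Longrightarrow> \<kappa> x > 0"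
    and sp: "\<And>f. f \<in> frame_bundle D g \<Longrightarrow> g (fst f) (killing_vector \<kappa> f) (killing_vector \<kappa> f) < 0"
    and dbx: "contains_transversal_frobenius (frame_bundle D g \<times> mink_frames) (theta_forms g \<beta>) (singular_forms g \<beta> \<kappa> \<i>)"
    and x0: "x0 \<in> D"
  obtains c U T \<psi> \<theta> where "x0 \<in> U" "U \<subseteq> D" "model_chart g \<kappa> c U T \<psi> \<theta>"
    "\<And>f. f \<in> frame_bundle D g \<Longrightarrow> fst f \<in> U \<Longrightarrow> first_integral g \<kappa> f = c"
proof -
  obtain S E where S: "open S" "x0 \<in> S" "S \<subseteq> D" "smooth_on S E" "\<And>x. x \<in> S \<Longrightarrow> (x, E x) \<in> frame_bundle D g"
    "\<And>x. x \<in> S \<Longrightarrow> fderiv \<kappa> x (E x $ 2) = 0"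
    "\<And>x. x \<in> S \<Longrightarrow> fderiv \<kappa> x (E x $ 1) < 0"
    by (rule adapted_frame_exists[OF o L st pos sp x0], assumption, assumption, rule that)
  define f0 :: frame3 where "f0 = (0, \<chi> i. axis i 1)"
  have f0: "f0 \<in> mink_frames" unfolding f0_def by (rule mink_frames_nonempty)
  have "((x0, E x0), f0) \<in> frame_bundle D g \<times> mink_frames" using S(2,5) f0 by auto
  from bspec[OF dbx[unfolded contains_transversal_frobenius_def] this] obtain W \<alpha>s where W: "open W" "((x0, E x0), f0) \<in> W" "length \<alpha>s \<ge> 2"
      "frobenius_frame (frame_bundle D g \<times> mink_frames) W \<alpha>s"
    and WW: "\<forall>q\<in>(frame_bundle D g \<times> mink_frames) \<inter> W.
      (\<forall>\<alpha>\<in>set \<alpha>s. in_span_on (tangent_space (frame_bundle D g \<times> mink_frames) q) (forms_at (singular_forms g \<beta> \<kappa> \<i>) q) (\<alpha> q)) \<and>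
      (\<forall>v. in_span_on (tangent_space (frame_bundle D g \<times> mink_frames) q) (forms_at \<alpha>s q) v \<and>
         in_span_on (tangent_space (frame_bundle D g \<times> mink_frames) q) (forms_at (theta_forms g \<beta>) q) v
         \<longrightarrow> (\<forall>X\<in>tangent_space (frame_bundle D g \<times> mink_frames) q. v X = 0))"
    by (elim exE conjE) (rule that)
  \<comment> \<open>A single Minkowski frame is kept fixed while \<open>x\<close> varies; at this
    frame transversality is evaluated at every point of the shrunken domain.\<close>
  define S' where "S' = {x \<in> S. ((x, E x), f0) \<in> W}"
  have "continuous_on S (\<lambda>x. ((x, E x), f0))"
    by (intro continuous_intros smooth_on_continuous[OF S(4)])
  from continuous_open_preimage[OF this S(1) W(1)]
  have S': "open S'" "x0 \<in> S'" "S' \<subseteq> S" using S(2) W(2) by (auto simp: S'_def vimage_def Int_def)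
  interpret darboux_section D g \<beta> \<kappa> S' E W \<alpha>s f0
  proof unfold_locales
    let ?N = "frame_bundle D g \<times> mink_frames"
    show "open D" "lorentz_metric_on D g" "structure_equations D g \<beta> \<kappa>" "open S'" "open W" "2 \<le> length \<alpha>s"
      "frobenius_frame ?N W \<alpha>s" "f0 \<in> mink_frames"
      by (fact o L st S'(1) W(1,3,4) f0)+
    show "S' \<subseteq> D" using S'(3) S(3) by (rule order_trans)
    show "smooth_on S' E" by (rule smooth_on_subset[OF S(4) S'(3)])
    show "in_span_on (tangent_space ?N q) (forms_at (singular_forms g \<beta> \<kappa> \<i>) q) (\<alpha> q)"
      if "q \<in> ?N \<inter> W" "\<alpha> \<in> set \<alpha>s" for q \<alpha>
      using bspec[OF WW that(1)] that(2) by blast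
    show "\<forall>X\<in>tangent_space ?N q. v X = 0"
      if "q \<in> ?N \<inter> W" "in_span_on (tangent_space ?N q) (forms_at \<alpha>s q) v"
        "in_span_on (tangent_space ?N q) (forms_at (theta_forms g \<beta>) q) v" for q v
      using bspec[OF WW that(1)] that(2,3) by blast
    fix x assume "x \<in> S'"
    then have x: "x \<in> S" "x \<in> D" and xW: "((x, E x), f0) \<in> W" using S(3) by (auto simp: S'_def)
    show "(x, E x) \<in> frame_bundle D g" by (rule S(5)[OF x(1)])
    show "((x, E x), f0) \<in> W" by (rule xW)
    show "\<kappa> x > 0" by (rule pos[OF x(2)])
    show "fderiv \<kappa> x (E x $ 2) = 0" by (rule S(6)[OF x(1)])
    show "fderiv \<kappa> x (E x $ 1) \<noteq> 0" using S(7)[OF x(1)] by simp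
  qed
  have neg: "fderiv \<kappa> x (E x $ 1) < 0" if "x \<in> S'" for x
    using S(7) S'(3) that by blast
  obtain c U T \<psi> \<theta> where nf: "x0 \<in> U" "U \<subseteq> S'" "model_chart g \<kappa> c U T \<psi> \<theta>"
    "\<And>x. x \<in> U \<Longrightarrow> first_integral g \<kappa> (x, E x) = c"
    by (rule normal_form[OF neg S'(2)], assumption, rule that)
  have "first_integral g \<kappa> f = c" if f: "f \<in> frame_bundle D g" "fst f \<in> U" for f
  proof -
    obtain x v where xv: "f = (x, v)" by (cases f)
    have x: "x \<in> U" "x \<in> S'" "x \<in> D" using f nf(2) SD by (auto simp: xv)
    note fv = f(1)[unfolded xv] and fE = frameE[OF x(2)]
    have lin: "linear (fderiv (curvature_q \<kappa>) x)"
      by (rule linear_frechet_derivative[OF curvature_q_differentiable[OF o L st pos x(3)]])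
    show ?thesis
      using nf(4)[OF x(1)] frame_invariance[OF L fv fE lin]
      unfolding xv first_integral_frame[OF L fv] first_integral_frame[OF L fE] by simp
  qed
  then show ?thesis using that[OF nf(1) _ nf(3)] nf(2) SD by blast
qed

section \<open>Charts and transition maps\<close>

lemma homeomorphism_imp_homeomorphic_map:
  assumes "homeomorphism S T f g"
  shows "homeomorphic_map (top_of_set S) (top_of_set T) f"
proof -
  have "homeomorphic_maps (top_of_set S) (top_of_set T) f g"
    using assms unfolding homeomorphic_maps_def homeomorphism_def by auto
  then show ?thesis by (auto simp: homeomorphic_map_maps)
qed

lemma chart_subset: "is_chart M c \<Longrightarrow> fst c \<subseteq> topspace M"
  by (simp add: is_chart_def openin_subset)

lemma chart_topspace: "is_chart M c \<Longrightarrow> topspace (subtopology M (fst c)) = fst c"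
  by (simp add: Int_absorb1 chart_subset)

lemma chart_inj: "is_chart M c \<Longrightarrow> inj_on (snd c) (fst c)"
  using homeomorphic_imp_injective_map[of "subtopology M (fst c)" _ "snd c"] chart_topspace[of M c]
  by (auto simp: is_chart_def)

lemma chart_inverse: "is_chart M c \<Longrightarrow> p \<in> fst c \<Longrightarrow> inv_into (fst c) (snd c) (snd c p) = p"
  using chart_inj by (metis inv_into_f_f)

lemma chart_open_image:
  assumes c: "is_chart M c" and O': "openin M P" "P \<subseteq> fst c"
  shows "open (snd c ` P)"
proof -
  have h: "homeomorphic_map (subtopology M (fst c)) (top_of_set (chart_image c)) (snd c)"
    and o: "open (chart_image c)" "openin M (fst c)" using c by (auto simp: is_chart_def)
  have "openin (subtopology M (fst c)) P" using O' o(2) by (simp add: openin_open_subtopology)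
  then have "openin (top_of_set (chart_image c)) (snd c ` P)"
    using homeomorphic_map_openness[OF h] O' chart_topspace[OF c] by auto
  then show ?thesis using o(1) openin_open_trans by blast
qed

lemma chart_open_preimage:
  assumes c: "is_chart M c" and U: "open U"
  shows "openin M {p \<in> fst c. snd c p \<in> U}"
proof -
  have h: "homeomorphic_map (subtopology M (fst c)) (top_of_set (chart_image c)) (snd c)"
    and o: "openin M (fst c)" using c by (auto simp: is_chart_def)
  have "openin (top_of_set (chart_image c)) (chart_image c \<inter> U)" using U by auto
  from openin_continuous_map_preimage[OF homeomorphic_imp_continuous_map[OF h] this]
  have "openin (subtopology M (fst c)) {p \<in> fst c. snd c p \<in> chart_image c \<inter> U}"
    unfolding chart_topspace[OF c] .
  then have "openin M {p \<in> fst c. snd c p \<in> chart_image c \<inter> U}"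
    using o openin_open_subtopology by blast
  moreover have "{p \<in> fst c. snd c p \<in> chart_image c \<inter> U} = {p \<in> fst c. snd c p \<in> U}"
    by (auto simp: chart_image_def)
  ultimately show ?thesis by simp
qed

lemma overlap_open: "is_chart M c \<Longrightarrow> is_chart M c' \<Longrightarrow> open (overlap c c')"
  unfolding overlap_def by (rule chart_open_image) (auto simp: is_chart_def)

lemma transition_apply: "is_chart M c \<Longrightarrow> p \<in> fst c \<Longrightarrow> transition c c' (snd c p) = snd c' p"
  by (simp add: transition_def in_chart_def chart_inverse)

lemma in_chart_apply: "is_chart M c \<Longrightarrow> p \<in> fst c \<Longrightarrow> in_chart c K (snd c p) = K p"
  by (simp add: in_chart_def chart_inverse)

lemma frechet_derivative_chain:
  assumes "smooth_on S f" "x \<in> S" "g differentiable (at (f x))"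
  shows "fderiv (\<lambda>y. g (f y)) x h = fderiv g (f x) (fderiv f x h)"
proof -
  have "(g has_derivative fderiv g (f x)) (at (f x))"
    using assms(3) frechet_derivative_works by blast
  from frechet_derivative_eqI[OF has_derivative_compose[OF smooth_on_has_derivative[OF assms(1,2)] this]]
  show ?thesis by simp
qed

text \<open>The transition into the new chart is \<psi> after the transition into \<open>c\<close>,
  and the one back is the old transition after \<theta>; smoothness and agreement of metrics follow
  by composition and the chain rule.\<close>

lemma composed_chart:
  assumes c: "is_chart M c" and U: "open U" "U \<subseteq> chart_image c" "open T" "homeomorphism U T \<psi> \<theta>"
    and sm: "smooth_on U \<psi>" "smooth_on T \<theta>"
  defines "c' \<equiv> ({p \<in> fst c. snd c p \<in> U}, \<psi> \<circ> snd c)"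
  shows "is_chart M c'"
    and "is_chart M d \<Longrightarrow> charts_compatible d c \<Longrightarrow> charts_compatible d c'"
    and "is_chart M d \<Longrightarrow> charts_compatible d c \<Longrightarrow> metrics_agree d c gd gc \<Longrightarrow>
      (\<And>x X Y. x \<in> U \<Longrightarrow> gc x X Y = h (\<psi> x) (fderiv \<psi> x X) (fderiv \<psi> x Y)) \<Longrightarrow>
      metrics_agree d c' gd h"
proof -
  define P where "P = {p \<in> fst c. snd c p \<in> U}"
  have c'[simp]: "fst c' = P" "snd c' = \<psi> \<circ> snd c" by (simp_all add: c'_def P_def)
  have im: "snd c ` P = U" using U(2) by (force simp: P_def chart_image_def)
  have Pc: "P \<subseteq> fst c" by (auto simp: P_def)
  have oP: "openin M P" unfolding P_def by (rule chart_open_preimage[OF c U(1)])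
  have ci: "chart_image c' = T"
  proof -
    have "chart_image c' = \<psi> ` (snd c ` P)" by (simp add: chart_image_def image_comp)
    then show ?thesis using U(4) unfolding im homeomorphism_def by simp
  qed
  have h: "homeomorphic_map (subtopology M (fst c)) (top_of_set (chart_image c)) (snd c)"
    using c by (simp add: is_chart_def)
  have "homeomorphic_map (subtopology (subtopology M (fst c)) P) (subtopology (top_of_set (chart_image c)) U) (snd c)"
    by (rule homeomorphic_map_subtopologies[OF h]) (use chart_topspace[OF c] Pc im U(2) in \<open>simp add: Int_absorb1\<close>)
  then have "homeomorphic_map (subtopology M P) (top_of_set U) (snd c)"
    using Pc U(2) by (simp add: subtopology_subtopology Int_absorb1)
  from homeomorphic_map_compose[OF this homeomorphism_imp_homeomorphic_map[OF U(4)]]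
  show ch: "is_chart M c'" using oP U(3) ci by (simp add: is_chart_def)
  have \<theta>\<psi>: "\<theta> (\<psi> x) = x" "\<psi> x \<in> T" if "x \<in> U" for x using U(4) that by (auto simp: homeomorphism_def)
  assume d: "is_chart M d" and cmp: "charts_compatible d c"
  have ov: "overlap d c' \<subseteq> overlap d c" using Pc by (auto simp: overlap_def)
  have tU: "transition d c x \<in> U" "transition d c' x = \<psi> (transition d c x)" if x: "x \<in> overlap d c'" for x
  proof -
    obtain p where p: "x = snd d p" "p \<in> fst d" "p \<in> P" using x by (auto simp: overlap_def)
    show "transition d c x \<in> U" "transition d c' x = \<psi> (transition d c x)"
      using p by (auto simp: transition_apply[OF d] P_def)
  qed
  note od = overlap_open[OF d ch] and od' = overlap_open[OF ch d]
  have st: "smooth_on (overlap d c') (transition d c)" "smooth_on (overlap c d) (transition c d)"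
    using cmp ov smooth_on_subset by (auto simp: charts_compatible_def)
  have s1: "smooth_on (overlap d c') (transition d c')"
    by (rule smooth_on_cong[OF od smooth_on_compose[OF od U(1) tU(1) st(1) sm(1)]]) (simp_all add: tU(2))
  have s2: "smooth_on (overlap c' d) (transition c' d)"
  proof (rule smooth_on_cong[OF od' smooth_on_compose[OF od' overlap_open[OF c d] _ _ st(2), of \<theta>]])
    fix y assume "y \<in> overlap c' d"
    then obtain p where p: "y = \<psi> (snd c p)" "p \<in> P" "p \<in> fst d" by (auto simp: overlap_def)
    then have y: "\<theta> y = snd c p" using \<theta>\<psi>(1) by (simp add: P_def)
    show "\<theta> y \<in> overlap c d" unfolding y using p Pc by (auto simp: overlap_def)
    show "transition c d (\<theta> y) = transition c' d y"
      unfolding y using p Pc transition_apply[OF c, of p d] transition_apply[OF ch, of p d] by auto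
  next
    have "overlap c' d \<subseteq> T" using ci by (auto simp: overlap_def chart_image_def)
    then show "smooth_on (overlap c' d) \<theta>" by (rule smooth_on_subset[OF sm(2)])
  qed
  show "charts_compatible d c'" using s1 s2 by (simp add: charts_compatible_def)
  assume ag: "metrics_agree d c gd gc"
    and iso: "\<And>x X Y. x \<in> U \<Longrightarrow> gc x X Y = h (\<psi> x) (fderiv \<psi> x X) (fderiv \<psi> x Y)"
  show "metrics_agree d c' gd h"
    unfolding metrics_agree_def Let_def
  proof (intro ballI allI)
    fix x X Y assume x: "x \<in> overlap d c'"
    have "fderiv (transition d c') x = fderiv (\<lambda>y. \<psi> (transition d c y)) x"
      by (rule frechet_derivative_cong_open[OF od x]) (simp add: tU)
    then have fd: "fderiv (transition d c') x V
        = fderiv \<psi> (transition d c x) (fderiv (transition d c) x V)" for V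
      using frechet_derivative_chain[OF st(1) x smooth_on_differentiable[OF sm(1) tU(1)[OF x]]] by simp
    have "gd x X Y = gc (transition d c x) (fderiv (transition d c) x X) (fderiv (transition d c) x Y)"
      using ag x ov unfolding metrics_agree_def Let_def by blast
    then show "gd x X Y = h (transition d c' x) (fderiv (transition d c') x X) (fderiv (transition d c') x Y)"
      unfolding fd tU(2)[OF x] iso[OF tU(1)[OF x]] .
  qed
qed

text \<open>The differential of the transition map sends orthonormal frames to orthonormal frames
  and pulls \<open>q\<close> back to \<open>q\<close>. Both sides thus come from one functional
  evaluated on two frames at the same point.\<close>

lemma first_integral_chart_independent:
  assumes c: "is_chart M c" "is_chart M c'" and cmp: "charts_compatible c c'"
    and L: "lorentz_metric_on (chart_image c) g" "lorentz_metric_on (chart_image c') g'"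
    and st: "structure_equations (chart_image c') g' \<beta> (in_chart c' K)"
    and pos: "\<And>x. x \<in> chart_image c' \<Longrightarrow> in_chart c' K x > 0"
    and ag: "metrics_agree c c' g g'" and p: "p \<in> fst c" "p \<in> fst c'"
    and f: "(snd c p, v) \<in> frame_bundle (chart_image c) g" "(snd c' p, v') \<in> frame_bundle (chart_image c') g'"
  shows "first_integral g (in_chart c K) (snd c p, v) = first_integral g' (in_chart c' K) (snd c' p, v')"
proof -
  let ?x = "snd c p" and ?y = "snd c' p" and ?d = "fderiv (transition c c') (snd c p)"
  let ?q = "curvature_q (in_chart c K)" and ?q' = "curvature_q (in_chart c' K)"
  have x: "?x \<in> overlap c c'" using p by (auto simp: overlap_def)
  have tr: "transition c c' ?x = ?y" by (rule transition_apply[OF c(1) p(1)])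
  have sm: "smooth_on (overlap c c') (transition c c')" using cmp by (simp add: charts_compatible_def)
  have oc': "open (chart_image c')" using c(2) by (simp add: is_chart_def)
  have y: "?y \<in> chart_image c'" using p by (auto simp: chart_image_def)
  have dq': "?q' differentiable (at ?y)" by (rule curvature_q_differentiable[OF oc' L(2) st pos y])
  define w where "w = (\<chi> i. ?d (v $ i))"
  have agx: "g ?x X Y = g' ?y (?d X) (?d Y)" for X Y
    using ag x unfolding metrics_agree_def Let_def tr[symmetric] by blast
  have w: "(?y, w) \<in> frame_bundle (chart_image c') g'"
    using f(1) y unfolding frame_bundle_def w_def by (simp flip: agx)
  have "fderiv ?q ?x = fderiv (\<lambda>z. ?q' (transition c c' z)) ?x"
  proof (rule frechet_derivative_cong_open[OF overlap_open[OF c] x])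
    fix z assume "z \<in> overlap c c'"
    then obtain r where "z = snd c r" "r \<in> fst c" "r \<in> fst c'" by (auto simp: overlap_def)
    then show "?q z = ?q' (transition c c' z)"
      by (simp add: curvature_q_def transition_apply[OF c(1)] in_chart_apply[OF c(1)] in_chart_apply[OF c(2)])
  qed
  then have fd: "fderiv ?q ?x V = fderiv ?q' ?y (?d V)" for V
    using frechet_derivative_chain[OF sm x, of ?q'] dq' by (simp add: tr)
  have lin: "linear (fderiv ?q' ?y)" by (rule linear_frechet_derivative[OF dq'])
  show ?thesis
    using frame_invariance[OF L(2) w f(2) lin]
    unfolding first_integral_frame[OF L(1) f(1)] first_integral_frame[OF L(2) f(2)] fd
      in_chart_apply[OF c(1) p(1)] in_chart_apply[OF c(2) p(2)] w_def by simp
qed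

lemma frame_exists:
  assumes "lorentz_metric_on D g" "x \<in> D"
  obtains v where "(x, v) \<in> frame_bundle D g"
proof -
  obtain X Y where "g x X X = 1" "g x Y Y = -1" "g x X Y = 0"
    using assms unfolding lorentz_metric_on_def by blast
  then have "(x, \<chi> i. if i = 1 then X else Y) \<in> frame_bundle D g"
    by (intro frame_bundleI[OF assms]) simp_all
  then show ?thesis using that by blast
qed

theorem theorem11:
  fixes M :: "'a topology" and A :: "'a chart set"
    and g :: "'a chart \<Rightarrow> metric2"
    and \<beta> :: "'a chart \<Rightarrow> frame2 \<Rightarrow> frame2 \<Rightarrow> real"
    and K :: "'a \<Rightarrow> real"
  assumes "lorentzian_surface M A g"
    and "connection_and_curvature A g \<beta> K"
    and "elliptic M K"
    and "darboux_integrable A g \<beta> K"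
    and "spacelike_killing_field A g K"
  shows "\<forall>C\<in>connected_components_of M.
     (\<exists>c>0. locally_equivalent_on M A g K C
        (diag_metric (\<lambda>u. c * cosh u ^ 4) (\<lambda>u. c * sinh u ^ 2)) (\<lambda>u. 1 / (c * cosh u ^ 4))) \<or>
     (\<exists>c>0. locally_equivalent_on M A g K C
        (diag_metric (\<lambda>u. c * sinh u ^ 4) (\<lambda>u. c * cosh u ^ 2)) (\<lambda>u. 1 / (c * sinh u ^ 4))) \<or>
     locally_equivalent_on M A g K C
        (diag_metric (\<lambda>u. u ^ 2) (\<lambda>u. u ^ 2)) (\<lambda>u. 1 / u ^ 4)"
proof
  fix C assume C: "C \<in> connected_components_of M"
  have ch: "is_chart M c" and L: "lorentz_metric_on (chart_image c) (g c)"
    and st: "structure_equations (chart_image c) (g c) (\<beta> c) (in_chart c K)" if "c \<in> A" for c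
    using assms(1,2) that by (auto simp: lorentzian_surface_def smooth_surface_def connection_and_curvature_def)
  have cmp: "charts_compatible c c'" and ag: "metrics_agree c c' (g c) (g c')" if "c \<in> A" "c' \<in> A" for c c'
    using assms(1) that by (auto simp: lorentzian_surface_def smooth_surface_def)
  have cover: "\<exists>c\<in>A. p \<in> fst c" if "p \<in> topspace M" for p
    using assms(1) that by (auto simp: lorentzian_surface_def smooth_surface_def)
  have pos: "in_chart c K x > 0" if c: "c \<in> A" and x: "x \<in> chart_image c" for c x
  proof -
    obtain p where p: "x = snd c p" "p \<in> fst c" using x by (auto simp: chart_image_def)
    then show ?thesis
      using assms(3) chart_subset[OF ch[OF c]] by (auto simp: in_chart_apply[OF ch[OF c]] elliptic_def)
  qed
  have sp: "g c (fst f) (killing_vector (in_chart c K) f) (killing_vector (in_chart c K) f) < 0"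
    if "c \<in> A" "f \<in> frame_bundle (chart_image c) (g c)" for c f
    using assms(5) that unfolding spacelike_killing_field_def Let_def by blast
  have dbx: "contains_transversal_frobenius (frame_bundle (chart_image c) (g c) \<times> mink_frames)
      (theta_forms (g c) (\<beta> c)) (singular_forms (g c) (\<beta> c) (in_chart c K) \<i>)"
    if c: "c \<in> A" and ne: "chart_image c \<noteq> {}" for c
  proof -
    obtain x where x: "x \<in> chart_image c" using ne by auto
    have "darboux_integrable_chart (chart_image c) (g c) (\<beta> c) (in_chart c K)"
      using assms(4) c by (simp add: darboux_integrable_def)
    \<comment> \<open>An empty chart satisfies the hyperbolic alternative vacuously; a point of the
      chart excludes that alternative.\<close>
    moreover have "\<not> (\<forall>x\<in>chart_image c. in_chart c K x < 0)" using pos[OF c x] x by force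
    ultimately show ?thesis unfolding darboux_integrable_chart_def Let_def by blast
  qed
  \<comment> \<open>Quantifying over all charts and frames makes this a property of the point alone;
    \<open>level_unique\<close> holds because every point lies in a chart and carries a
    frame.\<close>
  define level where "level p J \<longleftrightarrow> (\<forall>c\<in>A. \<forall>v. p \<in> fst c \<longrightarrow> (snd c p, v) \<in> frame_bundle (chart_image c) (g c)
      \<longrightarrow> first_integral (g c) (in_chart c K) (snd c p, v) = J)" for p J
  have image: "snd c p \<in> chart_image c" if "p \<in> fst c" for c and p :: 'a using that by (auto simp: chart_image_def)
  have level_unique: "J = J'" if "level p J" "level p J'" and p: "p \<in> topspace M" for p J J'
  proof -
    obtain c where c: "c \<in> A" "p \<in> fst c" using cover[OF p] by blast
    obtain v where "(snd c p, v) \<in> frame_bundle (chart_image c) (g c)" by (rule frame_exists[OF L[OF c(1)] image[OF c(2)]])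
    then show ?thesis using that c unfolding level_def by blast
  qed
  have loc: "\<exists>J c U T \<psi> \<theta>. c \<in> A \<and> p \<in> fst c \<and> snd c p \<in> U \<and> U \<subseteq> chart_image c \<and>
      model_chart (g c) (in_chart c K) J U T \<psi> \<theta> \<and> (\<forall>p'\<in>fst c. snd c p' \<in> U \<longrightarrow> level p' J)"
    if p: "p \<in> topspace M" for p
  proof -
    obtain c where c: "c \<in> A" "p \<in> fst c" using cover[OF p] by blast
    note im = image[OF c(2)]
    have oc: "open (chart_image c)" using ch[OF c(1)] by (simp add: is_chart_def)
    have ne: "chart_image c \<noteq> {}" using im by auto
    obtain J U T \<psi> \<theta> where m: "snd c p \<in> U" "U \<subseteq> chart_image c" "model_chart (g c) (in_chart c K) J U T \<psi> \<theta>"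
      "\<And>f. f \<in> frame_bundle (chart_image c) (g c) \<Longrightarrow> fst f \<in> U \<Longrightarrow> first_integral (g c) (in_chart c K) f = J"
      by (rule local_model[OF oc L[OF c(1)] st[OF c(1)] pos[OF c(1)] sp[OF c(1)] dbx[OF c(1) ne] im], assumption, assumption, rule that)
    have "level p' J" if p': "p' \<in> fst c" "snd c p' \<in> U" for p'
      unfolding level_def
    proof (intro ballI allI impI)
      fix d v' assume d: "d \<in> A" "p' \<in> fst d" "(snd d p', v') \<in> frame_bundle (chart_image d) (g d)"
      obtain v where v: "(snd c p', v) \<in> frame_bundle (chart_image c) (g c)"
        by (rule frame_exists[OF L[OF c(1)] image[OF p'(1)]])
      show "first_integral (g d) (in_chart d K) (snd d p', v') = J"
        using first_integral_chart_independent[OF ch[OF d(1)] ch[OF c(1)] cmp[OF d(1) c(1)] L[OF d(1)] L[OF c(1)]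
            st[OF c(1)] pos[OF c(1)] ag[OF d(1) c(1)] d(2) p'(1) d(3) v] m(4)[OF v] p'(2) by simp
    qed
    then show ?thesis using c m(1-3) by blast
  qed
  obtain p0 where p0: "p0 \<in> C" using nonempty_connected_components_of[OF C] by auto
  have conn: "connectedin M C" by (rule connectedin_connected_components_of[OF C])
  then have CM: "C \<subseteq> topspace M" by (rule connectedin_subset_topspace)
  obtain J where J0: "level p0 J" using loc[of p0] p0 CM by blast
  \<comment> \<open>With \<open>b\<close> standing for either truth value, the level set and its
    complement are treated at once; a connected \<open>C\<close> containing \<open>p0\<close> then
    lies in the level set.\<close>
  have opn: "openin M {p \<in> topspace M. level p J \<longleftrightarrow> b}" for b
  proof (subst openin_subopen, intro ballI)
    fix p assume p: "p \<in> {p \<in> topspace M. level p J \<longleftrightarrow> b}"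
    then obtain J' c U T \<psi> \<theta> where l: "c \<in> A" "p \<in> fst c" "snd c p \<in> U" "open U"
        "\<And>p'. p' \<in> fst c \<Longrightarrow> snd c p' \<in> U \<Longrightarrow> level p' J'"
      using loc[of p] unfolding model_chart_def by blast
    have eq: "level p' J \<longleftrightarrow> J = J'" if "p' \<in> fst c" "snd c p' \<in> U" for p'
      using l(5)[OF that] level_unique[of p' J J'] chart_subset[OF ch[OF l(1)]] that(1) by blast
    have "{p' \<in> fst c. snd c p' \<in> U} \<subseteq> {p \<in> topspace M. level p J \<longleftrightarrow> b}"
      using eq eq[OF l(2,3)] p chart_subset[OF ch[OF l(1)]] by auto
    then show "\<exists>T. openin M T \<and> p \<in> T \<and> T \<subseteq> {p \<in> topspace M. level p J \<longleftrightarrow> b}"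
      using chart_open_preimage[OF ch[OF l(1)] l(4)] l(2,3) by blast
  qed
  have lev: "level p J" if p: "p \<in> C" for p
  proof (rule ccontr)
    assume "\<not> level p J"
    then have "C \<subseteq> {p \<in> topspace M. level p J \<longleftrightarrow> True} \<union> {p \<in> topspace M. level p J \<longleftrightarrow> False}"
      "{p \<in> topspace M. level p J \<longleftrightarrow> True} \<inter> {p \<in> topspace M. level p J \<longleftrightarrow> False} \<inter> C = {}"
      "{p \<in> topspace M. level p J \<longleftrightarrow> True} \<inter> C \<noteq> {}" "{p \<in> topspace M. level p J \<longleftrightarrow> False} \<inter> C \<noteq> {}"
      using CM p p0 J0 by auto
    then show False using conn opn[of True] opn[of False] unfolding connectedin by blast
  qed
  have main: "locally_equivalent_on M A g K C (diag_metric (model_u J) (model_v J)) (model_K J)"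
    unfolding locally_equivalent_on_def
  proof
    fix p assume p: "p \<in> C"
    then obtain J' c U T \<psi> \<theta> where l: "c \<in> A" "p \<in> fst c" "snd c p \<in> U" "U \<subseteq> chart_image c"
        "model_chart (g c) (in_chart c K) J' U T \<psi> \<theta>" "\<And>p'. p' \<in> fst c \<Longrightarrow> snd c p' \<in> U \<Longrightarrow> level p' J'"
      using loc[of p] CM by blast
    have "J' = J" using level_unique[OF l(6)[OF l(2,3)] lev[OF p]] p CM by blast
    note m = l(5)[unfolded this model_chart_def]
    have U: "open U" "open T" "homeomorphism U T \<psi> \<theta>" "smooth_on U \<psi>" "smooth_on T \<theta>"
      and kap: "\<And>x. x \<in> U \<Longrightarrow> in_chart c K x = model_K J (\<psi> x $ 1)"
      and iso: "\<And>x X Y. x \<in> U \<Longrightarrow> g c x X Y = diag_metric (model_u J) (model_v J) (\<psi> x)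
          (fderiv \<psi> x X) (fderiv \<psi> x Y)"
      using m by blast+
    define c' where "c' = ({p \<in> fst c. snd c p \<in> U}, \<psi> \<circ> snd c)"
    note cc = composed_chart[OF ch[OF l(1)] U(1) l(4) U(2-5), folded c'_def]
    have "is_chart M c' \<and> p \<in> fst c' \<and> (\<forall>d\<in>A. charts_compatible d c' \<and>
        metrics_agree d c' (g d) (diag_metric (model_u J) (model_v J))) \<and> (\<forall>x\<in>fst c'. K x = model_K J (snd c' x $ 1))"
    proof (intro conjI ballI)
      show "is_chart M c'" by (rule cc(1))
      show "p \<in> fst c'" using l(2,3) by (simp add: c'_def)
      show "charts_compatible d c'" if "d \<in> A" for d
        by (rule cc(2)[OF ch[OF that] cmp[OF that l(1)]])
      show "metrics_agree d c' (g d) (diag_metric (model_u J) (model_v J))" if "d \<in> A" for d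
        by (rule cc(3)[OF ch[OF that] cmp[OF that l(1)] ag[OF that l(1)] iso])
      show "K x = model_K J (snd c' x $ 1)" if "x \<in> fst c'" for x
        using that kap[of "snd c x"] in_chart_apply[OF ch[OF l(1)], of x K] by (simp add: c'_def)
    qed
    then show "\<exists>c'. is_chart M c' \<and> p \<in> fst c' \<and> (\<forall>c\<in>A. charts_compatible c c' \<and>
        metrics_agree c c' (g c) (diag_metric (model_u J) (model_v J))) \<and> (\<forall>x\<in>fst c'. K x = model_K J (snd c' x $ 1))"
      by blast
  qed
  consider "J < 0" | "J > 0" | "J = 0" by linarith
  then show "(\<exists>c>0. locally_equivalent_on M A g K C
        (diag_metric (\<lambda>u. c * cosh u ^ 4) (\<lambda>u. c * sinh u ^ 2)) (\<lambda>u. 1 / (c * cosh u ^ 4))) \<or>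
     (\<exists>c>0. locally_equivalent_on M A g K C
        (diag_metric (\<lambda>u. c * sinh u ^ 4) (\<lambda>u. c * cosh u ^ 2)) (\<lambda>u. 1 / (c * sinh u ^ 4))) \<or>
     locally_equivalent_on M A g K C
        (diag_metric (\<lambda>u. u ^ 2) (\<lambda>u. u ^ 2)) (\<lambda>u. 1 / u ^ 4)"
  proof cases
    case 1
    then show ?thesis
      using main unfolding model_u_def[abs_def] model_v_def[abs_def] model_K_def[abs_def]
      by (intro disjI1 exI[of _ "J\<^sup>2"]) simp
  next
    case 2
    then show ?thesis
      using main unfolding model_u_def[abs_def] model_v_def[abs_def] model_K_def[abs_def]
      by (intro disjI2 disjI1 exI[of _ "J\<^sup>2"]) simp
  next
    case 3
    then show ?thesis
      using main unfolding model_u_def[abs_def] model_v_def[abs_def] model_K_def[abs_def]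
      by (intro disjI2) simp
  qed
qed

end
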